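(* Let $\rho\in[0,\infty)$, $\alpha,\beta\in\mathbb{R}$ with $2\beta<\alpha+1$, let $x_0\ge0$ and let $X$ be the solution (for $\alpha\le-1$: the pathwise unique nonnegative strong solution) of $$dX_t=dB_t+\rho\,\mathrm{sgn}(X_t)\frac{|X_t|^\alpha}{t^\beta}\,dt,\qquad t\ge1,\quad X_1=x_0,$$ with explosion time $\tau_e$. Then $X$ is transient, and: (a) when $\alpha\in(-\infty,1)$, $$\lim_{t\to\infty}\frac{|X_t|}{t^{\frac{1-\beta}{1-\alpha}}}=\left(\frac{\rho(1-\alpha)}{1-\beta}\right)^{\frac{1}{1-\alpha}}\quad\text{a.s.};$$ (b) when $\alpha\in(1,\infty)$, with $\gamma:=\frac{2\beta}{\alpha+1}$ and $\varphi_\gamma(s):=(1+(1-\gamma)s)^{\frac{1}{1-\gamma}}$, $$|X_t|\sim\frac{\varphi_\gamma^{\frac{\gamma}{\alpha-1}}\big(\varphi_\gamma^{-1}(\tau_e)\big)\cdot\tau_e^{\frac{\gamma}{2}}}{\big(\rho(\alpha-1)(\tau_e-t)\big)^{\frac{1}{\alpha-1}}}\quad\text{a.s. as }t\to\tau_e;$$ (c) when $\alpha=1$, $$\lim_{t\to\infty}\frac{X_t}{\exp\left(\frac{\rho\,t^{1-\beta}}{1-\beta}\right)}=G\quad\text{a.s.},$$ where $G\sim\mathcal N(m,\sigma^2)$ with $m:=x_0\exp\left(\frac{\rho}{\beta-1}\right)$ and $\sigma^2:=\int_1^\infty\exp\left(\frac{2\rho\,s^{1-\beta}}{\beta-1}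\right)ds$.
   Context: $B$ is a standard Brownian motion; $\mathrm{sgn}$ is the sign function; $\tau_e=\sup_n\inf\{t\ge1:|X_t|\ge n\}$ (finite a.s. when $\alpha>1$ in this regime). $X$ is transient if $|X_t|\to\infty$ a.s. as $t\to\tau_e$. Note $\gamma<1$ here, so $\varphi_\gamma$ is an increasing bijection of $[0,\infty)$ onto $[1,\infty)$.
   Formalization: The formal theorem assumes ρ > 0 instead of ρ ∈ [0,∞): for ρ = 0, X is a Brownian motion, which is recurrent rather than transient (and σ² in (c) is infinite), so the statement fails there. *)

theory Defs
  imports "HOL-Probability.Probability"
begin

definition std_brownian_motion :: "'a measure \<Rightarrow> (real \<Rightarrow> 'a \<Rightarrow> real) \<Rightarrow> bool" where
  "std_brownian_motion M B \<longleftrightarrow>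
     prob_space M \<and>
     (\<forall>t\<ge>0. B t \<in> borel_measurable M) \<and>
     (\<forall>\<omega>\<in>space M. B 0 \<omega> = 0 \<and> continuous_on {0..} (\<lambda>t. B t \<omega>)) \<and>
     (\<forall>s t. 0 \<le> s \<and> s < t \<longrightarrow>
        distributed M lborel (\<lambda>\<omega>. B t \<omega> - B s \<omega>) (normal_density 0 (sqrt (t - s)))) \<and>
     (\<forall>(n::nat) (ts::nat \<Rightarrow> real). 0 \<le> ts 0 \<and> (\<forall>i<n. ts i < ts (Suc i)) \<longrightarrow>
        prob_space.indep_vars M (\<lambda>_. borel) (\<lambda>i \<omega>. B (ts (Suc i)) \<omega> - B (ts i) \<omega>) {..<n})"

definition nat_filtration :: "'a measure \<Rightarrow> (real \<Rightarrow> 'a \<Rightarrow> real) \<Rightarrow> real \<Rightarrow> 'a measure" where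
  "nat_filtration M B t =
     sigma (space M) (\<Union>s\<in>{0..t}. {B s -` A \<inter> space M | A. A \<in> sets borel})"

definition drift :: "real \<Rightarrow> real \<Rightarrow> real \<Rightarrow> real \<Rightarrow> real \<Rightarrow> real" where
  "drift \<rho> \<alpha> \<beta> t x = \<rho> * sgn x * \<bar>x\<bar> powr \<alpha> / t powr \<beta>"

text \<open>X is a (strong) solution on [1, tau) with X_1 = x0, and tau is its explosion time:
  either tau = infinity or |X| is unbounded on [1, tau) (with continuous paths this is
  exactly tau = sup_n inf {t \<ge> 1. |X_t| \<ge> n}).  Strong: X_t on {t < tau} and the event
  {t < tau} are a.s. equal to objects measurable w.r.t. the natural filtration of B.\<close>
definition sde_solution ::
  "'a measure \<Rightarrow> (real \<Rightarrow> 'a \<Rightarrow> real) \<Rightarrow> real \<Rightarrow> real \<Rightarrow> real \<Rightarrow> real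
    \<Rightarrow> (real \<Rightarrow> 'a \<Rightarrow> real) \<Rightarrow> ('a \<Rightarrow> ereal) \<Rightarrow> bool" where
  "sde_solution M B \<rho> \<alpha> \<beta> x0 X \<tau> \<longleftrightarrow>
     (\<forall>\<omega>\<in>space M. 1 < \<tau> \<omega>) \<and>
     (AE \<omega> in M.
        continuous_on {t. 1 \<le> t \<and> ereal t < \<tau> \<omega>} (\<lambda>t. X t \<omega>) \<and>
        X 1 \<omega> = x0 \<and>
        (\<forall>t. 1 \<le> t \<and> ereal t < \<tau> \<omega> \<longrightarrow>
           set_integrable lborel {1..t} (\<lambda>s. drift \<rho> \<alpha> \<beta> s (X s \<omega>)) \<and>
           X t \<omega> = x0 + (B t \<omega> - B 1 \<omega>) + (LBINT s:{1..t}. drift \<rho> \<alpha> \<beta> s (X s \<omega>))) \<and>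
        (\<tau> \<omega> = \<infinity> \<or> (\<forall>n::real. \<exists>t. 1 \<le> t \<and> ereal t < \<tau> \<omega> \<and> n \<le> \<bar>X t \<omega>\<bar>))) \<and>
     (\<forall>t\<ge>1. \<exists>g\<in>borel_measurable (nat_filtration M B t). \<exists>A\<in>sets (nat_filtration M B t).
        AE \<omega> in M. (ereal t < \<tau> \<omega> \<longleftrightarrow> \<omega> \<in> A) \<and> (ereal t < \<tau> \<omega> \<longrightarrow> X t \<omega> = g \<omega>))"

definition to_expl :: "ereal \<Rightarrow> real filter" where
  "to_expl T = (if T = \<infinity> then at_top else at_left (real_of_ereal T))"

definition phi_gamma :: "real \<Rightarrow> real \<Rightarrow> real" where
  "phi_gamma \<gamma> s = (1 + (1 - \<gamma>) * s) powr (1 / (1 - \<gamma>))"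

end

theory Submission
  imports Defs "HOL-Real_Asymp.Real_Asymp"
begin

text \<open>The noise is additive, so \<open>X - B\<close> is differentiable away from the zeros of \<open>X\<close> and almost everything is a pathwise
  analysis of an ordinary differential equation. Since \<open>2 * \<beta> < \<alpha> + 1\<close>, at the diffusive scale \<open>\<bar>x\<bar> = c * sqrt t\<close> the drift
  beats the noise by a power of \<open>t\<close>: a path of the noise with the growth and oscillation bounds of Brownian motion
  cannot bring a solution back once \<open>\<bar>X\<bar>\<close> has reached this scale at a late time, and it is driven beyond \<open>t powr q\<close> for some \<open>q > 1/2\<close>.
  From there on, l'Hopital's rule applied to \<open>(X - B) powr (1 - \<alpha>)\<close> gives the asymptotics.

  The scale \<open>c * sqrt t\<close> is reached because the drift points away from \<open>0\<close>: the expectation of \<open>X\<^sup>2\<close> grows at least like \<open>t\<close>,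
  so \<open>X\<close> stays below \<open>c * sqrt r\<close> on the whole of \<open>{r..2*r}\<close> with probability at most \<open>c\<^sup>2\<close>. Only this step uses adaptedness,
  and it cannot be dropped: \<open>0\<close> is an unstable equilibrium near which a solution that knows the future could remain.

  For \<open>\<alpha> = 1\<close> the equation is linear and the limit is a Wiener integral, which is nonzero almost surely.\<close>

section \<open>Paths of the equation\<close>

text \<open>The powers behind the comparison of drift and noise: at height \<open>sqrt t\<close> the
  drift has size \<open>t powr (\<alpha>/2 - \<beta>)\<close>, so in a time of order
  \<open>t\<close> it moves the path by \<open>t powr (\<alpha>/2 - \<beta> + 1)\<close>, and
  \<open>2 * \<beta> < \<alpha> + 1\<close> says exactly that this exponent exceeds 1/2. The surplus
  \<open>(\<alpha> + 1 - 2 * \<beta>) / 2\<close> pays for a small \<epsilon>: windows of length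
  \<open>t powr (1 - \<epsilon>)\<close>, noise of size at most
  \<open>t powr (1/2 + \<epsilon>/2)\<close> and a target height
  \<open>t powr (1/2 + \<epsilon>)\<close>.

  The obstacle near 0 is that for negative \<alpha> the drift is unbounded there and merely
  integrable along the path. The second-moment argument therefore uses only the sign of the drift
  and the integral of its modulus, and it works on finite meshes with the independence and the
  moments of the increments of the noise. It bounds a probability and yields no almost sure
  statement for a fixed \<open>c\<close>; since \<open>c\<^sup>2\<close> is arbitrarily small, the
  almost sure statement holds with a \<open>c\<close> that depends on the path.\<close>

lemma continuous_bounded_Icc:
  fixes g :: "real \<Rightarrow> real"
  assumes "continuous_on {a..b} g"
  obtains K where "K > 0" "\<And>s. a \<le> s \<Longrightarrow> s \<le> b \<Longrightarrow> \<bar>g s\<bar> \<le> K"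
proof -
  have "compact (g ` {a..b})" by (intro compact_continuous_image assms) auto
  then obtain K where "K > 0" "\<And>y. y \<in> g ` {a..b} \<Longrightarrow> norm y \<le> K"
    using compact_imp_bounded bounded_pos by metis
  then show thesis using that[of K] by auto
qed

text \<open>A single trajectory with the randomness frozen, so that \<open>b\<close> is just a
  continuous function. Integrability of the drift is part of the notion of solution: for \<alpha> <
  0 the drift is unbounded near the zeros of \<open>x\<close>.\<close>

locale sde_path =
  fixes \<rho> \<alpha> \<beta> :: real and b x :: "real \<Rightarrow> real" and T :: ereal
  assumes rho: "\<rho> > 0"
    and cont_b: "continuous_on {1..} b"
    and T_gt: "1 < T"
    and cont_x: "continuous_on {t. 1 \<le> t \<and> ereal t < T} x"
    and int_x: "\<And>t. 1 \<le> t \<Longrightarrow> ereal t < T \<Longrightarrow> set_integrable lborel {1..t} (\<lambda>s. drift \<rho> \<alpha> \<beta> s (x s))"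
    and eq_x: "\<And>t. 1 \<le> t \<Longrightarrow> ereal t < T \<Longrightarrow>
           x t = x 1 + (b t - b 1) + (LBINT s:{1..t}. drift \<rho> \<alpha> \<beta> s (x s))"
    and expl: "T = \<infinity> \<or> (\<forall>n::real. \<exists>t. 1 \<le> t \<and> ereal t < T \<and> n \<le> \<bar>x t\<bar>)"
begin

abbreviation f where "f t \<equiv> drift \<rho> \<alpha> \<beta> t (x t)"

lemma lt_T: "s \<le> t \<Longrightarrow> ereal t < T \<Longrightarrow> ereal s < T"
  by (metis ereal_less_eq(3) le_less_trans)

lemma cont_x': "1 \<le> s \<Longrightarrow> ereal t < T \<Longrightarrow> continuous_on {s..t} x"
  by (rule continuous_on_subset[OF cont_x]) (auto intro: lt_T)

lemma cont_b': "1 \<le> s \<Longrightarrow> continuous_on {s..t} b"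
  by (rule continuous_on_subset[OF cont_b]) auto

lemma set_int: "1 \<le> s \<Longrightarrow> ereal t < T \<Longrightarrow> set_integrable lborel {s..t} f"
proof (cases "s \<le> t")
  case True
  assume "1 \<le> s" "ereal t < T"
  then show ?thesis using True
    by (intro set_integrable_subset[OF int_x[of t]]) auto
qed (simp add: set_integrable_def)

lemma hk_int: "1 \<le> s \<Longrightarrow> ereal t < T \<Longrightarrow> f integrable_on {s..t}"
  using set_borel_integral_eq_integral(1)[OF set_int] by blast

lemma incr:
  assumes "1 \<le> s" "s \<le> t" "ereal t < T"
  shows "x t - x s = b t - b s + integral {s..t} f"
proof -
  have *: "x u = x 1 + (b u - b 1) + integral {1..u} f" if "1 \<le> u" "ereal u < T" for u
    using eq_x[OF that] set_borel_integral_eq_integral(2)[OF int_x[OF that]] by simp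
  have "integral {1..s} f + integral {s..t} f = integral {1..t} f"
    using assms by (intro Henstock_Kurzweil_Integration.integral_combine hk_int) auto
  with *[of t] *[of s] assms lt_T[OF assms(2,3)] show ?thesis by simp
qed

lemma f_nonneg: "x t \<ge> 0 \<Longrightarrow> f t \<ge> 0"
  using rho by (simp add: drift_def)

lemma incr_pos:
  assumes "1 \<le> s" "s \<le> t" "ereal t < T" "\<And>u. u \<in> {s..t} \<Longrightarrow> 0 \<le> x u"
  shows "b t - b s \<le> x t - x s"
proof -
  have "integral {s..t} f \<ge> 0"
    using assms by (intro Henstock_Kurzweil_Integration.integral_nonneg hk_int) (auto intro: f_nonneg)
  then show ?thesis using incr[OF assms(1-3)] by simp
qed

text \<open>While \<open>x\<close> is nonnegative the drift only pushes it up, so \<open>x\<close>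
  loses at most what the noise takes away. If the noise moves by at most \<open>d < x s\<close>, the
  path cannot arrive at a first time \<open>v\<close> with \<open>x v \<le> 0\<close>, since up to
  \<open>v\<close> it has lost at most \<open>d\<close>.\<close>

lemma stays:
  assumes "1 \<le> s" "s \<le> t" "ereal t < T" "\<And>u. u \<in> {s..t} \<Longrightarrow> \<bar>b u - b s\<bar> \<le> d" "d < x s"
  shows "x s - d \<le> x t"
proof -
  have pos: "0 < x u" if "u \<in> {s..t}" for u
  proof (rule ccontr)
    assume "\<not> 0 < x u"
    define S where "S = {s..u} \<inter> {v. x v \<le> 0}"
    have uS: "u \<in> S" using that \<open>\<not> 0 < x u\<close> by (auto simp: S_def)
    have uT: "ereal u < T" using that assms lt_T by auto
    have "closed S" unfolding S_def
      using continuous_closed_preimage[OF cont_x'[OF assms(1) uT], of "{..0}"]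
      by (simp add: vimage_def Int_def)
    moreover have "bdd_below S" by (auto simp: S_def intro!: bdd_belowI[of _ s])
    ultimately have inS: "Inf S \<in> S" using uS closed_contains_Inf by blast
    define v where "v = Inf S"
    have v: "s \<le> v" "v \<le> u" "x v \<le> 0" using inS by (auto simp: S_def v_def)
    have before: "x w > 0" if "s \<le> w" "w < v" for w
    proof (rule ccontr)
      assume "\<not> x w > 0"
      then have "w \<in> S" using that v by (auto simp: S_def)
      then have "v \<le> w" unfolding v_def by (intro cInf_lower) (auto simp: S_def intro!: bdd_belowI[of _ s])
      then show False using that by simp
    qed
    have sv: "s < v" using v assms(4)[of s] assms(2,5) by (cases "s = v") auto
    have vT: "ereal v < T" using v uT lt_T by blast
    \<comment> \<open>Positivity before \<open>v\<close> passes to the left limit, so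
      \<open>incr_pos\<close> applies on the closed interval \<open>{s..v}\<close>.\<close>
    have "x v \<ge> 0"
    proof (rule tendsto_lowerbound)
      have "continuous (at v within {s..v}) x"
        using cont_x'[OF assms(1) vT] sv by (auto simp: continuous_on_eq_continuous_within)
      then show "(x \<longlongrightarrow> x v) (at_left v)"
        using sv by (simp add: continuous_within at_within_Icc_at_left)
      show "eventually (\<lambda>w. 0 \<le> x w) (at_left v)"
        using sv before by (auto simp: eventually_at_left intro!: exI[of _ s] less_imp_le)
    qed auto
    then have "0 \<le> x w" if "w \<in> {s..v}" for w
      using before[of w] that by (cases "w = v") auto
    from incr_pos[OF assms(1) v(1) vT this] have "b v - b s \<le> x v - x s" .
    moreover have "\<bar>b v - b s\<bar> \<le> d" using v that assms(4)[of v] by auto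
    ultimately show False using v assms(5) by linarith
  qed
  have "b t - b s \<le> x t - x s"
    by (rule incr_pos) (use assms pos in \<open>auto intro: less_imp_le\<close>)
  moreover have "\<bar>b t - b s\<bar> \<le> d" using assms by auto
  ultimately show ?thesis by linarith
qed

text \<open>\<open>x\<close> inherits the roughness of \<open>b\<close>, but in \<open>x - b\<close>
  the noise cancels and the integral of the drift remains. As long as \<open>x\<close> stays away
  from 0 the integrand is continuous, whatever the sign of \<alpha>.\<close>

lemma deriv_pos:
  assumes "1 < t" "ereal t < T" "x t > 0"
  shows "((\<lambda>u. x u - b u) has_real_derivative \<rho> * x t powr \<alpha> / t powr \<beta>) (at t)"
proof -
  obtain t1 where t1: "t < t1" "ereal t1 < T"
    using ereal_dense2[OF assms(2)] by auto
  have "continuous_on {1..t1} x" using cont_x'[of 1 t1] t1 by auto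
  then have "isCont x t" using assms t1
    by (intro continuous_on_interior[of "{1..t1}"]) auto
  then have "eventually (\<lambda>u. x u > 0) (at t)"
    using assms(3) by (simp add: isCont_def order_tendstoD)
  then obtain d where d: "d > 0" "\<And>u. u \<noteq> t \<Longrightarrow> dist u t < d \<Longrightarrow> x u > 0"
    by (auto simp: eventually_at)
  define e where "e = min (d/2) (min (t - 1) (t1 - t))"
  have e: "e > 0" "e \<le> d/2" "e \<le> t - 1" "e \<le> t1 - t"
    using d t1 assms by (auto simp: e_def min_def)
  define l r where "l = t - e" and "r = t + e"
  have lr: "1 \<le> l" "l < t" "t < r" "ereal r < T" using e t1 lt_T[of r t1] by (auto simp: l_def r_def)
  have pos: "x u > 0" if "u \<in> {l..r}" for u
    using that e d(2)[of u] assms(3) by (cases "u = t") (auto simp: l_def r_def dist_real_def)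
  have cf: "continuous_on {l..r} f"
  proof -
    have "continuous_on {l..r} (\<lambda>t. \<rho> * x t powr \<alpha> / t powr \<beta>)"
      using lr pos by (intro continuous_intros cont_x') force+
    then show ?thesis
      by (rule continuous_on_eq) (use pos in \<open>auto simp: drift_def less_imp_le dest!: pos\<close>)
  qed
  have "((\<lambda>u. x l - b l + integral {l..u} f) has_real_derivative f t) (at t within {l..r})"
    using integral_has_real_derivative[OF cf, of t] lr by (auto intro!: derivative_eq_intros)
  then have "((\<lambda>u. x l - b l + integral {l..u} f) has_real_derivative f t) (at t)"
    using lr by (simp add: at_within_Icc_at)
  moreover have "f t = \<rho> * x t powr \<alpha> / t powr \<beta>" using assms by (simp add: drift_def)
  moreover have "\<forall>\<^sub>F u in nhds t. x l - b l + integral {l..u} f = x u - b u"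
  proof -
    have "\<forall>\<^sub>F u in nhds t. u \<in> {l<..<r}" using lr by (intro eventually_nhds_in_open) auto
    then show ?thesis
    proof eventually_elim
      case (elim u)
      then have "ereal u < T" using lr lt_T[of u r] by auto
      then show ?case using incr[of l u] lr elim by simp
    qed
  qed
  ultimately show ?thesis
    by (subst DERIV_cong_ev[symmetric, OF refl _ refl]) auto
qed

text \<open>The drift is odd in space. Hence facts about large positive values of \<open>x\<close>
  carry over to large negative values, and the pathwise lemmas below only treat the upper
  side.\<close>

lemma neg: "sde_path \<rho> \<alpha> \<beta> (\<lambda>t. - b t) (\<lambda>t. - x t) T"
proof -
  have *: "drift \<rho> \<alpha> \<beta> s (- x s) = - drift \<rho> \<alpha> \<beta> s (x s)" for s
    by (simp add: drift_def sgn_minus)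
  show ?thesis
  proof
    fix t assume t: "1 \<le> t" "ereal t < T"
    show "set_integrable lborel {1..t} (\<lambda>s. drift \<rho> \<alpha> \<beta> s (- x s))"
      using set_integral_uminus(1)[OF int_x[OF t]] int_x[OF t] unfolding * set_integrable_def by simp
    show "- x t = - x 1 + (- b t - - b 1) + (LBINT s:{1..t}. drift \<rho> \<alpha> \<beta> s (- x s))"
      using eq_x[OF t] unfolding * set_lebesgue_integral_def by simp
  qed (use rho T_gt cont_x cont_b expl in \<open>auto intro: continuous_intros\<close>)
qed

end

text \<open>Restarting a path at its last visit to level \<open>m\<close> keeps the remaining piece
  above \<open>m\<close>, where the drift can be estimated. In reversed time the same statement
  provides a first hitting time.\<close>

lemma last_exit:
  fixes x :: "real \<Rightarrow> real"
  assumes "continuous_on {s..t} x" "s \<le> t" "x s \<le> m" "m \<le> x t"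
  obtains u where "u \<in> {s..t}" "x u = m" "\<And>v. v \<in> {u..t} \<Longrightarrow> m \<le> x v"
proof -
  define S where "S = {s..t} \<inter> {v. x v \<le> m}"
  have "closed S" unfolding S_def
    using continuous_closed_preimage[OF assms(1), of "{..m}"] by (simp add: vimage_def Int_def)
  moreover have bdd: "bdd_above S" by (auto simp: S_def intro!: bdd_aboveI[of _ t])
  moreover have "s \<in> S" using assms by (auto simp: S_def)
  ultimately have inS: "Sup S \<in> S" using closed_contains_Sup by blast
  define u where "u = Sup S"
  have u: "s \<le> u" "u \<le> t" "x u \<le> m" using inS by (auto simp: S_def u_def)
  have gt: "m < x v" if "u < v" "v \<le> t" for v
  proof (rule ccontr)
    assume "\<not> m < x v"
    then have "v \<in> S" using that u by (auto simp: S_def)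
    then show False using cSup_upper[OF _ bdd] that u_def by fastforce
  qed
  have "\<exists>w\<ge>u. w \<le> t \<and> x w = m"
    by (rule IVT') (use u assms in \<open>auto intro: continuous_on_subset\<close>)
  then obtain w where "u \<le> w" "w \<le> t" "x w = m" by auto
  with gt[of w] have "w = u" by (cases "w = u") auto
  then have "x u = m" using \<open>x w = m\<close> by simp
  show thesis
    by (rule that[of u]) (use u \<open>x u = m\<close> gt in \<open>auto simp: le_less\<close>)
qed

section \<open>Explosion: excluded for \<alpha> \<le> 1, and its rate for \<alpha> > 1\<close>

context sde_path
begin

lemma b_bounded: obtains M where "M > 0" "\<And>u. 1 \<le> u \<Longrightarrow> u \<le> r \<Longrightarrow> \<bar>b u\<bar> \<le> M"
  using continuous_bounded_Icc[OF cont_b'[OF order_refl, of r]] by blast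

text \<open>Gronwall's argument on the last stretch above \<open>m\<close>. There
  \<open>x \<ge> 1\<close>, so \<alpha> \<le> 1 makes the drift at most \<open>L * x\<close>, hence
  at most \<open>L * (x - b + M)\<close>, and \<open>x - b + M\<close> is differentiable. The
  integrating factor \<open>exp (- L * u)\<close> then makes \<open>z\<close> nonincreasing.\<close>

lemma upper_bound:
  assumes "\<alpha> \<le> 1" "T = ereal r"
  shows "\<exists>C. \<forall>t. 1 \<le> t \<and> t < r \<longrightarrow> x t \<le> C"
proof -
  obtain M where M: "M > 0" "\<And>u. 1 \<le> u \<Longrightarrow> u \<le> r \<Longrightarrow> \<bar>b u\<bar> \<le> M" using b_bounded by blast
  have r: "1 < r" using T_gt assms by simp
  have "continuous_on {1..r} (\<lambda>u::real. 1 / u powr \<beta>)" by (intro continuous_intros) auto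
  then obtain K where K: "K > 0" "\<And>u. 1 \<le> u \<Longrightarrow> u \<le> r \<Longrightarrow> \<bar>1 / u powr \<beta>\<bar> \<le> K"
    by (rule continuous_bounded_Icc) blast
  define m where "m = max 1 (x 1)"
  define L where "L = \<rho> * K"
  have L: "L > 0" using rho K by (simp add: L_def)
  define C where "C = (m + 2 * M) * exp (L * r)"
  have mC: "m \<le> C"
  proof -
    have "1 \<le> exp (L * r)" using L r by simp
    then have "(m + 2 * M) * 1 \<le> C" unfolding C_def using M(1) by (intro mult_left_mono) (auto simp: m_def)
    then show ?thesis using M by simp
  qed
  have "x t \<le> C" if t: "1 \<le> t" "t < r" for t
  proof (cases "x t \<le> m")
    case True then show ?thesis using mC by simp
  next
    case False
    have tT: "ereal t < T" using t assms by simp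
    obtain s where s: "s \<in> {1..t}" "x s = m" "\<And>v. v \<in> {s..t} \<Longrightarrow> m \<le> x v"
    proof (rule last_exit[OF cont_x'[OF order_refl tT], of m])
      show "x 1 \<le> m" by (simp add: m_def)
    qed (use t False in auto)
    have st: "s < t" using s False by (cases "s = t") auto
    define z where "z u = (x u - b u + M) * exp (- L * u)" for u
    have "z t \<le> z s"
    proof (rule DERIV_nonpos_imp_decreasing_open[OF less_imp_le[OF st]])
      fix u assume u: "s < u" "u < t"
      then have u1: "1 < u" "ereal u < T" using s t assms by auto
      have xu: "x u \<ge> 1" using s(3)[of u] u by (auto simp: m_def)
      have "(z has_real_derivative (\<rho> * x u powr \<alpha> / u powr \<beta>) * exp (- L * u)
               + exp (- L * u) * (- L) * (x u - b u + M)) (at u)"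
      proof -
        have 1: "((\<lambda>u. x u - b u + M) has_real_derivative \<rho> * x u powr \<alpha> / u powr \<beta>) (at u)"
          using DERIV_add[OF deriv_pos[OF u1] DERIV_const[of M]] xu by simp
        have 2: "((\<lambda>u. exp (- L * u)) has_real_derivative exp (- L * u) * (- L)) (at u)"
          by (auto intro!: derivative_eq_intros)
        show ?thesis using DERIV_mult[OF 1 2] unfolding z_def .
      qed
      moreover have "(\<rho> * x u powr \<alpha> / u powr \<beta>) * exp (- L * u)
               + exp (- L * u) * (- L) * (x u - b u + M) \<le> 0"
      proof -
        have "x u powr \<alpha> \<le> x u powr 1" using xu assms(1) by (intro powr_mono) auto
        then have "\<rho> * x u powr \<alpha> * (1 / u powr \<beta>) \<le> \<rho> * x u * K"
          using rho K(2)[of u] u1 u t xu by (intro mult_mono) auto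
        also have "\<dots> = L * x u" by (simp add: L_def)
        also have "\<dots> \<le> L * (x u - b u + M)" using L M(2)[of u] u1 u t by (intro mult_left_mono) auto
        finally have "\<rho> * x u powr \<alpha> / u powr \<beta> - L * (x u - b u + M) \<le> 0" by simp
        then have "exp (- L * u) * (\<rho> * x u powr \<alpha> / u powr \<beta> - L * (x u - b u + M)) \<le> 0"
          by (intro mult_nonneg_nonpos) auto
        then show ?thesis by (simp add: algebra_simps)
      qed
      ultimately show "\<exists>y. (z has_real_derivative y) (at u) \<and> y \<le> 0" by blast
    next
      show "continuous_on {s..t} z" unfolding z_def
        using s by (intro continuous_intros cont_x' cont_b') (auto simp: tT)
    qed
    then have "(x t - b t + M) * exp (- L * t) \<le> (m - b s + M) * exp (- L * s)"
      using s by (simp add: z_def)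
    then have "(x t - b t + M) * exp (- L * t) * exp (L * t) \<le> (m - b s + M) * exp (- L * s) * exp (L * t)"
      by (intro mult_right_mono) auto
    then have "x t - b t + M \<le> (m - b s + M) * exp (L * (t - s))"
      by (simp add: mult.assoc exp_add[symmetric] algebra_simps)
    also have "\<dots> \<le> (m + 2 * M) * exp (L * r)"
      using M(2)[of s] s t L st by (intro mult_mono) (auto simp: m_def)
    finally show ?thesis using M(2)[of t] t by (simp add: C_def)
  qed
  then show ?thesis by blast
qed

lemma no_explosion:
  assumes "\<alpha> \<le> 1"
  shows "T = \<infinity>"
proof (rule ccontr)
  assume "T \<noteq> \<infinity>"
  then obtain r where r: "T = ereal r" using T_gt by (cases T) auto
  obtain C where C: "\<And>t. 1 \<le> t \<Longrightarrow> t < r \<Longrightarrow> x t \<le> C" using upper_bound[OF assms r] by blast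
  obtain C' where C': "\<And>t. 1 \<le> t \<Longrightarrow> t < r \<Longrightarrow> - x t \<le> C'"
    using sde_path.upper_bound[OF neg assms r] by blast
  obtain t where "1 \<le> t" "t < r" "max C C' + 1 \<le> \<bar>x t\<bar>"
    using expl r by (metis less_ereal.simps(1) PInfty_neq_ereal(1))
  then show False using C[of t] C'[of t] by (auto simp: abs_if split: if_splits)
qed

text \<open>On a bounded time interval the noise oscillates by at most \<open>2 * M\<close>. Once
  above that level the path keeps its sign and later loses at most \<open>2 * M\<close> from any
  height reached, which turns unboundedness into divergence.\<close>

lemma explosion_up:
  assumes T: "T = ereal r" and M: "\<And>u. 1 \<le> u \<Longrightarrow> u \<le> r \<Longrightarrow> \<bar>b u\<bar> \<le> M"
    and t0: "1 \<le> t0" "t0 < r" "2 * M < x t0"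
  shows "filterlim x at_top (at_left r)"
proof -
  have stay: "x s - 2 * M \<le> x t" if "1 \<le> s" "s \<le> t" "t < r" "2 * M < x s" for s t
  proof (rule stays)
    fix u assume "u \<in> {s..t}"
    then show "\<bar>b u - b s\<bar> \<le> 2 * M" using M[of u] M[of s] that by auto
  qed (use that T in auto)
  have "continuous_on {1..t0} x" using t0 T by (intro cont_x') auto
  then obtain N where N: "\<And>u. 1 \<le> u \<Longrightarrow> u \<le> t0 \<Longrightarrow> \<bar>x u\<bar> \<le> N"
    by (rule continuous_bounded_Icc) blast
  have M0: "0 \<le> M" using M[of 1] t0 by auto
  show ?thesis unfolding filterlim_at_top
  proof
    fix Z :: real
    obtain t1 where t1: "1 \<le> t1" "t1 < r" "max (N + 1) (\<bar>Z\<bar> + 2 * M + 1) \<le> \<bar>x t1\<bar>"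
      using expl T by (metis less_ereal.simps(1) PInfty_neq_ereal(1))
    \<comment> \<open>\<open>N\<close> bounds the path up to \<open>t0\<close>, so a value beyond
      \<open>N\<close> can only be taken later, where the sign is already known to be
      positive.\<close>
    have "t0 < t1" using N[of t1] t1 by force
    then have "0 < x t1" using stay[of t0 t1] t0 t1 by auto
    then have "2 * M < x t1" using t1 by linarith
    then have "Z \<le> x v" if "v \<in> {t1<..<r}" for v
      using stay[of t1 v] t1 that M0 \<open>2 * M < x t1\<close> \<open>0 < x t1\<close> by auto
    then show "\<forall>\<^sub>F v in at_left r. Z \<le> x v"
      using t1 by (auto simp: eventually_at_left intro!: exI[of _ t1])
  qed
qed

lemma explosion:
  assumes T: "T = ereal r"
  shows "filterlim x at_top (at_left r) \<or> filterlim (\<lambda>t. - x t) at_top (at_left r)"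
proof -
  obtain M where M: "M > 0" "\<And>u. 1 \<le> u \<Longrightarrow> u \<le> r \<Longrightarrow> \<bar>b u\<bar> \<le> M" using b_bounded by blast
  obtain t where t: "1 \<le> t" "t < r" "2 * M + 1 \<le> \<bar>x t\<bar>"
    using expl T by (metis less_ereal.simps(1) PInfty_neq_ereal(1))
  show ?thesis
  proof (cases "x t \<ge> 0")
    case True then show ?thesis using explosion_up[OF T M(2) t(1,2)] t by auto
  next
    case False then show ?thesis
      using sde_path.explosion_up[OF neg T _ t(1,2), of M] M t by auto
  qed
qed

text \<open>At a finite explosion time \<open>b\<close> stays bounded, so \<open>x / y\<close> tends
  to 1, and \<open>t powr (- \<beta>)\<close> tends to the constant
  \<open>r powr (- \<beta>)\<close>. Thus \<open>y powr (1 - \<alpha>)\<close>, which vanishes at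
  \<open>r\<close> because \<alpha> > 1, has a derivative tending to \<open>- l\<close> and is
  equivalent to \<open>l * (r - t)\<close>. Solving for \<open>x\<close> produces the factor
  \<open>r powr (\<beta> / (\<alpha> - 1))\<close>.\<close>

lemma explosion_asymp:
  assumes T: "T = ereal r" and lim: "filterlim x at_top (at_left r)" and al: "\<alpha> > 1"
  shows "((\<lambda>t. x t * (\<rho> * (\<alpha> - 1) * (r - t)) powr (1 / (\<alpha> - 1)) / r powr (\<beta> / (\<alpha> - 1))) \<longlongrightarrow> 1) (at_left r)"
proof -
  have r: "1 < r" using T_gt T by simp
  define y where "y u = x u - b u" for u
  have "(b \<longlongrightarrow> b r) (at_left r)"
    using cont_b r
    by (metis at_within_Icc_at_left cont_b' continuous_on_Icc_at_leftD order_refl)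
  have y: "filterlim y at_top (at_left r)"
    unfolding y_def using filterlim_tendsto_add_at_top[OF tendsto_minus[OF \<open>(b \<longlongrightarrow> b r) (at_left r)\<close>] lim] by simp
  have bx: "((\<lambda>t. b t / x t) \<longlongrightarrow> 0) (at_left r)"
    by (rule tendsto_divide_0[OF \<open>(b \<longlongrightarrow> b r) (at_left r)\<close>])
       (rule filterlim_at_top_imp_at_infinity[OF lim])
  have xpos: "\<forall>\<^sub>F t in at_left r. 0 < x t" "\<forall>\<^sub>F t in at_left r. 0 < y t"
    using lim y by (auto simp: filterlim_at_top_dense)
  have yx: "((\<lambda>t. y t / x t) \<longlongrightarrow> 1) (at_left r)"
  proof (rule Lim_transform_eventually)
    show "((\<lambda>t. 1 - b t / x t) \<longlongrightarrow> 1) (at_left r)"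
      using tendsto_diff[OF tendsto_const bx, of 1] by simp
    show "\<forall>\<^sub>F t in at_left r. 1 - b t / x t = y t / x t"
      using xpos(1) by eventually_elim (auto simp: y_def field_simps)
  qed
  have xy: "((\<lambda>t. x t / y t) \<longlongrightarrow> 1) (at_left r)"
    using tendsto_inverse[OF yx] by (simp add: inverse_eq_divide)
  have near: "\<forall>\<^sub>F t in at_left r. t \<in> {1<..<r}"
    using r by (auto simp: eventually_at_left intro!: exI[of _ 1])
  define l where "l = (\<alpha> - 1) * \<rho> * r powr (- \<beta>)"
  have l: "l > 0" using rho al r by (simp add: l_def)
  have "((\<lambda>t. y t powr (1 - \<alpha>) / (r - t)) \<longlongrightarrow> l) (at_left r)"
  proof (rule lhopital_left)
    show "((\<lambda>t. y t powr (1 - \<alpha>)) \<longlongrightarrow> 0) (at_left r)"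
      by (rule tendsto_neg_powr) (use al y in auto)
    show "((\<lambda>t. r - t) \<longlongrightarrow> 0) (at_left r)"
      by (auto intro!: tendsto_eq_intros)
    show "\<forall>\<^sub>F t in at_left r. r - t \<noteq> 0" using near by eventually_elim auto
    show "\<forall>\<^sub>F t in at_left r. -1 \<noteq> (0::real)" by simp
    show "\<forall>\<^sub>F t in at_left r. ((\<lambda>t. r - t) has_real_derivative -1) (at t)"
      by (auto intro!: always_eventually derivative_eq_intros)
    show "\<forall>\<^sub>F t in at_left r. ((\<lambda>t. y t powr (1 - \<alpha>)) has_real_derivative
       (1 - \<alpha>) * y t powr (- \<alpha>) * (\<rho> * x t powr \<alpha> / t powr \<beta>)) (at t)"
      using near xpos
    proof eventually_elim
      case (elim t)
      have "(y has_real_derivative (\<rho> * x t powr \<alpha> / t powr \<beta>)) (at t)"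
        unfolding y_def using elim T by (intro deriv_pos) auto
      from DERIV_fun_powr[OF this elim(3), of "1 - \<alpha>"] show ?case
        by (simp add: mult_ac)
    qed
    show "((\<lambda>t. (1 - \<alpha>) * y t powr (- \<alpha>) * (\<rho> * x t powr \<alpha> / t powr \<beta>) / -1) \<longlongrightarrow> l) (at_left r)"
    proof (rule Lim_transform_eventually)
      have "((\<lambda>t. (\<alpha> - 1) * \<rho> * (x t / y t) powr \<alpha> * t powr (- \<beta>)) \<longlongrightarrow> (\<alpha> - 1) * \<rho> * 1 powr \<alpha> * r powr (- \<beta>)) (at_left r)"
        using r by (intro tendsto_intros xy) auto
      then show "((\<lambda>t. (\<alpha> - 1) * \<rho> * (x t / y t) powr \<alpha> * t powr (- \<beta>)) \<longlongrightarrow> l) (at_left r)"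
        by (simp add: l_def)
      show "\<forall>\<^sub>F t in at_left r. (\<alpha> - 1) * \<rho> * (x t / y t) powr \<alpha> * t powr (- \<beta>)
          = (1 - \<alpha>) * y t powr (- \<alpha>) * (\<rho> * x t powr \<alpha> / t powr \<beta>) / -1"
        using near xpos
        by eventually_elim (simp add: powr_divide powr_minus field_simps)
    qed
  qed
  then have lim1: "((\<lambda>t. (y t powr (1 - \<alpha>) / (r - t)) powr (- 1 / (\<alpha> - 1)) * (x t / y t)) \<longlongrightarrow> l powr (- 1 / (\<alpha> - 1)) * 1) (at_left r)"
    using l by (intro tendsto_intros xy) auto
  have lim2: "((\<lambda>t. (y t powr (1 - \<alpha>) / (r - t)) powr (- 1 / (\<alpha> - 1)) * (x t / y t) *
      ((\<rho> * (\<alpha> - 1)) powr (1 / (\<alpha> - 1)) / r powr (\<beta> / (\<alpha> - 1)))) \<longlongrightarrow>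
      l powr (- 1 / (\<alpha> - 1)) * 1 * ((\<rho> * (\<alpha> - 1)) powr (1 / (\<alpha> - 1)) / r powr (\<beta> / (\<alpha> - 1)))) (at_left r)"
    by (rule tendsto_mult[OF lim1 tendsto_const])
  have eq: "l powr (- 1 / (\<alpha> - 1)) * 1 * ((\<rho> * (\<alpha> - 1)) powr (1 / (\<alpha> - 1)) / r powr (\<beta> / (\<alpha> - 1))) = 1"
  proof -
    have "l powr (- 1 / (\<alpha> - 1)) = (\<rho> * (\<alpha> - 1)) powr (- (1 / (\<alpha> - 1))) * (r powr (- \<beta>)) powr (- 1 / (\<alpha> - 1))"
      using rho al r by (simp add: l_def powr_mult mult.commute)
    also have "(r powr (- \<beta>)) powr (- 1 / (\<alpha> - 1)) = r powr (\<beta> / (\<alpha> - 1))"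
      by (simp add: powr_powr)
    finally show ?thesis using rho al r by (simp add: powr_minus field_simps)
  qed
  have ev: "\<forall>\<^sub>F t in at_left r. (y t powr (1 - \<alpha>) / (r - t)) powr (- 1 / (\<alpha> - 1)) * (x t / y t) *
      ((\<rho> * (\<alpha> - 1)) powr (1 / (\<alpha> - 1)) / r powr (\<beta> / (\<alpha> - 1))) =
     x t * (\<rho> * (\<alpha> - 1) * (r - t)) powr (1 / (\<alpha> - 1)) / r powr (\<beta> / (\<alpha> - 1))"
    using near xpos
  proof eventually_elim
    case (elim t)
    have "(y t powr (1 - \<alpha>) / (r - t)) powr (- 1 / (\<alpha> - 1)) = y t powr ((1 - \<alpha>) * (- 1 / (\<alpha> - 1))) / (r - t) powr (- (1 / (\<alpha> - 1)))"
      using elim by (simp add: powr_divide powr_powr)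
    also have "(1 - \<alpha>) * (- 1 / (\<alpha> - 1)) = 1" using al by (simp add: field_simps)
    finally have "(y t powr (1 - \<alpha>) / (r - t)) powr (- 1 / (\<alpha> - 1)) = y t * (r - t) powr (1 / (\<alpha> - 1))"
      using elim by (simp add: powr_minus field_simps)
    then show ?case using elim rho al by (simp add: powr_mult)
  qed
  show ?thesis using Lim_transform_eventually[OF lim2[unfolded eq] ev] .
qed

end

section \<open>Escape to a superdiffusive scale and growth on an infinite horizon\<close>

lemma powr_dominates:
  fixes a e C K :: real
  assumes "a < e" "K > 0"
  shows "\<forall>\<^sub>F t in at_top. C * t powr a < K * t powr e"
proof -
  have "filterlim (\<lambda>t::real. t powr (e - a)) at_top at_top"
    using assms by real_asymp
  then have "\<forall>\<^sub>F t in at_top. t powr (e - a) > C / K"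
    by (auto simp: filterlim_at_top_dense)
  then show ?thesis using eventually_gt_at_top[of 0]
  proof eventually_elim
    case (elim t)
    then have "C < K * t powr (e - a)" using assms by (simp add: field_simps)
    then have "C * t powr a < K * t powr (e - a) * t powr a"
      using elim by (intro mult_strict_right_mono) auto
    also have "\<dots> = K * t powr e" by (simp add: powr_add[symmetric] mult.assoc)
    finally show ?case .
  qed
qed

text \<open>Bounds a power from below on a band \<open>{l..u}\<close> uniformly in the sign of the
  exponent; it is needed for the powers \<alpha> and \<open>- \<beta>\<close>, whose signs are both
  unknown.\<close>

lemma powr_ge_min:
  fixes l u y a :: real
  assumes "0 < l" "l \<le> y" "y \<le> u"
  shows "min (l powr a) (u powr a) \<le> y powr a"
proof (cases "a \<ge> 0")
  case True
  then have "l powr a \<le> y powr a" using assms by (intro powr_mono2) auto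
  then show ?thesis by simp
next
  case False
  then have "u powr a \<le> y powr a" using assms by (intro powr_mono2') auto
  then show ?thesis by simp
qed

context sde_path
begin

text \<open>The window \<open>t powr (1 - \<epsilon>)\<close> is short enough for the noise to move
  by at most a quarter of \<open>c * sqrt t\<close> and long enough for the drift to carry the path
  to \<open>t powr q\<close>. Because \<open>q\<close> exceeds the growth exponent
  \<open>1/2 + \<epsilon>/2\<close> of the noise, \<open>x\<close> and \<open>x - b\<close> are
  comparable at that height, so that a barrier for \<open>x - b\<close> controls the drift, which
  depends on \<open>x\<close>.\<close>

lemma escape:
  fixes c \<epsilon> :: real
  assumes T: "T = \<infinity>" and c: "c > 0" and eps: "\<epsilon> > 0" "(2 + \<bar>\<alpha>\<bar>) * \<epsilon> < (\<alpha> + 1 - 2 * \<beta>) / 2"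
    and b1: "\<forall>\<^sub>F t in at_top. \<bar>b t\<bar> \<le> t powr (1/2 + \<epsilon>/2)"
    and b2: "\<forall>\<^sub>F t in at_top. \<forall>v\<in>{t..t + t powr (1 - \<epsilon>)}. \<bar>b v - b t\<bar> \<le> c / 4 * sqrt t"
    and fr: "\<And>R. \<exists>t\<ge>R. c * sqrt t \<le> x t"
  shows "\<exists>k>0. \<forall>\<^sub>F t in at_top. k * t powr (1/2 + \<epsilon>) \<le> x t - b t"
proof -
  define q where "q = 1/2 + \<epsilon>"
  \<comment> \<open>The height \<open>t1 powr q\<close> is reached at some
    \<open>t2 \<le> 2 * t1\<close>, and
    \<open>t1 powr q \<ge> (t2 / 2) powr q = 2 * \<kappa> * t2 powr q\<close>. So the path starts at
    twice the height of the barrier, which leaves room for \<open>b\<close>.\<close>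
  define \<kappa> where "\<kappa> = 2 powr (-q) / 2"
  have kp: "\<kappa> > 0" by (simp add: \<kappa>_def)
  define C1 where "C1 = min ((c/2) powr \<alpha>) 1"
  define C2 where "C2 = min 1 (2 powr (-\<beta>))"
  \<comment> \<open>Exponent of the drift accumulated over a window: its size on the window times
    the length \<open>t1 powr (1 - \<epsilon>)\<close>. The loss
    \<open>\<bar>\<alpha>\<bar> * \<epsilon>\<close> is due to \<alpha> < 0, where the drift is
    weakest at the upper end \<open>t1 powr q\<close> of the band. The assumption on \<epsilon> is
    precisely \<open>q < e\<close>.\<close>
  define e where "e = \<alpha>/2 - \<bar>\<alpha>\<bar> * \<epsilon> - \<beta> + (1 - \<epsilon>)"
  define C3 where "C3 = min ((\<kappa>/2) powr \<alpha>) ((2*\<kappa>) powr \<alpha>)"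
  have Cp: "C1 > 0" "C2 > 0" "C3 > 0" using c kp by (auto simp: C1_def C2_def C3_def)
  have eq: "q < e" using eps by (simp add: q_def e_def field_simps)
  have "(1 - \<alpha>) * \<epsilon> \<le> (2 + \<bar>\<alpha>\<bar>) * \<epsilon>" using eps by (intro mult_right_mono) auto
  also note eps(2)
  finally have "\<epsilon> * (1 - \<alpha>) < (\<alpha> + 1 - 2 * \<beta>) / 2" by (simp only: mult.commute[of \<epsilon>])
  \<comment> \<open>Compares the slope of the barrier, of order \<open>t powr (q - 1)\<close>, with
    the drift along it, of order \<open>t powr (q * \<alpha> - \<beta>)\<close>.\<close>
  then have qq: "q - 1 < q * \<alpha> - \<beta>" by (simp add: q_def field_simps)
  have E1: "\<forall>\<^sub>F t in at_top. 1 * t powr q < (\<rho> * C1 * C2) * t powr e"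
    using rho Cp eq by (intro powr_dominates) auto
  have E2: "\<forall>\<^sub>F t in at_top. 1 * t powr (1/2 + \<epsilon>/2) < (\<kappa>/2) * t powr q"
    using kp eps by (intro powr_dominates) (auto simp: q_def)
  have E3: "\<forall>\<^sub>F t in at_top. \<kappa> * q * t powr (q - 1) < (\<rho> * C3) * t powr (q * \<alpha> - \<beta>)"
    using rho Cp qq by (intro powr_dominates) auto
  have E4: "\<forall>\<^sub>F t in at_top. (c/2) * t powr (1/2) < 1 * t powr q"
    using eps by (intro powr_dominates) (auto simp: q_def)
  have "\<forall>\<^sub>F t in at_top. t > 1 \<and> 1 * t powr q < (\<rho> * C1 * C2) * t powr e \<and>
     \<bar>b t\<bar> \<le> (\<kappa>/2) * t powr q \<and> \<kappa> * q * t powr (q - 1) < (\<rho> * C3) * t powr (q * \<alpha> - \<beta>) \<and>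
     (c/2) * t powr (1/2) < 1 * t powr q \<and>
     (\<forall>v\<in>{t..t + t powr (1 - \<epsilon>)}. \<bar>b v - b t\<bar> \<le> c / 4 * sqrt t)"
    (is "eventually ?P at_top")
    using E1 E2 E3 E4 b1 b2 eventually_gt_at_top[of 1] by eventually_elim auto
  then obtain R where R0: "\<forall>t\<ge>R. ?P t"
    unfolding eventually_at_top_linorder by (elim exE)
  have R: "\<And>t. t \<ge> R \<Longrightarrow> t > 1"
    "\<And>t. t \<ge> R \<Longrightarrow> t powr q < (\<rho> * C1 * C2) * t powr e"
    "\<And>t. t \<ge> R \<Longrightarrow> \<bar>b t\<bar> \<le> (\<kappa>/2) * t powr q"
    "\<And>t. t \<ge> R \<Longrightarrow> \<kappa> * q * t powr (q - 1) < (\<rho> * C3) * t powr (q * \<alpha> - \<beta>)"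
    "\<And>t. t \<ge> R \<Longrightarrow> (c/2) * t powr (1/2) < t powr q"
    "\<And>t v. t \<ge> R \<Longrightarrow> v\<in>{t..t + t powr (1 - \<epsilon>)} \<Longrightarrow> \<bar>b v - b t\<bar> \<le> c / 4 * sqrt t"
    using R0 by simp_all
  obtain t1 where t1: "t1 \<ge> R" "c * sqrt t1 \<le> x t1" using fr[of R] by auto
  define h where "h = t1 powr (1 - \<epsilon>)"
  have t11: "t1 > 1" using R t1 by auto
  have h: "0 < h" "h \<le> t1" using t11 eps powr_mono[of "1 - \<epsilon>" 1 t1] by (auto simp: h_def)
  have stay: "(c/2) * sqrt t1 \<le> x v" if "v \<in> {t1..t1+h}" for v
  proof -
    have "x t1 - c / 4 * sqrt t1 \<le> x v"
    proof (rule stays)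
      show "\<bar>b u - b t1\<bar> \<le> c / 4 * sqrt t1" if "u \<in> {t1..v}" for u
        using R(6)[OF t1(1), of u] that \<open>v \<in> _\<close> by (auto simp: h_def)
      have "c / 4 * sqrt t1 < c * sqrt t1" using c t11 by auto
      then show "c / 4 * sqrt t1 < x t1" using t1 by linarith
    qed (use that t11 T in auto)
    then show ?thesis using t1 c t11 by (simp add: field_simps) (smt (verit) mult_nonneg_nonneg real_sqrt_ge_zero)
  qed
  \<comment> \<open>As long as \<open>x\<close> lies between the scales \<open>t1 powr (1/2)\<close> and \<open>t1 powr q\<close>, the drift accumulated over the window \<open>{t1..t1+h}\<close> alone exceeds \<open>t1 powr q\<close>.\<close>
  have "\<exists>v\<in>{t1..t1+h}. t1 powr q \<le> x v"
  proof (rule ccontr)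
    assume "\<not> ?thesis"
    then have up: "x v < t1 powr q" if "v \<in> {t1..t1+h}" for v using that by force
    define F where "F = \<rho> * C1 * C2 * t1 powr (\<alpha>/2 - \<bar>\<alpha>\<bar> * \<epsilon> - \<beta>)"
    have fF: "F \<le> f v" if v: "v \<in> {t1..t1+h}" for v
    proof -
      have xv: "x v > 0" using stay[OF v] c t11 by (smt (verit) mult_pos_pos half_gt_zero real_sqrt_gt_zero)
      have "C1 * t1 powr (\<alpha>/2 - \<bar>\<alpha>\<bar> * \<epsilon>) \<le> x v powr \<alpha>"
      proof (cases "\<alpha> \<ge> 0")
        case True
        have "C1 * t1 powr (\<alpha>/2 - \<bar>\<alpha>\<bar> * \<epsilon>) \<le> (c/2) powr \<alpha> * t1 powr (\<alpha>/2)"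
          using True eps t11 by (intro mult_mono powr_mono) (auto simp: C1_def)
        also have "\<dots> = ((c/2) * sqrt t1) powr \<alpha>"
          using c t11 powr_mult[of "c/2" "t1 powr (1/2)" \<alpha>]
          by (simp add: powr_half_sqrt[symmetric] powr_powr)
        also have "\<dots> \<le> x v powr \<alpha>" using stay[OF v] True c t11 by (intro powr_mono2) auto
        finally show ?thesis .
      next
        case False
        have "C1 * t1 powr (\<alpha>/2 - \<bar>\<alpha>\<bar> * \<epsilon>) \<le> 1 * t1 powr (\<alpha>/2 - \<bar>\<alpha>\<bar> * \<epsilon>)"
          by (intro mult_right_mono) (auto simp: C1_def)
        also have "\<dots> = (t1 powr q) powr \<alpha>" using False by (simp add: powr_powr q_def algebra_simps)
        also have "\<dots> \<le> x v powr \<alpha>" using up[OF v] xv False by (intro powr_mono2') auto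
        finally show ?thesis .
      qed
      moreover have "C2 * t1 powr (-\<beta>) \<le> v powr (-\<beta>)"
      proof -
        have "C2 * t1 powr (-\<beta>) = min (t1 powr (-\<beta>)) ((2 * t1) powr (-\<beta>))"
          using t11 by (simp add: C2_def powr_mult min_mult_distrib_right)
        also have "\<dots> \<le> v powr (-\<beta>)" using v h t11 by (intro powr_ge_min) auto
        finally show ?thesis .
      qed
      ultimately have "\<rho> * (C1 * t1 powr (\<alpha>/2 - \<bar>\<alpha>\<bar> * \<epsilon>)) * (C2 * t1 powr (-\<beta>)) \<le> \<rho> * x v powr \<alpha> * v powr (-\<beta>)"
        using rho Cp by (intro mult_mono) auto
      moreover have "t1 powr (\<alpha>/2 - \<bar>\<alpha>\<bar> * \<epsilon> - \<beta>) = t1 powr (\<alpha>/2 - \<bar>\<alpha>\<bar> * \<epsilon>) * t1 powr (-\<beta>)"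
        by (simp add: powr_add[symmetric])
      ultimately show ?thesis using xv by (simp add: F_def drift_def powr_minus field_simps)
    qed
    have "integral {t1..t1+h} (\<lambda>_. F) \<le> integral {t1..t1+h} f"
      using t11 T fF by (intro integral_le hk_int) auto
    then have "F * h \<le> integral {t1..t1+h} f" using h by (simp add: mult.commute)
    moreover have "F * h = (\<rho> * C1 * C2) * t1 powr e"
      by (simp add: F_def h_def e_def powr_add[symmetric] mult.assoc)
    moreover have "x (t1+h) - x t1 = b (t1+h) - b t1 + integral {t1..t1+h} f"
      using t11 h T by (intro incr) auto
    moreover have "\<bar>b (t1+h) - b t1\<bar> \<le> c / 4 * sqrt t1"
      using R(6)[OF t1(1), of "t1+h"] h by (auto simp: h_def)
    moreover have "c / 4 * sqrt t1 \<le> c * sqrt t1" using c t11 by auto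
    ultimately have "(\<rho> * C1 * C2) * t1 powr e \<le> x (t1 + h)" using t1 by linarith
    then show False using up[of "t1+h"] R(2)[OF t1(1)] h by auto
  qed
  then obtain t2 where t2: "t1 \<le> t2" "t2 \<le> t1 + h" "t1 powr q \<le> x t2" by auto
  have q0: "q > 0" using eps by (simp add: q_def)
  define z where "z t = x t - b t - \<kappa> * t powr q" for t
  have z2: "z t2 > 0"
  proof -
    have "(t2 / 2) powr q \<le> t1 powr q" using t2 h q0 t11 by (intro powr_mono2) auto
    moreover have "(t2 / 2) powr q = 2 * \<kappa> * t2 powr q"
      using t2 t11 by (simp add: powr_divide \<kappa>_def powr_minus field_simps)
    ultimately have "2 * \<kappa> * t2 powr q \<le> x t2" using t2 by linarith
    moreover have "\<bar>b t2\<bar> \<le> (\<kappa>/2) * t2 powr q" using R(3)[of t2] t1 t2 by auto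
    moreover have "\<kappa> * t2 powr q > 0" using kp t2 t11 by auto
    ultimately show ?thesis unfolding z_def by (simp add: field_simps)
  qed
  \<comment> \<open>Barrier: wherever \<open>x - b\<close> touches \<open>\<kappa> * t powr q\<close>, it is steeper than the barrier.\<close>
  have "z t > 0" if t2t: "t2 \<le> t" for t
  proof (rule ccontr)
    assume "\<not> z t > 0"
    have cz: "continuous_on {t2..t} z" unfolding z_def using t2 t11 T
      by (intro continuous_intros cont_x' cont_b') auto
    \<comment> \<open>Time is reversed so that \<open>last_exit\<close> returns the first zero
      \<open>t3\<close> of \<open>z\<close> after \<open>t2\<close>. There \<open>z\<close> would
      have a positive derivative although it is nonnegative just before.\<close>
    then have "continuous_on {-t..-t2} (\<lambda>s. z (-s))"
      by (intro continuous_on_compose2[OF cz] continuous_intros) auto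
    then obtain u where u: "u \<in> {-t..-t2}" "z (-u) = 0" "\<And>v. v \<in> {u..-t2} \<Longrightarrow> 0 \<le> z (-v)"
    proof (rule last_exit[of "-t" "-t2" "\<lambda>s. z (-s)" 0])
      show "z (- (- t)) \<le> 0" using \<open>\<not> z t > 0\<close> by simp
    qed (use z2 t2t in auto)
    define t3 where "t3 = -u"
    have t3: "t2 < t3" "z t3 = 0" "\<And>v. t2 \<le> v \<Longrightarrow> v \<le> t3 \<Longrightarrow> 0 \<le> z v"
    proof -
      have "t3 \<noteq> t2" using u z2 by (auto simp: t3_def)
      then show "t2 < t3" using u by (auto simp: t3_def)
      show "z t3 = 0" using u by (simp add: t3_def)
      show "0 \<le> z v" if "t2 \<le> v" "v \<le> t3" for v using u(3)[of "-v"] that by (auto simp: t3_def)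
    qed
    have t31: "t3 \<ge> R" "t3 > 1" using t3 t2 t1 t11 by auto
    have kt: "\<kappa> * t3 powr q > 0" using kp t31 by auto
    have xt3: "(\<kappa>/2) * t3 powr q \<le> x t3" "x t3 \<le> 2 * \<kappa> * t3 powr q"
      using R(3)[OF t31(1)] t3(2) kt unfolding z_def by (auto simp: abs_le_iff)
    have xp: "x t3 > 0" using xt3(1) kt by (simp add: field_simps)
    have "(z has_real_derivative (\<rho> * x t3 powr \<alpha> / t3 powr \<beta>) - \<kappa> * (q * t3 powr (q - 1))) (at t3)"
      unfolding z_def using t31 T xp
      by (intro DERIV_diff deriv_pos DERIV_cmult has_real_derivative_powr) auto
    moreover have "(\<rho> * x t3 powr \<alpha> / t3 powr \<beta>) - \<kappa> * (q * t3 powr (q - 1)) > 0"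
    proof -
      have "C3 * t3 powr (q * \<alpha>) = min (((\<kappa>/2) * t3 powr q) powr \<alpha>) ((2 * \<kappa> * t3 powr q) powr \<alpha>)"
        using kp by (simp add: C3_def powr_mult powr_powr min_mult_distrib_right powr_divide)
      also have "\<dots> \<le> x t3 powr \<alpha>" using xt3 kp t31 by (intro powr_ge_min) auto
      finally have "\<rho> * (C3 * t3 powr (q * \<alpha>)) * t3 powr (-\<beta>) \<le> \<rho> * x t3 powr \<alpha> * t3 powr (-\<beta>)"
        using rho by (intro mult_right_mono mult_left_mono) auto
      moreover have "t3 powr (q * \<alpha> - \<beta>) = t3 powr (q * \<alpha>) * t3 powr (-\<beta>)" by (simp add: powr_add[symmetric])
      ultimately show ?thesis using R(4)[OF t31(1)] by (simp add: powr_minus field_simps)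
    qed
    ultimately obtain d where d: "d > 0" "\<And>g. g > 0 \<Longrightarrow> g < d \<Longrightarrow> z (t3 - g) < z t3"
      using DERIV_pos_inc_left by blast
    define g where "g = min (d/2) (t3 - t2)"
    have "g > 0" "g < d" "g \<le> t3 - t2" using d t3 by (auto simp: g_def min_def)
    then show False using d(2)[of g] t3(2) t3(3)[of "t3 - g"] by auto
  qed
  then have "\<forall>\<^sub>F t in at_top. \<kappa> * t powr q \<le> x t - b t"
    unfolding eventually_at_top_linorder z_def by (intro exI[of _ t2]) (auto intro: less_imp_le)
  then show ?thesis using kp unfolding q_def by blast
qed

text \<open>Since \<open>q' < q\<close>, the noise is negligible against \<open>x - b\<close>. This
  is what allows the equation, written for the derivative of \<open>x - b\<close> in terms of
  \<open>x\<close>, to be treated as autonomous in \<open>x - b\<close> up to a factor tending to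
  1.\<close>

lemma growth_ratio:
  assumes k: "k > 0" and gr: "\<forall>\<^sub>F t in at_top. k * t powr q \<le> x t - b t"
    and b1: "\<forall>\<^sub>F t in at_top. \<bar>b t\<bar> \<le> t powr q'" and q: "q' < q" "q > 0"
  shows "((\<lambda>t. x t / (x t - b t)) \<longlongrightarrow> 1) at_top" "filterlim (\<lambda>t. x t - b t) at_top at_top"
    "filterlim x at_top at_top" "\<forall>\<^sub>F t in at_top. 0 < x t \<and> 0 < x t - b t"
proof -
  have "filterlim (\<lambda>t. k * t powr q) at_top at_top" using k q by real_asymp
  then show y: "filterlim (\<lambda>t. x t - b t) at_top at_top"
    by (rule filterlim_at_top_mono[OF _ gr])
  have "((\<lambda>t. t powr (q' - q) / k) \<longlongrightarrow> 0) at_top" using k q by real_asymp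
  then have "((\<lambda>t. b t / (x t - b t)) \<longlongrightarrow> 0) at_top"
  proof (rule Lim_null_comparison[rotated])
    show "\<forall>\<^sub>F t in at_top. norm (b t / (x t - b t)) \<le> t powr (q' - q) / k"
      using gr b1 eventually_gt_at_top[of 0]
    proof eventually_elim
      case (elim t)
      have "\<bar>b t\<bar> / (x t - b t) \<le> t powr q' / (k * t powr q)"
        using elim k by (intro frac_le) auto
      moreover have "0 < k * t powr q" using elim k by auto
      then have "0 < x t - b t" using elim by linarith
      ultimately show ?case using elim k by (simp add: powr_diff field_simps)
    qed
  qed
  from tendsto_add[OF tendsto_const[of 1] this] have "((\<lambda>t. 1 + b t / (x t - b t)) \<longlongrightarrow> 1) at_top" by simp
  moreover have pos: "\<forall>\<^sub>F t in at_top. 0 < x t - b t"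
    using filterlim_at_top_dense[THEN iffD1, OF y, THEN spec, of 0] by simp
  then have "\<forall>\<^sub>F t in at_top. 1 + b t / (x t - b t) = x t / (x t - b t)"
    by eventually_elim (auto simp: field_simps)
  ultimately show lim: "((\<lambda>t. x t / (x t - b t)) \<longlongrightarrow> 1) at_top"
    by (rule Lim_transform_eventually)
  have "\<forall>\<^sub>F t in at_top. x t / (x t - b t) > 1/2" using lim by (rule order_tendstoD) simp
  then have half: "\<forall>\<^sub>F t in at_top. (1/2) * (x t - b t) \<le> x t"
    using pos by eventually_elim (auto simp: field_simps)
  have "filterlim (\<lambda>t. (1/2) * (x t - b t)) at_top at_top"
    by (rule filterlim_tendsto_pos_mult_at_top[OF tendsto_const _ y]) simp
  then show "filterlim x at_top at_top" by (rule filterlim_at_top_mono[OF _ half])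
  show "\<forall>\<^sub>F t in at_top. 0 < x t \<and> 0 < x t - b t" using half pos by eventually_elim auto
qed

text \<open>The derivatives of \<open>y powr (1 - \<alpha>)\<close> and
  \<open>t powr (1 - \<beta>)\<close> share the factor \<open>t powr (- \<beta>)\<close>; their
  quotient is \<open>l * (x / y) powr \<alpha>\<close>, which tends to \<open>l\<close>.\<close>

lemma sublinear_asymp:
  assumes T: "T = \<infinity>" and al: "\<alpha> < 1" and be: "\<beta> < 1"
    and k: "k > 0" and gr: "\<forall>\<^sub>F t in at_top. k * t powr q \<le> x t - b t"
    and b1: "\<forall>\<^sub>F t in at_top. \<bar>b t\<bar> \<le> t powr q'" and q: "q' < q" "q > 0"
  shows "((\<lambda>t. x t / t powr ((1 - \<beta>) / (1 - \<alpha>))) \<longlongrightarrow> (\<rho> * (1 - \<alpha>) / (1 - \<beta>)) powr (1 / (1 - \<alpha>))) at_top"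
proof -
  define y where "y t = x t - b t" for t
  note g = growth_ratio[OF k gr b1 q, folded y_def]
  define l where "l = \<rho> * (1 - \<alpha>) / (1 - \<beta>)"
  have l: "l > 0" using rho al be by (simp add: l_def)
  have "((\<lambda>t. y t powr (1 - \<alpha>) / t powr (1 - \<beta>)) \<longlongrightarrow> l) at_top"
  proof (rule lhospital_at_top_at_top)
    show "LIM t at_top. t powr (1 - \<beta>) :> at_top" using be by real_asymp
    show "\<forall>\<^sub>F t in at_top. (1 - \<beta>) * t powr (- \<beta>) \<noteq> 0"
      using eventually_gt_at_top[of 0] by eventually_elim (use be in auto)
    show "\<forall>\<^sub>F t in at_top. ((\<lambda>t. t powr (1 - \<beta>)) has_real_derivative (1 - \<beta>) * t powr (- \<beta>)) (at t)"
      using eventually_gt_at_top[of 0]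
    proof eventually_elim
      case (elim t)
      from has_real_derivative_powr[OF this, of "1 - \<beta>"] show ?case by simp
    qed
    show "\<forall>\<^sub>F t in at_top. ((\<lambda>t. y t powr (1 - \<alpha>)) has_real_derivative
       (1 - \<alpha>) * y t powr (- \<alpha>) * (\<rho> * x t powr \<alpha> / t powr \<beta>)) (at t)"
      using eventually_gt_at_top[of 1] g(4)
    proof eventually_elim
      case (elim t)
      have "(y has_real_derivative (\<rho> * x t powr \<alpha> / t powr \<beta>)) (at t)"
        unfolding y_def using elim T by (intro deriv_pos) auto
      from DERIV_fun_powr[OF this, of "1 - \<alpha>"] elim show ?case
        by (simp add: mult_ac)
    qed
    show "((\<lambda>t. (1 - \<alpha>) * y t powr (- \<alpha>) * (\<rho> * x t powr \<alpha> / t powr \<beta>) / ((1 - \<beta>) * t powr (- \<beta>))) \<longlongrightarrow> l) at_top"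
    proof (rule Lim_transform_eventually)
      have "((\<lambda>t. l * (x t / y t) powr \<alpha>) \<longlongrightarrow> l * 1 powr \<alpha>) at_top"
        by (intro tendsto_intros g(1)) auto
      then show "((\<lambda>t. l * (x t / y t) powr \<alpha>) \<longlongrightarrow> l) at_top" by simp
      show "\<forall>\<^sub>F t in at_top. l * (x t / y t) powr \<alpha>
          = (1 - \<alpha>) * y t powr (- \<alpha>) * (\<rho> * x t powr \<alpha> / t powr \<beta>) / ((1 - \<beta>) * t powr (- \<beta>))"
        using eventually_gt_at_top[of 1] g(4)
        by eventually_elim (use be in \<open>simp add: l_def powr_divide powr_minus field_simps\<close>)
    qed
  qed
  then have "((\<lambda>t. (y t powr (1 - \<alpha>) / t powr (1 - \<beta>)) powr (1 / (1 - \<alpha>))) \<longlongrightarrow> l powr (1 / (1 - \<alpha>))) at_top"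
    using l by (intro tendsto_powr tendsto_const) auto
  then have "((\<lambda>t. (y t powr (1 - \<alpha>) / t powr (1 - \<beta>)) powr (1 / (1 - \<alpha>)) * (x t / y t)) \<longlongrightarrow> l powr (1 / (1 - \<alpha>)) * 1) at_top"
    by (intro tendsto_mult g(1))
  then have lim: "((\<lambda>t. (y t powr (1 - \<alpha>) / t powr (1 - \<beta>)) powr (1 / (1 - \<alpha>)) * (x t / y t)) \<longlongrightarrow> l powr (1 / (1 - \<alpha>))) at_top"
    by simp
  have "\<forall>\<^sub>F t in at_top. (y t powr (1 - \<alpha>) / t powr (1 - \<beta>)) powr (1 / (1 - \<alpha>)) * (x t / y t)
     = x t / t powr ((1 - \<beta>) / (1 - \<alpha>))"
    using eventually_gt_at_top[of 1] g(4)
    by eventually_elim (use al in \<open>simp add: powr_divide powr_powr\<close>)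
  from Lim_transform_eventually[OF lim this] show ?thesis unfolding l_def .
qed

text \<open>The positive function \<open>y powr (1 - \<alpha>)\<close> would have to decrease on
  \<open>{R..2*R}\<close> by at least a multiple of \<open>R powr (1 - \<beta>)\<close>, while its
  value at \<open>R\<close> is only of order \<open>R powr (q * (1 - \<alpha>))\<close>. The growth
  of \<open>y\<close> is essential: for \<alpha> > 1 the exponent \<beta> may exceed 1, and then
  \<open>t powr (- \<beta>)\<close> is integrable at infinity and a fixed starting height gives no
  contradiction.\<close>

lemma superlinear_explodes:
  assumes T: "T = \<infinity>" and al: "\<alpha> > 1" and k: "k > 0"
    and gr: "\<forall>\<^sub>F t in at_top. k * t powr q \<le> x t - b t"
    and b1: "\<forall>\<^sub>F t in at_top. \<bar>b t\<bar> \<le> t powr q'" and q: "q' < q" "q > 0" "q * (1 - \<alpha>) < 1 - \<beta>"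
  shows False
proof -
  define y where "y t = x t - b t" for t
  note g = growth_ratio[OF k gr b1 q(1,2), folded y_def]
  define C where "C = (\<alpha> - 1) * \<rho> * (1/2) powr \<alpha>"
  define C2 where "C2 = min 1 (2 powr (-\<beta>))"
  have C: "C > 0" "C2 > 0" using al rho by (auto simp: C_def C2_def)
  have "\<forall>\<^sub>F t in at_top. x t / y t > 1/2" using g(1) by (rule order_tendstoD) simp
  moreover have "\<forall>\<^sub>F t in at_top. k powr (1 - \<alpha>) * t powr (q * (1 - \<alpha>)) < (C * C2) * t powr (1 - \<beta>)"
    using C q by (intro powr_dominates) auto
  ultimately have "\<forall>\<^sub>F t in at_top. t > 1 \<and> x t > 0 \<and> y t > 0 \<and> x t / y t > 1/2 \<and> k * t powr q \<le> y t \<and>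
     k powr (1 - \<alpha>) * t powr (q * (1 - \<alpha>)) < (C * C2) * t powr (1 - \<beta>)" (is "eventually ?P at_top")
    using g(4) gr[folded y_def] eventually_gt_at_top[of 1] by eventually_elim auto
  then obtain R where R: "\<And>t. t \<ge> R \<Longrightarrow> ?P t"
    unfolding eventually_at_top_linorder by auto
  have R1: "R > 1" using R by blast
  have der: "((\<lambda>t. y t powr (1 - \<alpha>)) has_real_derivative
       - ((\<alpha> - 1) * \<rho> * (x t / y t) powr \<alpha> * t powr (-\<beta>))) (at t)" if "t \<ge> R" for t
  proof -
    note t = R[OF that]
    have "(y has_real_derivative (\<rho> * x t powr \<alpha> / t powr \<beta>)) (at t)"
      unfolding y_def using t T by (intro deriv_pos) auto
    from DERIV_fun_powr[OF this, of "1 - \<alpha>"] t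
    have "((\<lambda>t. y t powr (1 - \<alpha>)) has_real_derivative
       (1 - \<alpha>) * y t powr (-\<alpha>) * (\<rho> * x t powr \<alpha> / t powr \<beta>)) (at t)"
      by (simp add: mult_ac)
    moreover have "(1 - \<alpha>) * y t powr (-\<alpha>) * (\<rho> * x t powr \<alpha> / t powr \<beta>)
      = - ((\<alpha> - 1) * \<rho> * (x t / y t) powr \<alpha> * t powr (-\<beta>))"
    proof -
      have "0 < x t" "0 < y t" "1 < t" using t by auto
      then have "(x t / y t) powr \<alpha> = x t powr \<alpha> * y t powr (-\<alpha>)"
        by (simp add: powr_divide powr_minus_divide)
      moreover have "\<rho> * x t powr \<alpha> / t powr \<beta> = \<rho> * x t powr \<alpha> * t powr (-\<beta>)"
        by (simp add: powr_minus_divide)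
      ultimately show ?thesis by (simp only:) (simp add: algebra_simps)
    qed
    ultimately show ?thesis by (simp only:)
  qed
  obtain s where s: "s > R" "s < 2 * R" "y (2 * R) powr (1 - \<alpha>) - y R powr (1 - \<alpha>) =
      (2 * R - R) * - ((\<alpha> - 1) * \<rho> * (x s / y s) powr \<alpha> * s powr (-\<beta>))"
    using MVT2[of R "2 * R" "\<lambda>t. y t powr (1 - \<alpha>)" "\<lambda>t. - ((\<alpha> - 1) * \<rho> * (x t / y t) powr \<alpha> * t powr (-\<beta>))"]
      der R1 by auto
  have "C2 * R powr (-\<beta>) = min (R powr (-\<beta>)) ((2 * R) powr (-\<beta>))"
    using R1 by (simp add: C2_def powr_mult min_mult_distrib_right)
  also have "\<dots> \<le> s powr (-\<beta>)" using s R1 by (intro powr_ge_min) auto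
  finally have 1: "C2 * R powr (-\<beta>) \<le> s powr (-\<beta>)" .
  have "(1/2) powr \<alpha> \<le> (x s / y s) powr \<alpha>" using R[of s] s al by (intro powr_mono2) auto
  then have "(\<alpha> - 1) * \<rho> * (1/2) powr \<alpha> * (C2 * R powr (-\<beta>)) \<le> (\<alpha> - 1) * \<rho> * (x s / y s) powr \<alpha> * s powr (-\<beta>)"
    using 1 C al rho by (intro mult_mono) auto
  then have "R * (C * C2 * R powr (-\<beta>)) \<le> R * ((\<alpha> - 1) * \<rho> * (x s / y s) powr \<alpha> * s powr (-\<beta>))"
    using R1 by (intro mult_left_mono) (auto simp: C_def)
  also have "\<dots> = y R powr (1 - \<alpha>) - y (2 * R) powr (1 - \<alpha>)" using s(3) by (simp add: algebra_simps)
  also have "\<dots> \<le> y R powr (1 - \<alpha>)" by simp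
  also have "\<dots> \<le> (k * R powr q) powr (1 - \<alpha>)" using R[of R] k al R1 by (intro powr_mono2') auto
  also have "\<dots> = k powr (1 - \<alpha>) * R powr (q * (1 - \<alpha>))" using k by (simp add: powr_mult powr_powr)
  also have "\<dots> < (C * C2) * R powr (1 - \<beta>)" using R[of R] by auto
  also have "\<dots> = R * (C * C2 * R powr (-\<beta>))" using R1 by (simp add: powr_diff powr_minus field_simps)
  finally show False by simp
qed

end

section \<open>Path regularity of Brownian motion\<close>

lemma sum_geometric_bound:
  fixes lam :: real
  assumes "lam \<ge> 0"
  shows "(\<Sum>l\<le>j. lam / 10 * (9/10) ^ l) \<le> lam"
proof -
  have "(\<Sum>l\<le>j. lam / 10 * (9/10) ^ l) = lam * (1 - (9/10) ^ Suc j)"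
    unfolding sum_distrib_left[symmetric] lessThan_Suc_atMost[symmetric]
    by (subst geometric_sum) (auto simp: field_simps)
  also have "\<dots> \<le> lam * 1" using assms by (intro mult_left_mono) auto
  finally show ?thesis by simp
qed

text \<open>A new point of level \<open>Suc j\<close> has a left neighbour of level
  \<open>j\<close>, so each level contributes at most one increment. The allowances shrink by 9/10
  per level, and the factor \<open>1/10 = 1 - 9/10\<close> makes them sum to at most
  \<open>lam\<close>.\<close>

lemma dyadic_chaining:
  fixes g :: "real \<Rightarrow> real"
  assumes inc: "\<And>j i. i < 2 ^ j \<Longrightarrow> \<bar>g (real (Suc i) / 2 ^ j) - g (real i / 2 ^ j)\<bar> \<le> lam / 10 * (9/10) ^ j"
    and lam: "lam \<ge> 0" and "i \<le> 2 ^ j"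
  shows "\<bar>g (real i / 2 ^ j) - g 0\<bar> \<le> (\<Sum>l\<le>j. lam / 10 * (9/10) ^ l)"
  using assms(3)
proof (induction j arbitrary: i)
  case 0
  then show ?case using inc[of 0 0] lam by (cases i) auto
next
  case (Suc j)
  show ?case
  proof (cases "even i")
    case True
    then obtain k where k: "i = 2 * k" by blast
    then have "\<bar>g (real k / 2 ^ j) - g 0\<bar> \<le> (\<Sum>l\<le>j. lam / 10 * (9/10) ^ l)"
      using Suc by auto
    moreover have "0 \<le> lam / 10 * (9/10) ^ Suc j" using lam by simp
    ultimately show ?thesis using k by simp
  next
    case False
    then obtain k where k: "i = Suc (2 * k)" by (metis oddE Suc_eq_plus1)
    then have "\<bar>g (real k / 2 ^ j) - g 0\<bar> \<le> (\<Sum>l\<le>j. lam / 10 * (9/10) ^ l)"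
      using Suc by auto
    moreover have "\<bar>g (real (Suc (2 * k)) / 2 ^ Suc j) - g (real (2 * k) / 2 ^ Suc j)\<bar> \<le> lam / 10 * (9/10) ^ Suc j"
      using k Suc.prems by (intro inc) auto
    moreover have "real (2 * k) / 2 ^ Suc j = real k / 2 ^ j" by simp
    ultimately show ?thesis unfolding k sum.atMost_Suc by (smt (verit))
  qed
qed

lemma chaining_bound:
  fixes g :: "real \<Rightarrow> real"
  assumes inc: "\<And>j i. i < 2 ^ j \<Longrightarrow> \<bar>g (real (Suc i) / 2 ^ j) - g (real i / 2 ^ j)\<bar> \<le> lam / 10 * (9/10) ^ j"
    and lam: "lam \<ge> 0" and cont: "continuous_on {0..1} g" and s: "s \<in> {0..1}"
  shows "\<bar>g s - g 0\<bar> \<le> lam"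
proof -
  define i where "i j = nat \<lfloor>s * 2 ^ j\<rfloor>" for j :: nat
  have i: "real (i j) \<le> s * 2 ^ j" "s * 2 ^ j < real (i j) + 1" for j
    using s unfolding i_def by (simp, linarith)
  have i2: "i j \<le> 2 ^ j" for j
  proof -
    have "s * 2 ^ j \<le> 1 * 2 ^ j" using s by (intro mult_right_mono) auto
    with i(1)[of j] have "real (i j) \<le> 1 * 2 ^ j" by (rule order_trans)
    then have "real (i j) \<le> real (2 ^ j)" by simp
    then show ?thesis by (simp only: of_nat_le_iff)
  qed
  have mem: "real (i j) / 2 ^ j \<in> {0..1}" for j
  proof -
    have "real (i j) \<le> real (2 ^ j)" using i2[of j] by (simp only: of_nat_le_iff)
    then show ?thesis by simp
  qed
  have "(\<lambda>j. real (i j) / 2 ^ j) \<longlonglongrightarrow> s"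
  proof (rule tendsto_sandwich[of "\<lambda>j. s - (1/2) ^ j" _ _ "\<lambda>_. s"])
    show "\<forall>\<^sub>F j in sequentially. s - (1/2) ^ j \<le> real (i j) / 2 ^ j"
    proof (rule always_eventually, rule allI)
      fix j show "s - (1/2) ^ j \<le> real (i j) / 2 ^ j"
      proof -
        have "s - (1/2) ^ j = (s * 2 ^ j - 1) / 2 ^ j" by (simp add: power_divide diff_divide_distrib)
        also have "\<dots> \<le> real (i j) / 2 ^ j" using i(2)[of j] by (intro divide_right_mono) auto
        finally show ?thesis .
      qed
    qed
    show "\<forall>\<^sub>F j in sequentially. real (i j) / 2 ^ j \<le> s"
    proof (rule always_eventually, rule allI)
      fix j show "real (i j) / 2 ^ j \<le> s" using i(1)[of j] by (simp add: pos_divide_le_eq)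
    qed
    have "(\<lambda>j. s - (1/2) ^ j) \<longlonglongrightarrow> s - 0" by (intro tendsto_intros LIMSEQ_power_zero) auto
    then show "(\<lambda>j. s - (1/2) ^ j) \<longlonglongrightarrow> s" by simp
  qed simp
  then have "(\<lambda>j. g (real (i j) / 2 ^ j)) \<longlonglongrightarrow> g s"
    using cont s mem by (intro continuous_on_tendsto_compose[OF cont]) auto
  then have "(\<lambda>j. \<bar>g (real (i j) / 2 ^ j) - g 0\<bar>) \<longlonglongrightarrow> \<bar>g s - g 0\<bar>"
    by (intro tendsto_intros)
  then show ?thesis
  proof (rule tendsto_upperbound)
    show "\<forall>\<^sub>F j in sequentially. \<bar>g (real (i j) / 2 ^ j) - g 0\<bar> \<le> lam"
    proof (rule always_eventually, rule allI)
      fix j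
      show "\<bar>g (real (i j) / 2 ^ j) - g 0\<bar> \<le> lam"
        using dyadic_chaining[of g lam "i j" j, OF inc lam i2] sum_geometric_bound[OF lam, of j]
        by linarith
    qed
  qed simp
qed

lemma dyadic_scale:
  fixes t :: real
  assumes "2 ^ N \<le> t"
  obtains n where "N \<le> n" "2 ^ n \<le> t" "t < 2 ^ Suc n"
proof -
  obtain m0 :: nat where "t < 2 ^ m0" using real_arch_pow[of 2 t] by auto
  define m where "m = (LEAST m::nat. t < 2 ^ m)"
  have m: "t < 2 ^ m" unfolding m_def using \<open>t < 2 ^ m0\<close> by (rule LeastI)
  have "N < m"
  proof (rule ccontr)
    assume "\<not> N < m"
    then have "(2::real) ^ m \<le> 2 ^ N" by (intro power_increasing) auto
    with m assms show False by linarith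
  qed
  then obtain n where n: "m = Suc n" "N \<le> n" by (cases m) auto
  have "\<not> t < 2 ^ n" using not_less_Least[of n "\<lambda>m. t < 2 ^ m"] n unfolding m_def by simp
  then show thesis using that[of n] n m by auto
qed

section \<open>Maximal tail bounds, growth and oscillation of Brownian paths\<close>

locale brownian = prob_space M for M :: "'a measure" +
  fixes B :: "real \<Rightarrow> 'a \<Rightarrow> real"
  assumes bm: "std_brownian_motion M B"
begin

lemma meas_B[measurable]: "0 \<le> t \<Longrightarrow> B t \<in> borel_measurable M"
  using bm by (simp add: std_brownian_motion_def)

lemma B_0: "\<omega> \<in> space M \<Longrightarrow> B 0 \<omega> = 0"
  using bm by (simp add: std_brownian_motion_def)

lemma cont_B: "\<omega> \<in> space M \<Longrightarrow> continuous_on {0..} (\<lambda>t. B t \<omega>)"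
  using bm by (simp add: std_brownian_motion_def)

lemma B_normal: "0 \<le> s \<Longrightarrow> s < t \<Longrightarrow>
  distributed M lborel (\<lambda>\<omega>. B t \<omega> - B s \<omega>) (normal_density 0 (sqrt (t - s)))"
  using bm by (simp add: std_brownian_motion_def)

lemma B_indep: "0 \<le> ts 0 \<Longrightarrow> (\<And>i. i < n \<Longrightarrow> ts i < ts (Suc i)) \<Longrightarrow>
  indep_vars (\<lambda>_. borel) (\<lambda>i \<omega>. B (ts (Suc i)) \<omega> - B (ts i) \<omega>) {..<n}"
  using bm unfolding std_brownian_motion_def by blast

lemma B_moments:
  assumes "0 \<le> s" "s < t"
  shows "integrable M (\<lambda>\<omega>. (B t \<omega> - B s \<omega>) ^ k)"
    "(\<integral>\<omega>. (B t \<omega> - B s \<omega>) ^ 4 \<partial>M) = 3 * (t - s)\<^sup>2"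
    "(\<integral>\<omega>. (B t \<omega> - B s \<omega>) ^ 2 \<partial>M) = t - s"
    "(\<integral>\<omega>. (B t \<omega> - B s \<omega>) \<partial>M) = 0"
proof -
  note D = B_normal[OF assms]
  have pos: "0 < sqrt (t - s)" using assms by simp
  have eq: "(\<integral>\<omega>. (B t \<omega> - B s \<omega>) ^ k \<partial>M) = (\<integral>x. normal_density 0 (sqrt (t - s)) x * x ^ k \<partial>lborel)" for k
    by (rule distributed_integral[OF D, symmetric]) auto
  show "integrable M (\<lambda>\<omega>. (B t \<omega> - B s \<omega>) ^ k)"
    using distributed_integrable[OF D, of "\<lambda>x. x ^ k"] integrable_normal_moment[OF pos, of 0 k] by auto
  show "(\<integral>\<omega>. (B t \<omega> - B s \<omega>) ^ 4 \<partial>M) = 3 * (t - s)\<^sup>2"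
    unfolding eq using integral_normal_moment_even[OF pos, of 0 2] assms
    by (simp add: fact_numeral field_simps power2_eq_square)
  show "(\<integral>\<omega>. (B t \<omega> - B s \<omega>) ^ 2 \<partial>M) = t - s"
    unfolding eq using integral_normal_moment_even[OF pos, of 0 1] assms by simp
  show "(\<integral>\<omega>. (B t \<omega> - B s \<omega>) \<partial>M) = 0"
    using eq[of 1] integral_normal_moment_odd[OF pos, of 0 0] by simp
qed

text \<open>Markov's inequality with the fourth moment. The square of \<open>t - s\<close> gives
  decay in a union bound over \<open>2 ^ j\<close> cells of length \<open>h / 2 ^ j\<close>, whereas
  the variance would give none.\<close>

lemma inc_tail:
  assumes "0 \<le> s" "s < t" "0 < l"
  shows "prob {\<omega>\<in>space M. l \<le> \<bar>B t \<omega> - B s \<omega>\<bar>} \<le> 3 * (t - s)\<^sup>2 / l ^ 4"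
proof -
  have [measurable]: "B t \<in> borel_measurable M" "B s \<in> borel_measurable M" using assms by auto
  have "{\<omega>\<in>space M. l \<le> \<bar>B t \<omega> - B s \<omega>\<bar>} \<subseteq> {\<omega>\<in>space M. l ^ 4 \<le> (B t \<omega> - B s \<omega>) ^ 4}"
    using assms(3) power_mono[of l "\<bar>B t \<omega> - B s \<omega>\<bar>" 4 for \<omega>] by auto
  then have "prob {\<omega>\<in>space M. l \<le> \<bar>B t \<omega> - B s \<omega>\<bar>} \<le> prob {\<omega>\<in>space M. l ^ 4 \<le> (B t \<omega> - B s \<omega>) ^ 4}"
    by (intro finite_measure_mono) auto
  also have "\<dots> \<le> (\<integral>\<omega>. (B t \<omega> - B s \<omega>) ^ 4 \<partial>M) / l ^ 4"
    by (rule integral_Markov_inequality_measure[of _ _ "space M"]) (use B_moments[OF assms(1,2)] assms in auto)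
  finally show ?thesis using B_moments(2)[OF assms(1,2)] by simp
qed

text \<open>A maximal inequality by chaining. The exceptional event is a countable union over dyadic
  increments that exceed their allowance, so it is measurable; off this event, continuity extends
  the bound from dyadic points to the whole interval.\<close>

lemma sup_tail:
  assumes u: "0 \<le> u" and h: "0 < h" and l: "0 < l"
  shows "\<exists>A\<in>events. prob A \<le> 150000 * h\<^sup>2 / l ^ 4 \<and>
     (\<forall>\<omega>\<in>space M - A. \<forall>s\<in>{u..u+h}. \<bar>B s \<omega> - B u \<omega>\<bar> \<le> l)"
proof -
  define p where "p j i = u + h * (real i / 2 ^ j)" for j i :: nat
  define L where "L j = l / 10 * (9/10) ^ j" for j :: nat
  define E where "E j i = {\<omega>\<in>space M. L j \<le> \<bar>B (p j (Suc i)) \<omega> - B (p j i) \<omega>\<bar>}" for j i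
  define A where "A j = (\<Union>i<2^j. E j i)" for j
  \<comment> \<open>Ratio of the union bounds of consecutive levels: twice as many cells, a quarter
    of the squared length, and an allowance whose fourth power shrinks by \<open>(9/10)^4\<close>.
    It is below 4/5, so the geometric series is at most 5; with \<open>3 * 10 ^ 4\<close> from the
    moment and the factor 1/10 this gives 150000.\<close>
  define r :: real where "r = (10/9)^4 / 2"
  have p0: "p j i \<ge> 0" for j i using u h by (simp add: p_def)
  have L0: "L j > 0" for j using l by (simp add: L_def)
  have E: "E j i \<in> events" for j i
    unfolding E_def using p0 by measurable
  have A: "A j \<in> events" for j unfolding A_def using E by auto
  have PE: "prob (E j i) \<le> 3 * (h / 2 ^ j)\<^sup>2 / (L j) ^ 4" for j i
  proof -
    have d: "p j (Suc i) - p j i = h / 2 ^ j" by (simp add: p_def field_simps)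
    moreover have "0 < h / 2 ^ j" using h by simp
    ultimately have "p j i < p j (Suc i)" by linarith
    from inc_tail[OF p0 this L0[of j]] show ?thesis unfolding E_def d .
  qed
  have PA: "prob (A j) \<le> 30000 * h\<^sup>2 / l ^ 4 * r ^ j" for j
  proof -
    have "prob (A j) \<le> (\<Sum>i<2^j. prob (E j i))" unfolding A_def
      using E by (intro finite_measure_subadditive_finite) auto
    also have "\<dots> \<le> (\<Sum>i<(2::nat)^j. 3 * (h / 2 ^ j)\<^sup>2 / (L j) ^ 4)" by (intro sum_mono PE)
    also have "\<dots> = 30000 * h\<^sup>2 / l ^ 4 * r ^ j"
    proof -
      have L4: "(L j) ^ 4 = l ^ 4 / 10000 * ((9/10) ^ 4) ^ j"
        unfolding L_def power_mult_distrib power_divide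
        by (simp only: power_mult[symmetric] mult.commute[of j]) simp
      have rj: "r ^ j = 1 / (2 ^ j * ((9/10)^4) ^ j)"
      proof -
        have "r = 1 / (2 * (9/10) ^ 4)" by (simp add: r_def power_divide)
        then show ?thesis by (simp only: power_one_over power_mult_distrib)
      qed
      have "Q * (3 * (h / Q)\<^sup>2 / (l ^ 4 / 10000 * P)) = 30000 * h\<^sup>2 / l ^ 4 * (1 / (Q * P))"
        if "P > 0" "Q > 0" for P Q :: real
        using that l by (simp add: power2_eq_square field_simps)
      from this[of "((9/10)^4) ^ j" "2 ^ j"]
      have "2 ^ j * (3 * (h / 2 ^ j)\<^sup>2 / (l ^ 4 / 10000 * ((9/10)^4) ^ j)) = 30000 * h\<^sup>2 / l ^ 4 * r ^ j"
        unfolding rj by simp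
      then show ?thesis unfolding L4 by simp
    qed
    finally show ?thesis .
  qed
  have r: "0 < r" "r < 1" by (auto simp: r_def field_simps)
  have sr: "summable (\<lambda>j. 30000 * h\<^sup>2 / l ^ 4 * r ^ j)" using r by (intro summable_mult summable_geometric) auto
  have sA: "summable (\<lambda>j. prob (A j))"
    by (rule summable_comparison_test'[OF sr, of 0]) (use PA in auto)
  have "prob (\<Union>j. A j) \<le> (\<Sum>j. prob (A j))"
    using A sA by (intro finite_measure_subadditive_countably) auto
  also have "\<dots> \<le> (\<Sum>j. 30000 * h\<^sup>2 / l ^ 4 * r ^ j)" by (intro suminf_le PA sA sr)
  also have "\<dots> = 30000 * h\<^sup>2 / l ^ 4 * (1 / (1 - r))"
    using r by (subst suminf_mult) (auto simp: suminf_geometric summable_geometric)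
  also have "\<dots> \<le> 30000 * h\<^sup>2 / l ^ 4 * 5" using l r
    by (intro mult_left_mono) (auto simp: r_def field_simps)
  finally have PU: "prob (\<Union>j. A j) \<le> 150000 * h\<^sup>2 / l ^ 4" by simp
  have good: "\<bar>B s \<omega> - B u \<omega>\<bar> \<le> l" if w: "\<omega> \<in> space M - (\<Union>j. A j)" and s: "s \<in> {u..u+h}" for \<omega> s
  proof -
    have "\<bar>B (u + h * ((s - u) / h)) \<omega> - B (u + h * 0) \<omega>\<bar> \<le> l"
    proof (rule chaining_bound[of "\<lambda>x. B (u + h * x) \<omega>"])
      fix j i :: nat assume "i < 2 ^ j"
      then have "\<omega> \<notin> E j i" using w by (auto simp: A_def)
      then show "\<bar>B (u + h * (real (Suc i) / 2 ^ j)) \<omega> - B (u + h * (real i / 2 ^ j)) \<omega>\<bar> \<le> l / 10 * (9/10) ^ j"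
        using w by (auto simp: E_def p_def L_def not_le)
    next
      show "continuous_on {0..1} (\<lambda>x. B (u + h * x) \<omega>)"
        using w u h by (intro continuous_on_compose2[OF cont_B[of \<omega>]] continuous_intros) auto
    qed (use l h s in \<open>auto simp: field_simps\<close>)
    then show ?thesis using h by simp
  qed
  show ?thesis by (rule bexI[of _ "\<Union>j. A j"]) (use PU good A in auto)
qed

lemma AE_eventually_avoids:
  assumes A: "\<And>n. A n \<in> events" and P: "\<And>n. prob (A n) \<le> C * r ^ n" and r: "0 < r" "r < 1"
  shows "AE \<omega> in M. \<exists>N. \<forall>n\<ge>N. \<omega> \<in> space M - A n"
proof -
  have "summable (\<lambda>n. C * r ^ n)" using r by (intro summable_mult summable_geometric) auto
  then have "summable (\<lambda>n. prob (A n))"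
    by (rule summable_comparison_test'[of _ 0]) (use P in auto)
  from borel_cantelli_AE1[OF A _ this] show ?thesis
    by (simp add: less_top[symmetric] eventually_sequentially)
qed

text \<open>On the dyadic block up to \<open>2 ^ Suc n\<close> the level \<open>(2^n) powr q\<close>
  is exceeded with probability of order \<open>2 powr ((2 - 4 * q) * n)\<close>, which is summable
  exactly because \<open>q > 1/2\<close>. Borel-Cantelli then applies.\<close>

lemma B_growth:
  assumes q: "q > 1/2"
  shows "AE \<omega> in M. \<forall>\<^sub>F t in at_top. \<bar>B t \<omega>\<bar> \<le> t powr q"
proof -
  have "\<forall>n::nat. \<exists>A\<in>events. prob A \<le> 150000 * (2^Suc n)\<^sup>2 / ((2^n) powr q) ^ 4 \<and>
     (\<forall>\<omega>\<in>space M - A. \<forall>s\<in>{0..0+2^Suc n}. \<bar>B s \<omega> - B 0 \<omega>\<bar> \<le> (2^n) powr q)"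
    by (intro allI sup_tail) auto
  then obtain A where A: "\<And>n::nat. A n \<in> events"
    "\<And>n. prob (A n) \<le> 150000 * (2^Suc n)\<^sup>2 / ((2^n) powr q) ^ 4"
    "\<And>n \<omega> s. \<omega>\<in>space M - A n \<Longrightarrow> s\<in>{0..2^Suc n} \<Longrightarrow> \<bar>B s \<omega> - B 0 \<omega>\<bar> \<le> (2^n) powr q"
    by (metis add_0)
  define r :: real where "r = 2 powr (2 - 4 * q)"
  have r: "0 < r" "r < 1" using q powr_less_mono[of "2 - 4 * q" 0 2] by (auto simp: r_def)
  have PA: "prob (A n) \<le> 600000 * r ^ n" for n
  proof -
    have p2: "(2::real) ^ n = 2 powr n" by (simp add: powr_realpow)
    have "((2^n) powr q) ^ 4 = (2::real) powr (4 * q * n)"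
      unfolding p2 by (simp add: powr_powr powr_power mult_ac)
    moreover have "((2::real)^Suc n)\<^sup>2 = 4 * 2 powr (2 * n)"
      unfolding power_Suc p2 by (simp add: power_mult_distrib powr_power)
    moreover have "r ^ n = 2 powr (2 * n) / 2 powr (4 * q * n)"
      by (simp add: r_def powr_power powr_diff[symmetric] algebra_simps)
    ultimately show ?thesis using A(2)[of n] by simp
  qed
  from AE_eventually_avoids[OF A(1) PA r] show ?thesis
  proof (rule AE_mp, intro AE_I2 impI, elim exE)
    fix \<omega> N assume w: "\<omega> \<in> space M" and "\<forall>n\<ge>N. \<omega> \<in> space M - A n"
    then have N: "\<And>n. n \<ge> N \<Longrightarrow> \<omega> \<in> space M - A n" by blast
    show "\<forall>\<^sub>F t in at_top. \<bar>B t \<omega>\<bar> \<le> t powr q"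
      unfolding eventually_at_top_linorder
    proof (intro exI[of _ "2^N"] allI impI)
      fix t :: real assume "2 ^ N \<le> t"
      then obtain n where n: "N \<le> n" "2 ^ n \<le> t" "t < 2 ^ Suc n" by (rule dyadic_scale)
      have t0: "0 \<le> t" using n(2) by (smt (verit) zero_le_power)
      have "\<bar>B t \<omega>\<bar> \<le> (2^n) powr q" using A(3)[OF N[OF n(1)], of t] n t0 B_0[OF w] by auto
      also have "\<dots> \<le> t powr q" using n q by (intro powr_mono2) auto
      finally show "\<bar>B t \<omega>\<bar> \<le> t powr q" .
    qed
  qed
qed

text \<open>The block between \<open>2 ^ n\<close> and \<open>2 ^ Suc n\<close> is covered by about
  \<open>2 ^ n / h n\<close> windows, each failing with probability of order
  \<open>(h n / 2 ^ n)\<^sup>2\<close>. The total is of order \<open>h n / 2 ^ n\<close>, that is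
  \<open>2 powr ((p - 1) * n)\<close>, summable since \<open>p < 1\<close>.\<close>

lemma B_oscillation:
  assumes p: "0 < p" "p < 1" and c: "c > 0"
  shows "AE \<omega> in M. \<forall>\<^sub>F t in at_top. \<forall>v\<in>{t..t + t powr p}. \<bar>B v \<omega> - B t \<omega>\<bar> \<le> c * sqrt t"
proof -
  define h where "h n = (2 ^ Suc n :: real) powr p" for n :: nat
  define l where "l n = c / 2 * sqrt (2 ^ n)" for n :: nat
  define u where "u n i = 2 ^ n + real i * h n" for n i :: nat
  define K where "K n = nat \<lfloor>2 ^ n / h n\<rfloor> + 1" for n :: nat
  have h0: "0 < h n" for n by (simp add: h_def)
  have l0: "0 < l n" for n using c by (simp add: l_def)
  have u0: "0 \<le> u n i" for n i using h0[of n] by (simp add: u_def less_imp_le)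
  \<comment> \<open>The windows start every \<open>h n\<close> but have length
    \<open>2 * h n\<close>, so a window with \<open>t\<close> in its first half also contains
    \<open>t + t powr p\<close>. Comparing both points with its left end costs
    \<open>2 * l n \<le> c * sqrt t\<close>.\<close>
  have "\<forall>n i. \<exists>A\<in>events. prob A \<le> 150000 * (2 * h n)\<^sup>2 / (l n) ^ 4 \<and>
     (\<forall>\<omega>\<in>space M - A. \<forall>s\<in>{u n i..u n i + 2 * h n}. \<bar>B s \<omega> - B (u n i) \<omega>\<bar> \<le> l n)"
    using h0 l0 u0 by (intro allI sup_tail) auto
  then obtain A where A: "\<And>n i::nat. A n i \<in> events"
    "\<And>n i. prob (A n i) \<le> 150000 * (2 * h n)\<^sup>2 / (l n) ^ 4"
    "\<And>n i \<omega> s. \<omega>\<in>space M - A n i \<Longrightarrow> s\<in>{u n i..u n i + 2 * h n} \<Longrightarrow> \<bar>B s \<omega> - B (u n i) \<omega>\<bar> \<le> l n"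
    by metis
  define D where "D n = (\<Union>i<K n. A n i)" for n
  define r :: real where "r = 2 powr (p - 1)"
  have r: "0 < r" "r < 1" using p powr_less_mono[of "p - 1" 0 2] by (auto simp: r_def)
  define C where "C = 28800000 / c ^ 4 * 2 powr p"
  have PD: "prob (D n) \<le> C * r ^ n" for n
  proof -
    have "(1::real) \<le> 2 ^ Suc n" by (rule one_le_power) simp
    then have "h n \<le> 2 ^ Suc n" using powr_mono[of p 1 "2 ^ Suc n"] p by (simp add: h_def)
    then have "1 \<le> 2 * (2 ^ n / h n)" using h0[of n] by (simp add: field_simps)
    moreover have "real (nat \<lfloor>2 ^ n / h n\<rfloor>) \<le> 2 ^ n / h n"
      using h0[of n] by (intro of_nat_floor) auto
    moreover have "real (K n) = real (nat \<lfloor>2 ^ n / h n\<rfloor>) + 1" by (simp add: K_def)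
    ultimately have K: "real (K n) \<le> 3 * (2 ^ n / h n)" by linarith
    have "prob (D n) \<le> (\<Sum>i<K n. prob (A n i))" unfolding D_def
      using A(1) by (intro finite_measure_subadditive_finite) auto
    also have "\<dots> \<le> (\<Sum>i<K n. 150000 * (2 * h n)\<^sup>2 / (l n) ^ 4)" by (intro sum_mono A(2))
    also have "\<dots> = real (K n) * (150000 * (2 * h n)\<^sup>2 / (l n) ^ 4)" by simp
    also have "\<dots> \<le> 3 * (2 ^ n / h n) * (150000 * (2 * h n)\<^sup>2 / (l n) ^ 4)"
      using K by (intro mult_right_mono) auto
    also have "\<dots> = C * r ^ n"
    proof -
      have "sqrt (2 ^ n) ^ 4 = ((2::real) ^ n)\<^sup>2"
        using power_mult[of "sqrt (2 ^ n)" 2 2] by simp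
      then have l4: "(l n) ^ 4 = c ^ 4 / 16 * (2 ^ n)\<^sup>2" by (simp add: l_def power_mult_distrib power_divide)
      have p2: "(2::real) ^ n = 2 powr n" by (simp add: powr_realpow)
      have "r ^ n = 2 powr (p * n) / 2 ^ n"
        unfolding p2 by (simp add: r_def powr_power powr_diff[symmetric] algebra_simps)
      moreover have "h n = 2 powr p * 2 powr (p * n)"
        unfolding h_def power_Suc p2 by (simp add: powr_mult powr_powr mult_ac)
      ultimately have hr: "h n = 2 powr p * r ^ n * 2 ^ n" by simp
      have "3 * (2 ^ n / h n) * (150000 * (2 * h n)\<^sup>2 / (l n) ^ 4) = 28800000 / c ^ 4 * (h n / 2 ^ n)"
        unfolding l4 using h0[of n] c by (simp add: power2_eq_square field_simps)
      also have "\<dots> = C * r ^ n" by (simp add: hr C_def)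
      finally show ?thesis .
    qed
    finally show ?thesis .
  qed
  have Dm: "D n \<in> events" for n unfolding D_def using A(1) by auto
  from AE_eventually_avoids[OF Dm PD r] show ?thesis
  proof (rule AE_mp, intro AE_I2 impI, elim exE)
    fix \<omega> N assume "\<forall>n\<ge>N. \<omega> \<in> space M - D n"
    then have N: "\<And>n. n \<ge> N \<Longrightarrow> \<omega> \<in> space M - D n" by blast
    show "\<forall>\<^sub>F t in at_top. \<forall>v\<in>{t..t + t powr p}. \<bar>B v \<omega> - B t \<omega>\<bar> \<le> c * sqrt t"
      unfolding eventually_at_top_linorder
    proof (intro exI[of _ "2^N"] allI impI ballI)
      fix t v :: real assume "2 ^ N \<le> t" and v: "v \<in> {t..t + t powr p}"
      then obtain n where n: "N \<le> n" "2 ^ n \<le> t" "t < 2 ^ Suc n" using dyadic_scale by blast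
      have t0: "0 < t" using n(2) by (smt (verit) zero_less_power)
      define i where "i = nat \<lfloor>(t - 2 ^ n) / h n\<rfloor>"
      have "real i \<le> (t - 2 ^ n) / h n" unfolding i_def using n h0[of n] by (intro of_nat_floor) auto
      moreover have "(t - 2 ^ n) / h n < real i + 1" unfolding i_def using n h0[of n] by linarith
      ultimately have i: "u n i \<le> t" "t < u n i + h n" using h0[of n] by (auto simp: u_def field_simps)
      have "(t - 2 ^ n) / h n \<le> 2 ^ n / h n" using n h0[of n] by (intro divide_right_mono) auto
      then have "i < K n" unfolding i_def K_def by (simp add: nat_mono floor_mono less_Suc_eq_le)
      then have w': "\<omega> \<in> space M - A n i" using N[OF n(1)] by (auto simp: D_def)
      have "t powr p \<le> h n" unfolding h_def using n t0 p by (intro powr_mono2) auto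
      then have "\<bar>B v \<omega> - B (u n i) \<omega>\<bar> \<le> l n" "\<bar>B t \<omega> - B (u n i) \<omega>\<bar> \<le> l n"
        using A(3)[OF w', of v] A(3)[OF w', of t] i v h0[of n] by auto
      then have "\<bar>B v \<omega> - B t \<omega>\<bar> \<le> 2 * l n" by linarith
      also have "\<dots> \<le> c * sqrt t" using n c by (simp add: l_def)
      finally show "\<bar>B v \<omega> - B t \<omega>\<bar> \<le> c * sqrt t" .
    qed
  qed
qed

end

section \<open>Leaving the diffusive scale\<close>

context brownian
begin

abbreviation Ft where "Ft \<equiv> nat_filtration M B"

abbreviation gen_Ft where "gen_Ft t \<equiv> (\<Union>s\<in>{0..t}. {B s -` A \<inter> space M | A. A \<in> sets borel})"

lemma space_Ft[simp]: "space (Ft t) = space M"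
  unfolding nat_filtration_def by (rule space_measure_of) auto

lemma sets_Ft: "sets (Ft t) = sigma_sets (space M) (gen_Ft t)"
  unfolding nat_filtration_def by (rule sets_measure_of) auto

lemma Ft_mono: "s \<le> t \<Longrightarrow> sets (Ft s) \<subseteq> sets (Ft t)"
  unfolding sets_Ft by (rule sigma_sets_mono') force

lemma Ft_events: "sets (Ft t) \<subseteq> events"
  unfolding sets_Ft
  by (rule sets.sigma_sets_subset) (auto intro!: measurable_sets[OF meas_B])

lemma measurable_Ft_mono: "g \<in> borel_measurable (Ft s) \<Longrightarrow> s \<le> t \<Longrightarrow> g \<in> borel_measurable (Ft t)"
  using Ft_mono[of s t] by (auto simp: measurable_def)

lemma measurable_Ft_M: "g \<in> borel_measurable (Ft s) \<Longrightarrow> g \<in> borel_measurable M"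
  using Ft_events[of s] by (auto simp: measurable_def)

lemma B_Ft: "0 \<le> s \<Longrightarrow> s \<le> t \<Longrightarrow> B s \<in> borel_measurable (Ft t)"
proof (rule measurableI)
  fix A :: "real set" assume "0 \<le> s" "s \<le> t" "A \<in> sets borel"
  then show "B s -` A \<inter> space (Ft t) \<in> sets (Ft t)"
    unfolding sets_Ft space_Ft by (intro sigma_sets.Basic) force
qed simp

text \<open>Values of \<open>B\<close> at finitely many times up to \<open>t\<close> are partial
  sums of increments along the sorted times, and the increment from \<open>t\<close> to
  \<open>u\<close> is one further member of the same independent family.\<close>

lemma indep_cylinder:
  assumes t: "0 \<le> t" "t < u" and S: "finite S" "S \<subseteq> {0..t}" "S \<noteq> {}" and A: "\<And>s. A s \<in> sets borel" and Y: "Y \<in> sets borel"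
  shows "prob ({\<omega>\<in>space M. \<forall>s\<in>S. B s \<omega> \<in> A s} \<inter> ((\<lambda>\<omega>. B u \<omega> - B t \<omega>) -` Y \<inter> space M)) =
    prob {\<omega>\<in>space M. \<forall>s\<in>S. B s \<omega> \<in> A s} * prob ((\<lambda>\<omega>. B u \<omega> - B t \<omega>) -` Y \<inter> space M)"
proof -
  \<comment> \<open>The time 0 is added so that the partial sums start from \<open>B 0 = 0\<close>,
    and \<open>t\<close> so that the last increment starts exactly there.\<close>
  define xs where "xs = sorted_list_of_set (insert 0 (insert t S))"
  have fin: "finite (insert 0 (insert t S))" using S by auto
  have xs: "set xs = insert 0 (insert t S)" "sorted_wrt (<) xs"
    unfolding xs_def using fin by (simp_all only: set_sorted_list_of_set strict_sorted_list_of_set)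
  define m where "m = length xs - 1"
  have len: "length xs = Suc m" using xs by (cases xs) (auto simp: m_def)
  define ts where "ts i = (if i \<le> m then xs ! i else u)" for i
  have nth_mono: "xs ! i < xs ! j" if "i < j" "j \<le> m" for i j
    using xs(2) that len by (auto simp: sorted_wrt_iff_nth_less)
  have range: "0 \<le> xs ! i" "xs ! i \<le> t" if "i \<le> m" for i
    using nth_mem[of i xs] that len xs S t by auto
  have ex: "\<exists>i\<le>m. xs ! i = s" if "s \<in> insert 0 (insert t S)" for s
    using that xs len by (metis in_set_conv_nth less_Suc_eq_le)
  have ts0: "ts 0 = 0"
  proof -
    obtain i where i: "i \<le> m" "xs ! i = 0" using ex[of 0] by auto
    then have "i = 0" using nth_mono[of 0 i] range(1)[of 0] by (cases i) auto
    then show ?thesis using i by (simp add: ts_def)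
  qed
  have tsm: "ts m = t"
  proof -
    obtain i where i: "i \<le> m" "xs ! i = t" using ex[of t] by auto
    then have "i = m" using nth_mono[of i m] range(2)[of m] by (cases "i = m") auto
    then show ?thesis using i by (simp add: ts_def)
  qed
  have tsu: "ts (Suc m) = u" by (simp add: ts_def)
  define Z where "Z i \<omega> = B (ts (Suc i)) \<omega> - B (ts i) \<omega>" for i \<omega>
  have ind: "indep_vars (\<lambda>_. borel) Z {..<Suc m}"
    unfolding Z_def
  proof (rule B_indep)
    fix i assume "i < Suc m"
    then show "ts i < ts (Suc i)"
      using nth_mono[of i "Suc i"] tsm tsu t by (cases "i = m") (auto simp: ts_def)
  qed (simp add: ts0)
  have iv: "indep_var (PiM {..<m} (\<lambda>_. borel)) (\<lambda>\<omega>. restrict (\<lambda>i. Z i \<omega>) {..<m})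
     (PiM {m} (\<lambda>_. borel)) (\<lambda>\<omega>. restrict (\<lambda>i. Z i \<omega>) {m})"
    by (rule indep_var_restrict[OF ind]) auto
  have sumZ: "B (xs ! i) \<omega> = (\<Sum>j<i. Z j \<omega>)" if "i \<le> m" "\<omega> \<in> space M" for i \<omega>
    unfolding Z_def using sum_lessThan_telescope[of "\<lambda>j. B (ts j) \<omega>" i] that ts0 B_0[of \<omega>]
    by (simp add: ts_def)
  define idx where "idx s = (SOME i. i \<le> m \<and> xs ! i = s)" for s
  have idx: "idx s \<le> m" "xs ! idx s = s" if "s \<in> S" for s
    using someI_ex[OF ex[of s, simplified]] that unfolding idx_def by auto
  define Xa where "Xa = {y\<in>space (PiM {..<m} (\<lambda>_. borel)). \<forall>s\<in>S. (\<Sum>j<idx s. y j) \<in> A s}"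
  define Xb where "Xb = {y\<in>space (PiM {m} (\<lambda>_. borel)). y m \<in> Y}"
  have Xa: "Xa \<in> sets (PiM {..<m} (\<lambda>_. borel :: real measure))"
  proof -
    have "{y\<in>space (PiM {..<m} (\<lambda>_. borel :: real measure)). (\<Sum>j<idx s. y j) \<in> A s} \<in> sets (PiM {..<m} (\<lambda>_. borel))"
      if "s \<in> S" for s
    proof -
      have "(\<lambda>y. \<Sum>j<idx s. y j) \<in> borel_measurable (PiM {..<m} (\<lambda>_. borel :: real measure))"
        using idx(1)[OF that] by (intro borel_measurable_sum measurable_component_singleton) auto
      from measurable_sets[OF this A[of s]] show ?thesis by (simp add: vimage_def Int_def conj_commute)
    qed
    then show ?thesis unfolding Xa_def using S by (intro sets.sets_Collect_finite_All') auto
  qed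
  have Xb: "Xb \<in> sets (PiM {m} (\<lambda>_. borel :: real measure))"
  proof -
    have "(\<lambda>y. y m) \<in> borel_measurable (PiM {m} (\<lambda>_. borel :: real measure))"
      by (intro measurable_component_singleton) auto
    from measurable_sets[OF this Y] show ?thesis by (simp add: Xb_def vimage_def Int_def conj_commute)
  qed
  have ea: "(\<lambda>\<omega>. restrict (\<lambda>i. Z i \<omega>) {..<m}) -` Xa \<inter> space M = {\<omega>\<in>space M. \<forall>s\<in>S. B s \<omega> \<in> A s}"
  proof -
    have "(\<Sum>j<idx s. restrict (\<lambda>i. Z i \<omega>) {..<m} j) = B s \<omega>" if "s \<in> S" "\<omega> \<in> space M" for s \<omega>
      using sumZ[OF idx(1)[OF that(1)] that(2)] idx[OF that(1)] by (auto intro!: sum.cong)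
    then show ?thesis by (auto simp: Xa_def space_PiM)
  qed
  have eb: "(\<lambda>\<omega>. restrict (\<lambda>i. Z i \<omega>) {m}) -` Xb \<inter> space M = (\<lambda>\<omega>. B u \<omega> - B t \<omega>) -` Y \<inter> space M"
    by (auto simp: Xb_def space_PiM Z_def tsm tsu)
  have "prob ((\<lambda>\<omega>. (restrict (\<lambda>i. Z i \<omega>) {..<m}, restrict (\<lambda>i. Z i \<omega>) {m})) -` (Xa \<times> Xb) \<inter> space M)
    = prob {\<omega>\<in>space M. \<forall>s\<in>S. B s \<omega> \<in> A s} * prob ((\<lambda>\<omega>. B u \<omega> - B t \<omega>) -` Y \<inter> space M)"
    using indep_varD[OF iv Xa Xb] unfolding ea eb .
  moreover have "(\<lambda>\<omega>. (restrict (\<lambda>i. Z i \<omega>) {..<m}, restrict (\<lambda>i. Z i \<omega>) {m})) -` (Xa \<times> Xb) \<inter> space M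
    = {\<omega>\<in>space M. \<forall>s\<in>S. B s \<omega> \<in> A s} \<inter> ((\<lambda>\<omega>. B u \<omega> - B t \<omega>) -` Y \<inter> space M)"
    unfolding ea[symmetric] eb[symmetric] by auto
  ultimately show ?thesis by simp
qed

text \<open>The cylinder events form an intersection-stable family generating \<open>Ft t\<close>,
  so their independence of the increment extends to the whole sigma-algebra.\<close>

lemma indep_increment:
  assumes t: "0 \<le> t" "t < u" and g: "g \<in> borel_measurable (Ft t)"
  shows "indep_var borel g borel (\<lambda>\<omega>. B u \<omega> - B t \<omega>)"
proof -
  define P where "P = {{\<omega>\<in>space M. \<forall>s\<in>S. B s \<omega> \<in> A s} | S A. finite S \<and> S \<subseteq> {0..t} \<and> S \<noteq> {} \<and> (\<forall>s. A s \<in> sets borel)}"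
  define Q where "Q = {(\<lambda>\<omega>. B u \<omega> - B t \<omega>) -` Y \<inter> space M | Y. Y \<in> sets borel}"
  have Bm: "(\<lambda>\<omega>. B u \<omega> - B t \<omega>) \<in> borel_measurable M"
    using t by (intro borel_measurable_diff meas_B) auto
  have PM: "P \<subseteq> events"
  proof
    fix E assume "E \<in> P"
    then obtain S A where E: "E = {\<omega>\<in>space M. \<forall>s\<in>S. B s \<omega> \<in> A s}" "finite S" "S \<subseteq> {0..t}" "S \<noteq> {}" "\<forall>s. A s \<in> sets borel"
      unfolding P_def by blast
    have "{\<omega>\<in>space M. B s \<omega> \<in> A s} \<in> events" if "s \<in> S" for s
      using measurable_sets[OF meas_B, of s "A s"] E that by (auto simp: vimage_def Int_def conj_commute)
    then show "E \<in> events" unfolding E(1) using E(2,4) by (intro sets.sets_Collect_finite_All') auto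
  qed
  have "indep_set P Q"
    unfolding indep_sets2_eq
  proof (intro conjI ballI)
    show "Q \<subseteq> events" unfolding Q_def using measurable_sets[OF Bm] by auto
    fix a b assume "a \<in> P" "b \<in> Q"
    then show "prob (a \<inter> b) = prob a * prob b" unfolding P_def Q_def
      using indep_cylinder[OF t] by blast
  qed (rule PM)
  moreover have "Int_stable P"
  proof (rule Int_stableI)
    fix a b assume "a \<in> P" "b \<in> P"
    then obtain S A S' A' where a: "a = {\<omega>\<in>space M. \<forall>s\<in>S. B s \<omega> \<in> A s}" "finite S" "S \<subseteq> {0..t}" "S \<noteq> {}" "\<forall>s. A s \<in> sets borel"
      and b: "b = {\<omega>\<in>space M. \<forall>s\<in>S'. B s \<omega> \<in> A' s}" "finite S'" "S' \<subseteq> {0..t}" "S' \<noteq> {}" "\<forall>s. A' s \<in> sets borel"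
      unfolding P_def by blast
    \<comment> \<open>Cylinders over different time sets are merged over the union of these sets,
      with no constraint, \<open>UNIV\<close>, at the times where one of them is silent.\<close>
    define A'' where "A'' s = (if s \<in> S then A s else UNIV) \<inter> (if s \<in> S' then A' s else UNIV)" for s
    have "a \<inter> b = {\<omega>\<in>space M. \<forall>s\<in>S \<union> S'. B s \<omega> \<in> A'' s}" unfolding a(1) b(1) A''_def by auto
    moreover have "\<forall>s. A'' s \<in> sets borel" using a(5) b(5) by (auto simp: A''_def)
    moreover have "finite (S \<union> S')" "S \<union> S' \<subseteq> {0..t}" "S \<union> S' \<noteq> {}" using a b by auto
    ultimately show "a \<inter> b \<in> P" unfolding P_def by blast
  qed
  moreover have "Int_stable Q"
  proof (rule Int_stableI)
    fix a b assume "a \<in> Q" "b \<in> Q"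
    then obtain Y Y' where "a = (\<lambda>\<omega>. B u \<omega> - B t \<omega>) -` Y \<inter> space M" "Y \<in> sets borel"
      "b = (\<lambda>\<omega>. B u \<omega> - B t \<omega>) -` Y' \<inter> space M" "Y' \<in> sets borel" unfolding Q_def by blast
    then show "a \<inter> b \<in> Q" unfolding Q_def by (intro CollectI exI[of _ "Y \<inter> Y'"]) auto
  qed
  ultimately have ind: "indep_set (sigma_sets (space M) P) (sigma_sets (space M) Q)"
    by (rule indep_set_sigma_sets)
  have "gen_Ft t \<subseteq> P"
  proof
    fix E assume "E \<in> gen_Ft t"
    then obtain s A where s: "s \<in> {0..t}" "A \<in> sets borel" "E = B s -` A \<inter> space M" by blast
    show "E \<in> P" unfolding P_def s(3) using s
      by (intro CollectI exI[of _ "{s}"] exI[of _ "\<lambda>_. A"]) auto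
  qed
  then have FP: "sets (Ft t) \<subseteq> sigma_sets (space M) P"
    unfolding sets_Ft by (rule sigma_sets_mono')
  have "sigma_sets (space M) {g -` A \<inter> space M |A. A \<in> sets borel} \<subseteq> sets (Ft t)"
  proof -
    have "{g -` A \<inter> space M |A. A \<in> sets borel} \<subseteq> sets (Ft t)"
      using measurable_sets[OF g] by auto
    then show ?thesis using sets.sigma_sets_subset[of _ "Ft t"] by simp
  qed
  then have "indep_set (sigma_sets (space M) {g -` A \<inter> space M |A. A \<in> sets borel}) (sigma_sets (space M) Q)"
    using ind FP unfolding indep_sets2_eq by blast
  then show ?thesis unfolding indep_var_eq Q_def using measurable_Ft_M[OF g] Bm by blast
qed

text \<open>The cross term has mean 0, because \<open>indicator J * y\<close> is known at time
  \<open>t\<close> and the increment is centred and independent of it. What remains is the variance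
  \<open>u - t\<close> on \<open>J\<close>. The bound on \<open>y\<close> over \<open>J\<close> is
  the localisation that makes the product integrable.\<close>

lemma increment_energy:
  assumes t: "0 \<le> t" "t < u" and J: "J \<in> sets (Ft t)" and y: "y \<in> borel_measurable (Ft t)"
    and bd: "\<And>\<omega>. \<omega> \<in> J \<Longrightarrow> \<bar>y \<omega>\<bar> \<le> a"
  shows "integrable M (\<lambda>\<omega>. indicator J \<omega> * (2 * y \<omega> * (B u \<omega> - B t \<omega>) + (B u \<omega> - B t \<omega>)\<^sup>2))" (is "integrable M ?f")
    and "(\<integral>\<omega>. indicator J \<omega> * (2 * y \<omega> * (B u \<omega> - B t \<omega>) + (B u \<omega> - B t \<omega>)\<^sup>2) \<partial>M) = (u - t) * prob J"
proof -
  let ?d = "\<lambda>\<omega>. B u \<omega> - B t \<omega>"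
  have JM: "J \<in> events" using J Ft_events by blast
  have i1: "(\<lambda>\<omega>. indicator J \<omega> * y \<omega>) \<in> borel_measurable (Ft t)"
    using J y by (intro borel_measurable_times borel_measurable_indicator) auto
  have i2: "(\<lambda>\<omega>. indicator J \<omega> :: real) \<in> borel_measurable (Ft t)"
    using J by (intro borel_measurable_indicator) auto
  have ind1: "indep_var borel (\<lambda>\<omega>. indicator J \<omega> * y \<omega>) borel ?d"
    by (rule indep_increment[OF t i1])
  have ind2: "indep_var borel (\<lambda>\<omega>. indicator J \<omega> :: real) borel (\<lambda>\<omega>. (?d \<omega>)\<^sup>2)"
    using indep_var_compose[OF indep_increment[OF t i2], of "\<lambda>x. x" borel "\<lambda>x. x\<^sup>2" borel]
    by (simp add: o_def)
  have int1: "integrable M (\<lambda>\<omega>. indicator J \<omega> * y \<omega>)"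
    by (rule integrable_const_bound[of _ "\<bar>a\<bar>"])
       (use bd measurable_Ft_M[OF i1] in \<open>auto simp: indicator_def intro!: AE_I2 order_trans[OF bd]\<close>)
  have int2: "integrable M (\<lambda>\<omega>. indicator J \<omega> :: real)" using JM by (intro integrable_real_indicator) (auto simp: less_top[symmetric])
  have d1: "integrable M ?d" using B_moments(1)[OF t, of 1] by simp
  have d2: "integrable M (\<lambda>\<omega>. (?d \<omega>)\<^sup>2)" by (rule B_moments(1)[OF t])
  have p1: "integrable M (\<lambda>\<omega>. indicator J \<omega> * y \<omega> * ?d \<omega>)"
    by (rule indep_var_integrable[OF ind1 int1 d1])
  have p2: "integrable M (\<lambda>\<omega>. indicator J \<omega> * (?d \<omega>)\<^sup>2)"
    by (rule indep_var_integrable[OF ind2 int2 d2])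
  have e1: "(\<integral>\<omega>. indicator J \<omega> * y \<omega> * ?d \<omega> \<partial>M) = 0"
    using indep_var_lebesgue_integral[OF ind1 int1 d1] B_moments(4)[OF t] by simp
  have e2: "(\<integral>\<omega>. indicator J \<omega> * (?d \<omega>)\<^sup>2 \<partial>M) = prob J * (u - t)"
    using indep_var_lebesgue_integral[OF ind2 int2 d2] B_moments(3)[OF t] JM by simp
  have eq: "?f = (\<lambda>\<omega>. 2 * (indicator J \<omega> * y \<omega> * ?d \<omega>) + indicator J \<omega> * (?d \<omega>)\<^sup>2)"
    by (auto simp: algebra_simps)
  show "integrable M ?f" unfolding eq using p1 p2 by auto
  show "(\<integral>\<omega>. ?f \<omega> \<partial>M) = (u - t) * prob J" unfolding eq
    using p1 p2 e1 e2 by simp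
qed

end

text \<open>Summed up, \<open>y (Suc k)\<^sup>2 - y k\<^sup>2 = 2 * y k * db k + db k\<^sup>2 + db k * d k + (y k + y (Suc k)) * d k\<close>. The last product is
  essentially nonnegative for a drift that repels from \<open>0\<close>, and \<open>db k * d k\<close> is small because \<open>d\<close> has bounded variation:
  this replaces the Ito formula for the square.\<close>

lemma discrete_energy:
  fixes y db :: "nat \<Rightarrow> real" and J :: "nat \<Rightarrow> bool" and a L m :: real
  defines "d \<equiv> \<lambda>k. y (Suc k) - y k - db k"
  assumes anti: "\<And>k. J (Suc k) \<Longrightarrow> J k" and ya: "\<And>k. J k \<Longrightarrow> \<bar>y k\<bar> \<le> a"
    and dL: "\<And>k. J k \<Longrightarrow> (\<Sum>j<k. \<bar>d j\<bar>) \<le> L" and a: "0 \<le> a" and L: "0 \<le> L" and m: "0 \<le> m"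
    and dbm: "\<And>k. k < n \<Longrightarrow> \<bar>db k\<bar> \<le> m"
  shows "(\<Sum>k<n. of_bool (J k) * (2 * y k * db k + (db k)\<^sup>2)) \<le>
     a\<^sup>2 + (\<Sum>k<n. of_bool (J (Suc k)) * max 0 (- (y k + y (Suc k)) * d k)) + L * m + 2 * a * m + m\<^sup>2"
proof -
  let ?S = "\<lambda>n. \<Sum>k<n. of_bool (J k) * (2 * y k * db k + (db k)\<^sup>2)"
  let ?E = "\<lambda>n. \<Sum>k<n. of_bool (J (Suc k)) * max 0 (- (y k + y (Suc k)) * d k)"
  \<comment> \<open>An invariant in two phases. While \<open>J\<close> holds, the sum is compared
    with the current \<open>(y n)\<^sup>2\<close>. In the step where \<open>J\<close> fails,
    \<open>y (Suc n)\<close> is out of control, so the last summand is estimated directly by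
    \<open>2 * a * m + m\<^sup>2\<close>; after that all summands vanish.\<close>
  have *: "(J n \<longrightarrow> ?S n \<le> (y n)\<^sup>2 + ?E n + m * (\<Sum>j<n. \<bar>d j\<bar>)) \<and>
        (\<not> J n \<longrightarrow> ?S n \<le> a\<^sup>2 + ?E n + L * m + 2 * a * m + m\<^sup>2)"
    using dbm
  proof (induction n)
    case 0
    then show ?case using a L m by simp
  next
    case (Suc n)
    have IH1: "J n \<Longrightarrow> ?S n \<le> (y n)\<^sup>2 + ?E n + m * (\<Sum>j<n. \<bar>d j\<bar>)"
      and IH2: "\<not> J n \<Longrightarrow> ?S n \<le> a\<^sup>2 + ?E n + L * m + 2 * a * m + m\<^sup>2"
      using Suc.IH Suc.prems by auto
    have dbn: "\<bar>db n\<bar> \<le> m" using Suc.prems by auto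
    show ?case
    proof (cases "J (Suc n)")
      case True
      then have Jn: "J n" by (rule anti)
      have "2 * y n * db n + (db n)\<^sup>2 = (y (Suc n))\<^sup>2 - (y n)\<^sup>2 + (- (y n + y (Suc n)) * d n) - db n * d n"
        by (simp add: d_def power2_eq_square algebra_simps)
      moreover have "- (db n * d n) \<le> \<bar>db n\<bar> * \<bar>d n\<bar>" by (metis abs_ge_minus_self abs_mult)
      moreover have "\<bar>db n\<bar> * \<bar>d n\<bar> \<le> m * \<bar>d n\<bar>" using dbn by (intro mult_right_mono) auto
      moreover have "- (y n + y (Suc n)) * d n \<le> max 0 (- (y n + y (Suc n)) * d n)" by simp
      ultimately have "2 * y n * db n + (db n)\<^sup>2 \<le> (y (Suc n))\<^sup>2 - (y n)\<^sup>2 + max 0 (- (y n + y (Suc n)) * d n) + m * \<bar>d n\<bar>"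
        by linarith
      then show ?thesis using IH1[OF Jn] Jn True by (simp add: algebra_simps)
    next
      case False
      show ?thesis
      proof (cases "J n")
        case Jn: True
        have "(y n)\<^sup>2 \<le> a\<^sup>2" using ya[OF Jn] a by (simp add: abs_le_square_iff[symmetric])
        moreover have "m * (\<Sum>j<n. \<bar>d j\<bar>) \<le> L * m"
          using dL[OF Jn] m by (subst mult.commute, intro mult_right_mono) auto
        moreover have "?S (Suc n) = ?S n + (2 * y n * db n + (db n)\<^sup>2)" using Jn by simp
        moreover have "?E (Suc n) = ?E n" using False by simp
        moreover have "2 * y n * db n \<le> 2 * a * m"
        proof -
          have "y n * db n \<le> \<bar>y n\<bar> * \<bar>db n\<bar>" by (metis abs_ge_self abs_mult)
          also have "\<dots> \<le> a * m" using ya[OF Jn] dbn a by (intro mult_mono) auto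
          finally show ?thesis by simp
        qed
        moreover have "(db n)\<^sup>2 \<le> m\<^sup>2" using dbn m by (simp add: abs_le_square_iff[symmetric])
        ultimately have "?S (Suc n) \<le> a\<^sup>2 + ?E (Suc n) + L * m + 2 * a * m + m\<^sup>2"
          using IH1[OF Jn] by linarith
        then show ?thesis using False by blast
      next
        case nJ: False
        then show ?thesis using IH2 False by simp
      qed
    qed
  qed
  show ?thesis
  proof (cases "J n")
    case True
    have "(y n)\<^sup>2 \<le> a\<^sup>2" using ya[OF True] a by (simp add: abs_le_square_iff[symmetric])
    moreover have "m * (\<Sum>j<n. \<bar>d j\<bar>) \<le> L * m" using dL[OF True] m by (subst mult.commute, intro mult_right_mono) auto
    moreover have "0 \<le> 2 * a * m" using a m by simp
    ultimately show ?thesis using * True by (smt (verit) zero_le_power2)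
  qed (use * in auto)
qed

text \<open>A crude bound that does not depend on the mesh. It serves as the dominating constant
  when the error sum is sent to 0 by dominated convergence.\<close>

lemma discrete_energy_bounded:
  fixes y d :: "nat \<Rightarrow> real" and J :: "nat \<Rightarrow> bool" and a L :: real
  assumes anti: "\<And>k. J (Suc k) \<Longrightarrow> J k" and ya: "\<And>k. J k \<Longrightarrow> \<bar>y k\<bar> \<le> a"
    and dL: "\<And>k. J k \<Longrightarrow> (\<Sum>j<k. \<bar>d j\<bar>) \<le> L" and a: "0 \<le> a" and L: "0 \<le> L"
  shows "(\<Sum>k<n. of_bool (J (Suc k)) * max 0 (- (y k + y (Suc k)) * d k)) \<le> 2 * a * L"
proof -
  let ?E = "\<lambda>n. \<Sum>k<n. of_bool (J (Suc k)) * max 0 (- (y k + y (Suc k)) * d k)"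
  have *: "(J n \<longrightarrow> ?E n \<le> 2 * a * (\<Sum>j<n. \<bar>d j\<bar>)) \<and> ?E n \<le> 2 * a * L"
  proof (induction n)
    case 0
    then show ?case using a L by simp
  next
    case (Suc n)
    show ?case
    proof (cases "J (Suc n)")
      case True
      then have Jn: "J n" by (rule anti)
      have "\<bar>- (y n + y (Suc n)) * d n\<bar> \<le> (2 * a) * \<bar>d n\<bar>"
        unfolding abs_mult using ya[OF Jn] ya[OF True] by (intro mult_right_mono) auto
      then have "max 0 (- (y n + y (Suc n)) * d n) \<le> 2 * a * \<bar>d n\<bar>" using a by auto
      moreover have "?E (Suc n) = ?E n + max 0 (- (y n + y (Suc n)) * d n)" using True by simp
      moreover have "2 * a * (\<Sum>j<Suc n. \<bar>d j\<bar>) = 2 * a * (\<Sum>j<n. \<bar>d j\<bar>) + 2 * a * \<bar>d n\<bar>"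
        by (simp add: distrib_left)
      ultimately have "?E (Suc n) \<le> 2 * a * (\<Sum>j<Suc n. \<bar>d j\<bar>)" using Suc Jn by linarith
      moreover have "2 * a * (\<Sum>j<Suc n. \<bar>d j\<bar>) \<le> 2 * a * L"
        using dL[OF True] a by (intro mult_left_mono) auto
      ultimately show ?thesis by linarith
    next
      case False
      then show ?thesis using Suc by simp
    qed
  qed
  then show ?thesis by blast
qed

section \<open>Equidistant meshes and the energy defect along them\<close>

definition mesh :: "real \<Rightarrow> real \<Rightarrow> nat \<Rightarrow> nat \<Rightarrow> real" where
  "mesh a l n k = a + l * real k / real n"

lemma mesh_0[simp]: "mesh a l n 0 = a" by (simp add: mesh_def)

lemma mesh_top: "n > 0 \<Longrightarrow> mesh a l n n = a + l" by (simp add: mesh_def)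

lemma mesh_step: "mesh a l n (Suc k) - mesh a l n k = l / real n"
  by (simp add: mesh_def add_divide_distrib[symmetric] field_simps)

lemma mesh_mono: "0 \<le> l \<Longrightarrow> j \<le> k \<Longrightarrow> mesh a l n j \<le> mesh a l n k"
  by (auto simp: mesh_def intro!: divide_right_mono mult_left_mono)

lemma mesh_less: "0 < l \<Longrightarrow> 0 < n \<Longrightarrow> mesh a l n k < mesh a l n (Suc k)"
  using mesh_step[of a l n k] by (smt (verit) divide_pos_pos of_nat_0_less_iff)

lemma mesh_ge: "0 \<le> l \<Longrightarrow> a \<le> mesh a l n k"
  using mesh_mono[of l 0 k a n] by simp

lemma mesh_le: "0 \<le> l \<Longrightarrow> 0 < n \<Longrightarrow> k \<le> n \<Longrightarrow> mesh a l n k \<le> a + l"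
  using mesh_mono[of l k n a n] mesh_top[of n a l] by simp

lemma mesh_fine:
  assumes "0 < l" "0 < e"
  obtains N where "\<And>n. n \<ge> N \<Longrightarrow> 0 < n \<and> l / real n < e"
proof -
  obtain N :: nat where N: "l / e < real N" using reals_Archimedean2 by blast
  have "0 < n \<and> l / real n < e" if "n \<ge> N" for n
  proof -
    have "0 < l / e" using assms by simp
    then have n: "0 < n" using N that by (cases n) auto
    have "l / e < real n" using N that by linarith
    then show ?thesis using assms n by (simp add: field_simps)
  qed
  then show thesis using that by blast
qed

context sde_path
begin

lemma hk_abs: "1 \<le> s \<Longrightarrow> ereal t < T \<Longrightarrow> (\<lambda>u. \<bar>f u\<bar>) integrable_on {s..t}"
  using set_borel_integral_eq_integral(1)[OF set_integrable_abs[OF set_int]] by blast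

lemma cell_bound:
  assumes "1 \<le> s" "s \<le> t" "ereal t < T"
  shows "\<bar>x t - x s - (b t - b s)\<bar> \<le> integral {s..t} (\<lambda>u. \<bar>f u\<bar>)"
proof -
  have "norm (integral {s..t} f) \<le> integral {s..t} (\<lambda>u. \<bar>f u\<bar>)"
    using assms by (intro integral_norm_bound_integral hk_int hk_abs) auto
  then show ?thesis using incr[OF assms] by simp
qed

text \<open>Since \<open>x u * f u \<ge> 0\<close>, the product \<open>(x s + x t) * f u\<close> can
  be negative only through the difference between \<open>x s + x t\<close> and
  \<open>2 * x u\<close>, which is at most \<open>2 * e\<close>. So the defect of a cell is the
  oscillation of \<open>x\<close> times the integral of the modulus of the drift.\<close>

lemma cell_energy:
  assumes "1 \<le> s" "s \<le> t" "ereal t < T" and e: "0 \<le> e"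
    and near: "\<And>u. u \<in> {s..t} \<Longrightarrow> \<bar>x s - x u\<bar> \<le> e \<and> \<bar>x t - x u\<bar> \<le> e"
  shows "max 0 (- (x s + x t) * (x t - x s - (b t - b s))) \<le> 2 * e * integral {s..t} (\<lambda>u. \<bar>f u\<bar>)"
proof -
  have fx: "0 \<le> x u * f u" for u
  proof -
    have "x u * f u = \<rho> * (x u * sgn (x u)) * \<bar>x u\<bar> powr \<alpha> / u powr \<beta>" by (simp add: drift_def)
    also have "x u * sgn (x u) = \<bar>x u\<bar>" by (rule abs_sgn[symmetric])
    finally show ?thesis using rho by simp
  qed
  have "integral {s..t} (\<lambda>u. - (x s + x t) * f u) \<le> integral {s..t} (\<lambda>u. 2 * e * \<bar>f u\<bar>)"
  proof (rule integral_le)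
    show "(\<lambda>u. - (x s + x t) * f u) integrable_on {s..t}" using hk_int[OF assms(1,3)] by (rule integrable_on_mult_right)
    show "(\<lambda>u. 2 * e * \<bar>f u\<bar>) integrable_on {s..t}" using hk_abs[OF assms(1,3)] by (rule integrable_on_mult_right)
    fix u assume u: "u \<in> {s..t}"
    have "- (x s + x t) * f u = - 2 * (x u * f u) - ((x s - x u) + (x t - x u)) * f u" by (simp add: algebra_simps)
    also have "\<dots> \<le> - (((x s - x u) + (x t - x u)) * f u)" using fx[of u] by simp
    also have "\<dots> \<le> \<bar>(x s - x u) + (x t - x u)\<bar> * \<bar>f u\<bar>" by (metis abs_ge_minus_self abs_mult)
    also have "\<dots> \<le> (2 * e) * \<bar>f u\<bar>" using near[OF u] by (intro mult_right_mono) auto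
    finally show "- (x s + x t) * f u \<le> 2 * e * \<bar>f u\<bar>" .
  qed
  then have "- (x s + x t) * integral {s..t} f \<le> 2 * e * integral {s..t} (\<lambda>u. \<bar>f u\<bar>)" by simp
  moreover have "0 \<le> integral {s..t} (\<lambda>u. \<bar>f u\<bar>)"
    by (intro Henstock_Kurzweil_Integration.integral_nonneg hk_abs assms) auto
  ultimately show ?thesis using incr[OF assms(1-3)] e by simp
qed

lemma abs_integral_diff:
  assumes "1 \<le> r" "r \<le> s" "s \<le> t" "ereal t < T"
  shows "integral {s..t} (\<lambda>u. \<bar>f u\<bar>) = integral {r..t} (\<lambda>u. \<bar>f u\<bar>) - integral {r..s} (\<lambda>u. \<bar>f u\<bar>)"
  using Henstock_Kurzweil_Integration.integral_combine[OF assms(2,3) hk_abs[OF assms(1,4)]] by simp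

lemma mesh_variation:
  assumes r: "1 \<le> r" "ereal (2 * r) < T" and n: "0 < n"
  shows "(\<Sum>k<n. \<bar>x (mesh r r n (Suc k)) - x (mesh r r n k) - (b (mesh r r n (Suc k)) - b (mesh r r n k))\<bar>)
    \<le> integral {r..2*r} (\<lambda>u. \<bar>f u\<bar>)"
proof -
  let ?I = "\<lambda>k. integral {r..mesh r r n k} (\<lambda>u. \<bar>f u\<bar>)"
  have "(\<Sum>k<n. \<bar>x (mesh r r n (Suc k)) - x (mesh r r n k) - (b (mesh r r n (Suc k)) - b (mesh r r n k))\<bar>)
     \<le> (\<Sum>k<n. ?I (Suc k) - ?I k)"
  proof (rule sum_mono)
    fix k assume "k \<in> {..<n}"
    then have T': "ereal (mesh r r n (Suc k)) < T"
      using mesh_le[of r n "Suc k" r] r n by (intro lt_T[OF _ r(2)]) auto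
    show "\<bar>x (mesh r r n (Suc k)) - x (mesh r r n k) - (b (mesh r r n (Suc k)) - b (mesh r r n k))\<bar> \<le> ?I (Suc k) - ?I k"
      using cell_bound[of "mesh r r n k" "mesh r r n (Suc k)"] abs_integral_diff[of r "mesh r r n k" "mesh r r n (Suc k)"]
        mesh_ge[of r r n k] mesh_mono[of r k "Suc k" r n] r T' by simp
  qed
  also have "\<dots> = ?I n - ?I 0" by (rule sum_lessThan_telescope)
  also have "\<dots> = integral {r..2*r} (\<lambda>u. \<bar>f u\<bar>)" using mesh_top[OF n, of r r] by simp
  finally show ?thesis .
qed

text \<open>Summing \<open>cell_energy\<close> gives the modulus of continuity of \<open>x\<close>
  times its total drift. The difficulty is that the window \<open>{r..2*r}\<close> may extend beyond
  the explosion time; the predicate \<open>N\<close> selects cells whose right endpoint is alive and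
  below \<open>a\<close>.\<close>

lemma mesh_energy_tendsto_0:
  assumes r: "1 \<le> r"
    and N: "\<And>n k. N n k \<Longrightarrow> k < n \<Longrightarrow> ereal (mesh r r n (Suc k)) < T \<and> \<bar>x (mesh r r n (Suc k))\<bar> \<le> a"
  shows "(\<lambda>n. \<Sum>k<n. of_bool (N n k) * max 0 (- (x (mesh r r n k) + x (mesh r r n (Suc k))) *
     (x (mesh r r n (Suc k)) - x (mesh r r n k) - (b (mesh r r n (Suc k)) - b (mesh r r n k))))) \<longlonglongrightarrow> 0"
    (is "(\<lambda>n. \<Sum>k<n. _ n k * ?e n k) \<longlonglongrightarrow> 0")
proof (cases "ereal r < T")
  let ?S = "\<lambda>n. \<Sum>k<n. of_bool (N n k) * ?e n k"
  case False
  have "\<not> N n k" if "k < n" for n k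
    using N[of n k] that False mesh_ge[of r r n "Suc k"] lt_T[of r "mesh r r n (Suc k)"] r by auto
  then have "?S n = 0" for n by (intro sum.neutral) auto
  then show ?thesis by simp
next
  let ?S = "\<lambda>n. \<Sum>k<n. of_bool (N n k) * ?e n k"
  case rT: True
  \<comment> \<open>If the path explodes by time \<open>2 * r\<close>, its modulus exceeds
    \<open>a\<close> close to the explosion, so all selected cells end before some \<open>u1\<close>
    strictly earlier. On \<open>{r..u1}\<close> the path is uniformly continuous and the drift is
    integrable.\<close>
  have "\<exists>u1\<ge>r. ereal u1 < T \<and> (\<forall>n k. N n k \<and> k < n \<longrightarrow> mesh r r n (Suc k) \<le> u1)"
  proof (cases "ereal (2 * r) < T")
    case True
    show ?thesis by (rule exI[of _ "2 * r"]) (use r True mesh_le[of r _ _ r] in auto)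
  next
    case False
    then obtain R where R: "T = ereal R" using T_gt by (cases T) auto
    have "filterlim (\<lambda>t. \<bar>x t\<bar>) at_top (at_left R)"
      using explosion[OF R]
    proof
      assume "filterlim x at_top (at_left R)"
      then show ?thesis by (rule filterlim_at_top_mono) (auto intro: always_eventually)
    next
      assume "filterlim (\<lambda>t. - x t) at_top (at_left R)"
      then show ?thesis by (rule filterlim_at_top_mono) (auto intro: always_eventually)
    qed
    then have "\<forall>\<^sub>F t in at_left R. a < \<bar>x t\<bar>" unfolding filterlim_at_top_dense by blast
    then obtain u0 where u0: "u0 < R" "\<And>v. u0 < v \<Longrightarrow> v < R \<Longrightarrow> a < \<bar>x v\<bar>"
      using rT R by (auto simp: eventually_at_left[of r R])
    show ?thesis
    proof (intro exI[of _ "max r u0"] conjI allI impI)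
      show "ereal (max r u0) < T" using u0 rT R by (auto simp: max_def)
      fix n k assume "N n k \<and> k < n"
      then show "mesh r r n (Suc k) \<le> max r u0"
        using N[of n k] u0(2)[of "mesh r r n (Suc k)"] R by (fastforce simp: not_le[symmetric])
    qed simp
  qed
  then obtain u1 where u1: "r \<le> u1" "ereal u1 < T" "\<And>n k. N n k \<Longrightarrow> k < n \<Longrightarrow> mesh r r n (Suc k) \<le> u1"
    by blast
  define C where "C = integral {r..u1} (\<lambda>u. \<bar>f u\<bar>)"
  have C0: "0 \<le> C" unfolding C_def
    using r u1 by (intro Henstock_Kurzweil_Integration.integral_nonneg hk_abs) auto
  have S0: "0 \<le> ?S n" for n by (intro sum_nonneg) auto
  have "\<exists>M. \<forall>n\<ge>M. ?S n < e" if epos: "e > 0" for e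
  proof -
    define e' where "e' = e / (2 * (C + 1))"
    have e': "e' > 0" using epos C0 by (simp add: e'_def)
    have "uniformly_continuous_on {r..u1} x"
      using r u1 by (intro compact_uniformly_continuous cont_x') auto
    then obtain \<delta> where \<delta>: "\<delta> > 0" "\<And>s t. s \<in> {r..u1} \<Longrightarrow> t \<in> {r..u1} \<Longrightarrow> dist t s < \<delta> \<Longrightarrow> dist (x t) (x s) < e'"
      unfolding uniformly_continuous_on_def using e' by metis
    obtain M where M: "\<And>n. n \<ge> M \<Longrightarrow> 0 < n \<and> r / real n < \<delta>" using mesh_fine[of r \<delta>] r \<delta> by auto
    have "?S n < e" if n: "n \<ge> M" for n
    proof -
      have n0: "0 < n" and rn: "r / real n < \<delta>" using M[OF n] by auto
      \<comment> \<open>Truncation at \<open>u1\<close> gives the integral a meaning for every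
        \<open>k\<close>, so the sum telescopes over all cells, selected or not.\<close>
      let ?I = "\<lambda>k. integral {r..min (mesh r r n k) u1} (\<lambda>u. \<bar>f u\<bar>)"
      have mT: "ereal (min v u1) < T" for v by (rule lt_T[OF _ u1(2)]) simp
      have mono: "?I k \<le> ?I (Suc k)" for k
        using r mesh_mono[of r k "Suc k" r n] by (intro integral_subset_le hk_abs mT) auto
      have "?S n \<le> (\<Sum>k<n. 2 * e' * (?I (Suc k) - ?I k))"
      proof (rule sum_mono)
        fix k assume "k \<in> {..<n}"
        show "of_bool (N n k) * ?e n k \<le> 2 * e' * (?I (Suc k) - ?I k)"
        proof (cases "N n k")
          case True
          have le: "mesh r r n (Suc k) \<le> u1" using u1(3)[OF True] \<open>k \<in> _\<close> by auto
          have m: "r \<le> mesh r r n k" "mesh r r n k \<le> mesh r r n (Suc k)" using mesh_ge[of r r n k] mesh_mono[of r k "Suc k" r n] r by simp_all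
          have T': "ereal (mesh r r n (Suc k)) < T" using lt_T[OF le u1(2)] .
          have "?e n k
            \<le> 2 * e' * integral {mesh r r n k..mesh r r n (Suc k)} (\<lambda>u. \<bar>f u\<bar>)"
          proof (rule cell_energy)
            fix u assume u: "u \<in> {mesh r r n k..mesh r r n (Suc k)}"
            have "dist (mesh r r n k) u < \<delta>" "dist (mesh r r n (Suc k)) u < \<delta>"
              using u mesh_step[of r r n k] rn by (auto simp: dist_real_def)
            then have "dist (x (mesh r r n k)) (x u) < e'" "dist (x (mesh r r n (Suc k))) (x u) < e'"
              using u le m by (auto intro!: \<delta>(2))
            then show "\<bar>x (mesh r r n k) - x u\<bar> \<le> e' \<and> \<bar>x (mesh r r n (Suc k)) - x u\<bar> \<le> e'"
              by (simp add: dist_real_def)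
          qed (use m r T' e' in auto)
          also have "integral {mesh r r n k..mesh r r n (Suc k)} (\<lambda>u. \<bar>f u\<bar>) = ?I (Suc k) - ?I k"
            using abs_integral_diff[OF r m T'] le m by (simp add: min_absorb1)
          finally show ?thesis using True by simp
        next
          case False
          then show ?thesis using mono[of k] e' by simp
        qed
      qed
      also have "\<dots> = 2 * e' * (?I n - ?I 0)"
        unfolding sum_distrib_left[symmetric] by (subst sum_lessThan_telescope) simp
      also have "\<dots> \<le> 2 * e' * C"
      proof (rule mult_left_mono)
        have "?I n \<le> C" unfolding C_def
          using r u1(2) by (intro integral_subset_le hk_abs mT) auto
        moreover have "?I 0 = 0" using u1 by (simp add: min_absorb1)
        ultimately show "?I n - ?I 0 \<le> C" by simp
      qed (use e' in simp)
      also have "\<dots> < e" using C0 epos by (simp add: e'_def field_simps)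
      finally show ?thesis .
    qed
    then show ?thesis by (intro exI[of _ M] allI impI)
  qed
  then have "\<forall>\<^sub>F n in sequentially. ?S n < e" if "e > 0" for e
    using that unfolding eventually_sequentially by simp
  then show ?thesis
  proof (intro order_tendstoI)
    fix e :: real assume "e < 0"
    then show "\<forall>\<^sub>F n in sequentially. e < ?S n"
      by (intro always_eventually allI less_le_trans[OF _ S0])
  qed
qed

end

section \<open>The stochastic solution: adapted versions and the probability of confinement\<close>

locale sde_sol = brownian M B for M :: "'a measure" and B +
  fixes \<rho> \<alpha> \<beta> x0 :: real and X :: "real \<Rightarrow> 'a \<Rightarrow> real" and \<tau> :: "'a \<Rightarrow> ereal"
  assumes rho: "\<rho> > 0" and sol: "sde_solution M B \<rho> \<alpha> \<beta> x0 X \<tau>"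
begin

lemma AE_path: "AE \<omega> in M. sde_path \<rho> \<alpha> \<beta> (\<lambda>t. B t \<omega>) (\<lambda>t. X t \<omega>) (\<tau> \<omega>) \<and> X 1 \<omega> = x0"
proof -
  have gt: "\<And>\<omega>. \<omega> \<in> space M \<Longrightarrow> 1 < \<tau> \<omega>" and
    ae: "AE \<omega> in M.
        continuous_on {t. 1 \<le> t \<and> ereal t < \<tau> \<omega>} (\<lambda>t. X t \<omega>) \<and>
        X 1 \<omega> = x0 \<and>
        (\<forall>t. 1 \<le> t \<and> ereal t < \<tau> \<omega> \<longrightarrow>
           set_integrable lborel {1..t} (\<lambda>s. drift \<rho> \<alpha> \<beta> s (X s \<omega>)) \<and>
           X t \<omega> = x0 + (B t \<omega> - B 1 \<omega>) + (LBINT s:{1..t}. drift \<rho> \<alpha> \<beta> s (X s \<omega>))) \<and>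
        (\<tau> \<omega> = \<infinity> \<or> (\<forall>n::real. \<exists>t. 1 \<le> t \<and> ereal t < \<tau> \<omega> \<and> n \<le> \<bar>X t \<omega>\<bar>))"
    using sol unfolding sde_solution_def by blast+
  from ae show ?thesis
  proof (rule AE_mp, intro AE_I2 impI, elim conjE, intro conjI)
    fix \<omega> assume w: "\<omega> \<in> space M" and c: "continuous_on {t. 1 \<le> t \<and> ereal t < \<tau> \<omega>} (\<lambda>t. X t \<omega>)"
      and x0: "X 1 \<omega> = x0"
      and eq: "\<forall>t. 1 \<le> t \<and> ereal t < \<tau> \<omega> \<longrightarrow>
           set_integrable lborel {1..t} (\<lambda>s. drift \<rho> \<alpha> \<beta> s (X s \<omega>)) \<and>
           X t \<omega> = x0 + (B t \<omega> - B 1 \<omega>) + (LBINT s:{1..t}. drift \<rho> \<alpha> \<beta> s (X s \<omega>))"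
      and ex: "\<tau> \<omega> = \<infinity> \<or> (\<forall>n::real. \<exists>t. 1 \<le> t \<and> ereal t < \<tau> \<omega> \<and> n \<le> \<bar>X t \<omega>\<bar>)"
    have "continuous_on {1..} (\<lambda>t. B t \<omega>)"
      using cont_B[OF w] by (rule continuous_on_subset) auto
    then show "sde_path \<rho> \<alpha> \<beta> (\<lambda>t. B t \<omega>) (\<lambda>t. X t \<omega>) (\<tau> \<omega>)"
      by unfold_locales (use rho gt[OF w] c x0 eq ex in auto)
  qed
qed

text \<open>The exceptional null set depends on \<open>t\<close>. The versions \<open>g\<close> and
  \<open>A\<close> can therefore replace \<open>X\<close> and the survival event simultaneously only
  at countably many times, such as all points of all meshes.\<close>

lemma adapted:
  obtains g A where "\<And>t. 1 \<le> t \<Longrightarrow> g t \<in> borel_measurable (Ft t)" "\<And>t. 1 \<le> t \<Longrightarrow> A t \<in> sets (Ft t)"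
    "\<And>t. 1 \<le> t \<Longrightarrow> AE \<omega> in M. (ereal t < \<tau> \<omega> \<longleftrightarrow> \<omega> \<in> A t) \<and> (ereal t < \<tau> \<omega> \<longrightarrow> X t \<omega> = g t \<omega>)"
proof -
  have "\<forall>t\<in>{1..}. \<exists>g A. g\<in>borel_measurable (Ft t) \<and> A\<in>sets (Ft t) \<and>
        (AE \<omega> in M. (ereal t < \<tau> \<omega> \<longleftrightarrow> \<omega> \<in> A) \<and> (ereal t < \<tau> \<omega> \<longrightarrow> X t \<omega> = g \<omega>))"
  proof
    fix t :: real assume "t \<in> {1..}"
    then have "\<exists>g\<in>borel_measurable (Ft t). \<exists>A\<in>sets (Ft t).
        AE \<omega> in M. (ereal t < \<tau> \<omega> \<longleftrightarrow> \<omega> \<in> A) \<and> (ereal t < \<tau> \<omega> \<longrightarrow> X t \<omega> = g \<omega>)"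
      using sol unfolding sde_solution_def by blast
    then show "\<exists>g A. g\<in>borel_measurable (Ft t) \<and> A\<in>sets (Ft t) \<and>
        (AE \<omega> in M. (ereal t < \<tau> \<omega> \<longleftrightarrow> \<omega> \<in> A) \<and> (ereal t < \<tau> \<omega> \<longrightarrow> X t \<omega> = g \<omega>))"
      unfolding Bex_def by blast
  qed
  from bchoice[OF this] obtain g where "\<forall>t\<in>{1..}. \<exists>A. g t\<in>borel_measurable (Ft t) \<and> A\<in>sets (Ft t) \<and>
        (AE \<omega> in M. (ereal t < \<tau> \<omega> \<longleftrightarrow> \<omega> \<in> A) \<and> (ereal t < \<tau> \<omega> \<longrightarrow> X t \<omega> = g t \<omega>))" ..
  from bchoice[OF this] obtain A where "\<forall>t\<in>{1..}. g t\<in>borel_measurable (Ft t) \<and> A t\<in>sets (Ft t) \<and>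
        (AE \<omega> in M. (ereal t < \<tau> \<omega> \<longleftrightarrow> \<omega> \<in> A t) \<and> (ereal t < \<tau> \<omega> \<longrightarrow> X t \<omega> = g t \<omega>))" ..
  then show thesis by (intro that[of g A]) auto
qed

end

text \<open>Lets the fourth moments of the increments control the largest increment.\<close>

lemma power4_split:
  fixes m e :: real
  assumes "0 \<le> m" "0 < e"
  shows "m \<le> e + m ^ 4 / e ^ 3" "m\<^sup>2 \<le> e\<^sup>2 + m ^ 4 / e\<^sup>2"
proof -
  show "m \<le> e + m ^ 4 / e ^ 3"
  proof (cases "m \<le> e")
    case True then show ?thesis using assms by (simp add: add_increasing2)
  next
    case False
    then have "m * e ^ 3 \<le> m * m ^ 3" using assms by (intro mult_left_mono power_mono) auto
    then have "m \<le> m ^ 4 / e ^ 3" using assms by (simp add: pos_le_divide_eq power_numeral_reduce)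
    then show ?thesis using assms by linarith
  qed
  show "m\<^sup>2 \<le> e\<^sup>2 + m ^ 4 / e\<^sup>2"
  proof (cases "m \<le> e")
    case True then have "m\<^sup>2 \<le> e\<^sup>2" using assms by (intro power_mono) auto
    then show ?thesis by (simp add: add_increasing2)
  next
    case False
    then have "m\<^sup>2 * e\<^sup>2 \<le> m\<^sup>2 * m\<^sup>2" using assms by (intro mult_left_mono power_mono) auto
    then have "m\<^sup>2 \<le> m ^ 4 / e\<^sup>2" using assms by (simp add: pos_le_divide_eq power_numeral_reduce)
    then show ?thesis using zero_le_power2[of e] by linarith
  qed
qed

context sde_sol
begin

text \<open>The event that \<open>X\<close> is confined need not be measurable, hence the covering event \<open>H\<close>. Taking \<open>a\<close> to be a small
  multiple of \<open>sqrt r\<close> makes its probability small, whatever the drift.\<close>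

lemma confinement_prob:
  assumes r: "1 \<le> r" and a: "0 \<le> a"
  shows "\<exists>H\<in>events. r * prob H \<le> a\<^sup>2 \<and>
    (AE \<omega> in M. (\<forall>u\<in>{r..2*r}. ereal u < \<tau> \<omega> \<and> \<bar>X u \<omega>\<bar> \<le> a) \<longrightarrow> \<omega> \<in> H)"
proof -
  obtain g A where g: "\<And>t. 1 \<le> t \<Longrightarrow> g t \<in> borel_measurable (Ft t)"
    and A: "\<And>t. 1 \<le> t \<Longrightarrow> A t \<in> sets (Ft t)"
    and gA: "\<And>t. 1 \<le> t \<Longrightarrow> AE \<omega> in M. (ereal t < \<tau> \<omega> \<longleftrightarrow> \<omega> \<in> A t) \<and> (ereal t < \<tau> \<omega> \<longrightarrow> X t \<omega> = g t \<omega>)"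
    using adapted by blast
  have r0: "0 \<le> r" "0 < r" using r by auto
  define tt where "tt = mesh r r"
  have tt1: "1 \<le> tt n k" for n k unfolding tt_def using mesh_ge[OF r0(1), of r n k] r by simp
  have tt0: "0 \<le> tt n k" for n k using tt1[of n k] by simp
  have ttm: "tt n j \<le> tt n k" if "j \<le> k" for n j k unfolding tt_def using mesh_mono[OF r0(1) that] .
  define y where "y n k \<omega> = g (tt n k) \<omega>" for n k \<omega>
  define db where "db n k \<omega> = B (tt n (Suc k)) \<omega> - B (tt n k) \<omega>" for n k \<omega>
  define d where "d n k \<omega> = y n (Suc k) \<omega> - y n k \<omega> - db n k \<omega>" for n k \<omega>
  \<comment> \<open>Confinement as seen up to the \<open>k\<close>-th mesh point, written with
    adapted versions only. The bound \<open>L\<close> on the variation of the discretised drift is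
    the adapted substitute for a bound on the integral of the modulus of the drift.\<close>
  define J where "J L n k = {\<omega>\<in>space M. (\<forall>j\<in>{..k}. \<omega> \<in> A (tt n j) \<and> \<bar>y n j \<omega>\<bar> \<le> a) \<and> (\<Sum>j<k. \<bar>d n j \<omega>\<bar>) \<le> L}" for L n k
  have yF: "y n j \<in> borel_measurable (Ft (tt n k))" if "j \<le> k" for n j k
    unfolding y_def using g[OF tt1] ttm[OF that] by (rule measurable_Ft_mono)
  have dF: "d n j \<in> borel_measurable (Ft (tt n k))" if "j < k" for n j k
    unfolding d_def db_def using that ttm
    by (intro borel_measurable_diff yF B_Ft tt0) auto
  have JF: "J L n k \<in> sets (Ft (tt n k))" for L n k
  proof -
    have c1: "{\<omega>\<in>space (Ft (tt n k)). \<omega> \<in> A (tt n j) \<and> \<bar>y n j \<omega>\<bar> \<le> a} \<in> sets (Ft (tt n k))" if "j \<in> {..k}" for j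
    proof -
      have "A (tt n j) \<in> sets (Ft (tt n k))" using A[OF tt1] Ft_mono[OF ttm] that by blast
      moreover have "{\<omega>\<in>space (Ft (tt n k)). \<bar>y n j \<omega>\<bar> \<le> a} \<in> sets (Ft (tt n k))"
        using yF[of j k n] that by (intro borel_measurable_le borel_measurable_abs borel_measurable_const) auto
      moreover have "{\<omega>\<in>space (Ft (tt n k)). \<omega> \<in> A (tt n j) \<and> \<bar>y n j \<omega>\<bar> \<le> a} =
        A (tt n j) \<inter> {\<omega>\<in>space (Ft (tt n k)). \<bar>y n j \<omega>\<bar> \<le> a}"
        using sets.sets_into_space[OF calculation(1)] by auto
      ultimately show ?thesis by simp
    qed
    have c2: "{\<omega>\<in>space (Ft (tt n k)). (\<Sum>j<k. \<bar>d n j \<omega>\<bar>) \<le> L} \<in> sets (Ft (tt n k))"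
      by (intro borel_measurable_le borel_measurable_sum borel_measurable_abs borel_measurable_const dF) auto
    have "{\<omega>\<in>space (Ft (tt n k)). (\<forall>j\<in>{..k}. \<omega> \<in> A (tt n j) \<and> \<bar>y n j \<omega>\<bar> \<le> a) \<and> (\<Sum>j<k. \<bar>d n j \<omega>\<bar>) \<le> L} \<in> sets (Ft (tt n k))"
      by (rule sets.sets_Collect_conj[OF c2 sets.sets_Collect_finite_All'[OF c1]]) auto
    then show ?thesis by (simp add: J_def)
  qed
  have JM: "J L n k \<in> events" for L n k using JF Ft_events by blast
  have anti: "\<omega> \<in> J L n k" if "\<omega> \<in> J L n (Suc k)" for \<omega> L n k
    using that by (auto simp: J_def)
  have anti': "J L n k \<subseteq> J L n j" if "j \<le> k" for L n j k
    using that by (induction rule: dec_induct) (use anti in blast)+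
  define S where "S L n \<omega> = (\<Sum>k<n. indicator (J L n k) \<omega> * (2 * y n k \<omega> * db n k \<omega> + (db n k \<omega>)\<^sup>2))" for L n \<omega>
  define E where "E L n \<omega> = (\<Sum>k<n. of_bool (\<omega> \<in> J L n (Suc k)) * max 0 (- (y n k \<omega> + y n (Suc k) \<omega>) * d n k \<omega>))" for L n \<omega>
  \<comment> \<open>\<open>Q\<close> dominates the fourth power of every increment, so its fourth
    root serves as the bound \<open>m\<close> of \<open>discrete_energy\<close>. Its mean
    \<open>3 * r\<^sup>2 / real n\<close> vanishes as the mesh is refined.\<close>
  define Q where "Q n \<omega> = (\<Sum>k<n. (db n k \<omega>) ^ 4)" for n \<omega>
  have step: "tt n k < tt n (Suc k)" "tt n (Suc k) - tt n k = r / real n" if "0 < n" for n k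
    unfolding tt_def using mesh_less[OF r0(2) that] mesh_step by auto
  have S_int: "integrable M (S L n)" "r * prob (J L n n) \<le> (\<integral>\<omega>. S L n \<omega> \<partial>M)" if n: "0 < n" for L n
  proof -
    have bd: "\<bar>y n k \<omega>\<bar> \<le> a" if "\<omega> \<in> J L n k" for k \<omega> using that by (auto simp: J_def)
    have *: "integrable M (\<lambda>\<omega>. indicator (J L n k) \<omega> * (2 * y n k \<omega> * db n k \<omega> + (db n k \<omega>)\<^sup>2))"
      "(\<integral>\<omega>. indicator (J L n k) \<omega> * (2 * y n k \<omega> * db n k \<omega> + (db n k \<omega>)\<^sup>2) \<partial>M) = r / real n * prob (J L n k)" for k
      using increment_energy[OF tt0[of n k] step(1)[OF n, of k] JF[of L n k] yF[OF order_refl] bd] step(2)[OF n, of k]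
      unfolding db_def by auto
    show "integrable M (S L n)" unfolding S_def using *(1) by (intro Bochner_Integration.integrable_sum)
    have "(\<integral>\<omega>. S L n \<omega> \<partial>M) = (\<Sum>k<n. r / real n * prob (J L n k))"
      unfolding S_def using * by (subst Bochner_Integration.integral_sum) auto
    \<comment> \<open>The events \<open>J L n k\<close> decrease in \<open>k\<close>, so paths
      confined to the end contribute the full variance \<open>r\<close>: this is the lower bound
      that competes with \<open>a\<^sup>2\<close>.\<close>
    also have "\<dots> \<ge> (\<Sum>k<n. r / real n * prob (J L n n))"
      using anti' JM r0 by (intro sum_mono mult_left_mono finite_measure_mono) auto
    finally show "r * prob (J L n n) \<le> (\<integral>\<omega>. S L n \<omega> \<partial>M)" using n by simp
  qed
  have Q_int: "integrable M (Q n)" "(\<integral>\<omega>. Q n \<omega> \<partial>M) = 3 * r\<^sup>2 / real n" if n: "0 < n" for n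
  proof -
    have *: "integrable M (\<lambda>\<omega>. (db n k \<omega>) ^ 4)" "(\<integral>\<omega>. (db n k \<omega>) ^ 4 \<partial>M) = 3 * (r / real n)\<^sup>2" for k
      using B_moments(1)[OF tt0 step(1)[OF n], of k 4] B_moments(2)[OF tt0 step(1)[OF n], of k] step(2)[OF n, of k]
      unfolding db_def by auto
    show "integrable M (Q n)" unfolding Q_def using *(1) by (intro Bochner_Integration.integrable_sum)
    show "(\<integral>\<omega>. Q n \<omega> \<partial>M) = 3 * r\<^sup>2 / real n"
      unfolding Q_def using * n by (subst Bochner_Integration.integral_sum) (auto simp: power2_eq_square)
  qed
  have Eb: "0 \<le> E L n \<omega>" "E L n \<omega> \<le> 2 * a * L" if L: "0 \<le> L" for L n \<omega>
  proof -
    show "0 \<le> E L n \<omega>" unfolding E_def by (intro sum_nonneg) auto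
    show "E L n \<omega> \<le> 2 * a * L" unfolding E_def
      by (rule discrete_energy_bounded) (use anti a L in \<open>auto simp: J_def\<close>)
  qed
  have Em: "E L n \<in> borel_measurable M" for L n
  proof -
    have [measurable]: "y n k \<in> borel_measurable M" "d n k \<in> borel_measurable M" "J L n k \<in> events" for k
      using measurable_Ft_M yF dF JM by blast+
    show ?thesis unfolding E_def by measurable
  qed
  have E_int: "integrable M (E L n)" if L: "0 \<le> L" for L n
    by (rule integrable_const_bound[of _ "2 * a * L"]) (use Eb[OF L] Em in auto)
  have bound: "S L n \<omega> \<le> a\<^sup>2 + E L n \<omega> + (L + 2 * a) * (e + Q n \<omega> / e ^ 3) + (e\<^sup>2 + Q n \<omega> / e\<^sup>2)"
    if L: "0 \<le> L" and e: "0 < e" for L n \<omega> e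
  proof -
    define m where "m = root 4 (Q n \<omega>)"
    have Q0: "0 \<le> Q n \<omega>" unfolding Q_def by (intro sum_nonneg) auto
    have m0: "0 \<le> m" using Q0 by (simp add: m_def)
    have m4: "m ^ 4 = Q n \<omega>" unfolding m_def using Q0 by (intro real_root_pow_pos2) auto
    have "S L n \<omega> \<le> a\<^sup>2 + E L n \<omega> + L * m + 2 * a * m + m\<^sup>2"
      unfolding S_def E_def d_def indicator_def
    proof (rule discrete_energy[where J = "\<lambda>k. \<omega> \<in> J L n k"])
      fix k assume k: "k < n"
      have "(\<bar>db n k \<omega>\<bar>) ^ 4 \<le> Q n \<omega>" unfolding Q_def using k
        by (subst power_even_abs) (auto intro!: member_le_sum[of k "{..<n}" "\<lambda>k. (db n k \<omega>) ^ 4"])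
      then have "root 4 (\<bar>db n k \<omega>\<bar> ^ 4) \<le> m" unfolding m_def by (intro real_root_le_mono) auto
      moreover have "root 4 (\<bar>db n k \<omega>\<bar> ^ 4) = \<bar>db n k \<omega>\<bar>" by (rule real_root_power_cancel) auto
      ultimately show "\<bar>db n k \<omega>\<bar> \<le> m" by linarith
    qed (use anti a L m0 in \<open>auto simp: J_def d_def\<close>)
    also have "\<dots> = a\<^sup>2 + E L n \<omega> + (L + 2 * a) * m + m\<^sup>2" by (simp add: algebra_simps)
    also have "\<dots> \<le> a\<^sup>2 + E L n \<omega> + (L + 2 * a) * (e + Q n \<omega> / e ^ 3) + (e\<^sup>2 + Q n \<omega> / e\<^sup>2)"
      using power4_split[OF m0 e] L a unfolding m4 by (intro add_mono mult_left_mono) auto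
    finally show ?thesis .
  qed
  define X_eq where "X_eq \<omega> \<longleftrightarrow> (\<forall>n k. (ereal (tt n k) < \<tau> \<omega> \<longleftrightarrow> \<omega> \<in> A (tt n k)) \<and> (ereal (tt n k) < \<tau> \<omega> \<longrightarrow> X (tt n k) \<omega> = y n k \<omega>))" for \<omega>
  have good: "AE \<omega> in M. X_eq \<omega> \<and>
     sde_path \<rho> \<alpha> \<beta> (\<lambda>t. B t \<omega>) (\<lambda>t. X t \<omega>) (\<tau> \<omega>)"
    unfolding X_eq_def AE_conj_iff AE_all_countable y_def using gA[OF tt1] AE_path by auto
  have E_lim: "(\<lambda>n. \<integral>\<omega>. E L n \<omega> \<partial>M) \<longlonglongrightarrow> (\<integral>\<omega>. 0 \<partial>M)" if L: "0 \<le> L" for L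
  proof (rule integral_dominated_convergence[of _ _ _ "\<lambda>_. 2 * a * L"])
    show "AE \<omega> in M. (\<lambda>n. E L n \<omega>) \<longlonglongrightarrow> 0"
      using good
    proof (rule AE_mp, intro AE_I2 impI, elim conjE)
      fix \<omega> assume w: "\<omega> \<in> space M"
        and X: "X_eq \<omega>"
        and path: "sde_path \<rho> \<alpha> \<beta> (\<lambda>t. B t \<omega>) (\<lambda>t. X t \<omega>) (\<tau> \<omega>)"
      have JX: "X (tt n j) \<omega> = y n j \<omega>" "ereal (tt n j) < \<tau> \<omega>" "\<bar>y n j \<omega>\<bar> \<le> a"
        if "\<omega> \<in> J L n k" "j \<le> k" for n j k
        using X that by (auto simp: J_def X_eq_def)
      have "(\<lambda>n. \<Sum>k<n. of_bool (\<omega> \<in> J L n (Suc k)) * max 0 (- (X (mesh r r n k) \<omega> + X (mesh r r n (Suc k)) \<omega>) *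
        (X (mesh r r n (Suc k)) \<omega> - X (mesh r r n k) \<omega> - (B (mesh r r n (Suc k)) \<omega> - B (mesh r r n k) \<omega>)))) \<longlonglongrightarrow> 0"
      proof (rule sde_path.mesh_energy_tendsto_0[OF path r])
        fix n k assume "\<omega> \<in> J L n (Suc k)"
        from JX[OF this order_refl] show "ereal (mesh r r n (Suc k)) < \<tau> \<omega> \<and> \<bar>X (mesh r r n (Suc k)) \<omega>\<bar> \<le> a"
          by (simp add: tt_def)
      qed
      moreover have "of_bool (\<omega> \<in> J L n (Suc k)) * max 0 (- (X (mesh r r n k) \<omega> + X (mesh r r n (Suc k)) \<omega>) *
        (X (mesh r r n (Suc k)) \<omega> - X (mesh r r n k) \<omega> - (B (mesh r r n (Suc k)) \<omega> - B (mesh r r n k) \<omega>)))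
        = of_bool (\<omega> \<in> J L n (Suc k)) * max 0 (- (y n k \<omega> + y n (Suc k) \<omega>) * d n k \<omega>)" for n k
        using JX(1)[of n "Suc k" k] JX(1)[of n "Suc k" "Suc k"]
        by (cases "\<omega> \<in> J L n (Suc k)") (simp_all add: tt_def d_def db_def)
      ultimately show "(\<lambda>n. E L n \<omega>) \<longlonglongrightarrow> 0" unfolding E_def by simp
    qed
    show "AE \<omega> in M. norm (E L n \<omega>) \<le> 2 * a * L" for n
      using Eb[OF L] by auto
  qed (use Em in auto)
  define HL where "HL L = (\<Inter>n\<in>{1..}. J L n n)" for L :: real
  have HLM: "HL L \<in> events" for L unfolding HL_def using JM by (intro sets.countable_INT') auto
  have PL: "r * prob (HL L) \<le> a\<^sup>2" if L: "0 \<le> L" for L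
  proof -
    define U where "U n e = a\<^sup>2 + (\<integral>\<omega>. E L n \<omega> \<partial>M) + (L + 2 * a) * (e + (3 * r\<^sup>2 / real n) / e ^ 3) + (e\<^sup>2 + (3 * r\<^sup>2 / real n) / e\<^sup>2)" for n e
    \<comment> \<open>The mesh is refined with \<open>e\<close> fixed, which removes the terms with
      \<open>Q\<close> and \<open>E\<close>; only afterwards \<open>e\<close> tends to 0.\<close>
    have le: "r * prob (HL L) \<le> a\<^sup>2 + (L + 2 * a) * e + e\<^sup>2" if e: "0 < e" for e
    proof (rule LIMSEQ_le_const)
      have "(\<lambda>n. U n e) \<longlonglongrightarrow> a\<^sup>2 + (\<integral>\<omega>. 0 \<partial>M) + (L + 2 * a) * (e + 0 / e ^ 3) + (e\<^sup>2 + 0 / e\<^sup>2)"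
        unfolding U_def using e by (intro tendsto_intros E_lim L lim_const_over_n) auto
      then show "(\<lambda>n. U n e)
        \<longlonglongrightarrow> a\<^sup>2 + (L + 2 * a) * e + e\<^sup>2" by simp
      show "\<exists>N. \<forall>n\<ge>N. r * prob (HL L) \<le> U n e"
      proof (intro exI[of _ 1] allI impI)
        fix n :: nat assume "1 \<le> n"
        then have n: "0 < n" by simp
        have "prob (HL L) \<le> prob (J L n n)"
          using JM \<open>1 \<le> n\<close> by (intro finite_measure_mono) (auto simp: HL_def)
        then have "r * prob (HL L) \<le> r * prob (J L n n)" using r0 by (intro mult_left_mono) auto
        also have "\<dots> \<le> (\<integral>\<omega>. S L n \<omega> \<partial>M)" by (rule S_int(2)[OF n])
        also have "\<dots> \<le> (\<integral>\<omega>. a\<^sup>2 + E L n \<omega> + (L + 2 * a) * (e + Q n \<omega> / e ^ 3) + (e\<^sup>2 + Q n \<omega> / e\<^sup>2) \<partial>M)"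
          using S_int(1)[OF n] E_int[OF L] Q_int(1)[OF n] bound[OF L e] by (intro integral_mono) auto
        also have "\<dots> = U n e"
          unfolding U_def using E_int[OF L] Q_int[OF n] by (simp add: prob_space)
        finally show "r * prob (HL L) \<le> U n e" .
      qed
    qed
    have "((\<lambda>e. a\<^sup>2 + (L + 2 * a) * e + e\<^sup>2) \<longlongrightarrow> a\<^sup>2 + (L + 2 * a) * 0 + 0\<^sup>2) (at_right 0)"
      by (intro tendsto_intros)
    moreover have "\<forall>\<^sub>F e in at_right 0. r * prob (HL L) \<le> a\<^sup>2 + (L + 2 * a) * e + e\<^sup>2"
      using eventually_at_right_less[of "0::real"] by eventually_elim (rule le)
    ultimately show ?thesis by (intro tendsto_lowerbound[of "\<lambda>e. a\<^sup>2 + (L + 2 * a) * e + e\<^sup>2" _ "at_right 0"]) auto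
  qed
  \<comment> \<open>The integral of the modulus of the drift is finite on each confined path but not
    uniformly bounded, hence the union over \<open>L\<close>. The bound \<open>a\<^sup>2\<close> is
    free of \<open>L\<close> and survives this increasing limit.\<close>
  define H where "H = (\<Union>L::nat. HL (real L))"
  have "incseq (\<lambda>L::nat. HL (real L))"
    unfolding incseq_Suc_iff HL_def J_def by (auto intro: order_trans)
  then have "(\<lambda>L. prob (HL (real L))) \<longlonglongrightarrow> prob H"
    unfolding H_def using HLM by (intro finite_Lim_measure_incseq) auto
  then have "(\<lambda>L. r * prob (HL (real L))) \<longlonglongrightarrow> r * prob H" by (intro tendsto_intros)
  then have PH: "r * prob H \<le> a\<^sup>2" using PL by (intro LIMSEQ_le_const2) auto
  have "AE \<omega> in M. (\<forall>u\<in>{r..2*r}. ereal u < \<tau> \<omega> \<and> \<bar>X u \<omega>\<bar> \<le> a) \<longrightarrow> \<omega> \<in> H"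
    using good
  proof (rule AE_mp, intro AE_I2 impI, elim conjE)
    fix \<omega> assume w: "\<omega> \<in> space M"
      and X: "X_eq \<omega>"
      and path: "sde_path \<rho> \<alpha> \<beta> (\<lambda>t. B t \<omega>) (\<lambda>t. X t \<omega>) (\<tau> \<omega>)"
      and conf: "\<forall>u\<in>{r..2*r}. ereal u < \<tau> \<omega> \<and> \<bar>X u \<omega>\<bar> \<le> a"
    interpret sde_path \<rho> \<alpha> \<beta> "\<lambda>t. B t \<omega>" "\<lambda>t. X t \<omega>" "\<tau> \<omega>" by (rule path)
    define V where "V = integral {r..2*r} (\<lambda>u. \<bar>drift \<rho> \<alpha> \<beta> u (X u \<omega>)\<bar>)"
    obtain L :: nat where L: "V \<le> real L" using real_arch_simple by blast
    have "\<omega> \<in> J (real L) n n" if n: "1 \<le> n" for n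
    proof -
      have mem: "tt n j \<in> {r..2*r}" if "j \<le> n" for j
        unfolding tt_def using mesh_ge[OF r0(1), of r n j] mesh_le[OF r0(1), of n j r] n that by auto
      have yX: "X (tt n j) \<omega> = y n j \<omega>" "\<omega> \<in> A (tt n j)" "\<bar>y n j \<omega>\<bar> \<le> a" if "j \<le> n" for j
      proof -
        have alive: "ereal (tt n j) < \<tau> \<omega>" and le: "\<bar>X (tt n j) \<omega>\<bar> \<le> a" using conf mem[OF that] by auto
        show eq: "X (tt n j) \<omega> = y n j \<omega>" using X alive unfolding X_eq_def by blast
        show "\<omega> \<in> A (tt n j)" using X alive unfolding X_eq_def by blast
        show "\<bar>y n j \<omega>\<bar> \<le> a" using le unfolding eq .
      qed
      have "(\<Sum>j<n. \<bar>d n j \<omega>\<bar>) = (\<Sum>k<n. \<bar>X (mesh r r n (Suc k)) \<omega> - X (mesh r r n k) \<omega> - (B (mesh r r n (Suc k)) \<omega> - B (mesh r r n k) \<omega>)\<bar>)"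
        using yX(1) by (intro sum.cong) (auto simp: d_def db_def tt_def)
      also have "\<dots> \<le> V" unfolding V_def using conf n r by (intro mesh_variation) auto
      finally show ?thesis using w yX L by (auto simp: J_def)
    qed
    then show "\<omega> \<in> H" unfolding H_def HL_def by auto
  qed
  moreover have "H \<in> events" unfolding H_def using HLM by auto
  ultimately show ?thesis using PH by blast
qed

text \<open>A path that is eventually below \<open>c * sqrt t\<close> is confined on all late
  windows, and already one window has probability at most \<open>2 * c\<^sup>2\<close>. Failing for
  every \<open>c\<close> in a sequence tending to 0 is therefore a null event; the \<open>c\<close>
  obtained depends on the path.\<close>

lemma AE_frequently_large:
  "AE \<omega> in M. \<tau> \<omega> = \<infinity> \<longrightarrow> (\<exists>c>0. \<forall>R. \<exists>t\<ge>R. c * sqrt t \<le> \<bar>X t \<omega>\<bar>)"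
proof -
  define c where "c m = 1 / real (Suc m)" for m
  \<comment> \<open>On \<open>{r..2*r}\<close> the moving threshold \<open>c * sqrt u\<close> is at
    most \<open>c * sqrt (2 * r)\<close>, whose square divided by \<open>r\<close> is the bound
    \<open>2 * c\<^sup>2\<close>.\<close>
  define P where "P m r \<omega> \<longleftrightarrow> (\<forall>u\<in>{real r..2*real r}. ereal u < \<tau> \<omega> \<and> \<bar>X u \<omega>\<bar> \<le> c m * sqrt (2 * real r))" for m r \<omega>
  have "\<forall>m. \<forall>r\<in>{1..}. \<exists>H\<in>events. prob H \<le> 2 * (c m)\<^sup>2 \<and> (AE \<omega> in M. P m r \<omega> \<longrightarrow> \<omega> \<in> H)"
  proof (intro allI ballI)
    fix m r :: nat assume r: "r \<in> {1..}"
    obtain H where H: "H \<in> events" "real r * prob H \<le> (c m * sqrt (2 * real r))\<^sup>2" "AE \<omega> in M. P m r \<omega> \<longrightarrow> \<omega> \<in> H"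
      using confinement_prob[of "real r" "c m * sqrt (2 * real r)"] r by (auto simp: P_def c_def)
    have "real r * prob H \<le> real r * (2 * (c m)\<^sup>2)" using H(2) r by (simp add: power_mult_distrib mult_ac)
    then have "prob H \<le> 2 * (c m)\<^sup>2" using r by simp
    then show "\<exists>H\<in>events. prob H \<le> 2 * (c m)\<^sup>2 \<and> (AE \<omega> in M. P m r \<omega> \<longrightarrow> \<omega> \<in> H)" using H by blast
  qed
  then have "\<forall>m. \<exists>H. \<forall>r\<in>{1..}. H r \<in> events \<and> prob (H r) \<le> 2 * (c m)\<^sup>2 \<and> (AE \<omega> in M. P m r \<omega> \<longrightarrow> \<omega> \<in> H r)"
    unfolding Bex_def by (intro allI bchoice) blast
  from choice[OF this] obtain H where "\<forall>m. \<forall>r\<in>{1..}. H m r \<in> events \<and> prob (H m r) \<le> 2 * (c m)\<^sup>2 \<and>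
      (AE \<omega> in M. P m r \<omega> \<longrightarrow> \<omega> \<in> H m r)" ..
  then have H: "\<And>m r. 1 \<le> r \<Longrightarrow> H m r \<in> events" "\<And>m r. 1 \<le> r \<Longrightarrow> prob (H m r) \<le> 2 * (c m)\<^sup>2"
    "\<And>m r. 1 \<le> r \<Longrightarrow> AE \<omega> in M. P m r \<omega> \<longrightarrow> \<omega> \<in> H m r"
    by auto
  \<comment> \<open>Confinement on all windows after \<open>R\<close>; starting at
    \<open>Suc R\<close> respects the requirement \<open>1 \<le> r\<close> of
    \<open>confinement_prob\<close>. The sets increase with \<open>R\<close>, so the union over
    \<open>R\<close> keeps the bound for a single window.\<close>
  define G where "G m R = (\<Inter>r\<in>{Suc R..}. H m r)" for m R
  define N where "N = (\<Inter>m. \<Union>R. G m R)"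
  have GM: "G m R \<in> events" for m R unfolding G_def using H(1) by (intro sets.countable_INT') auto
  have NM: "N \<in> events" unfolding N_def using GM by auto
  have PN: "prob N \<le> 2 * (c m)\<^sup>2" for m
  proof -
    have inc: "incseq (G m)" unfolding incseq_Suc_iff G_def by auto
    have "(\<lambda>R. prob (G m R)) \<longlonglongrightarrow> prob (\<Union>R. G m R)"
      using GM inc by (intro finite_Lim_measure_incseq) auto
    moreover have "prob (G m R) \<le> 2 * (c m)\<^sup>2" for R
    proof -
      have "prob (G m R) \<le> prob (H m (Suc R))" using H(1) by (intro finite_measure_mono) (auto simp: G_def)
      then show ?thesis using H(2)[of "Suc R" m] by simp
    qed
    ultimately have "prob (\<Union>R. G m R) \<le> 2 * (c m)\<^sup>2" by (intro LIMSEQ_le_const2) auto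
    moreover have "prob N \<le> prob (\<Union>R. G m R)" using GM by (intro finite_measure_mono) (auto simp: N_def)
    ultimately show ?thesis by linarith
  qed
  have "(\<lambda>m. 2 * (c m)\<^sup>2) \<longlonglongrightarrow> 2 * 0\<^sup>2"
    unfolding c_def by (intro tendsto_intros LIMSEQ_Suc[OF lim_1_over_n])
  then have "prob N \<le> 2 * 0\<^sup>2" by (rule LIMSEQ_le_const) (use PN in blast)
  then have "prob N = 0" using measure_nonneg[of M N] by simp
  then have "AE \<omega> in M. \<omega> \<notin> N" using NM by (intro AE_not_in) (simp add: null_sets_def emeasure_eq_measure)
  moreover have "AE \<omega> in M. \<forall>m. \<forall>r\<in>{1..}. P m r \<omega> \<longrightarrow> \<omega> \<in> H m r"
    unfolding AE_all_countable using H(3) by (auto simp: AE_ball_countable)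
  ultimately show ?thesis
  proof eventually_elim
    case (elim \<omega>)
    show ?case
    proof (rule impI, rule ccontr)
      assume T: "\<tau> \<omega> = \<infinity>" and nex: "\<not> (\<exists>c>0. \<forall>R. \<exists>t\<ge>R. c * sqrt t \<le> \<bar>X t \<omega>\<bar>)"
      have small: "\<exists>R. \<forall>t\<ge>R. \<bar>X t \<omega>\<bar> < c m * sqrt t" for m
      proof -
        have "c m > 0" by (simp add: c_def)
        with nex obtain R where "\<not> (\<exists>t\<ge>R. c m * sqrt t \<le> \<bar>X t \<omega>\<bar>)" by blast
        then have "\<forall>t\<ge>R. \<bar>X t \<omega>\<bar> < c m * sqrt t" by force
        then show ?thesis ..
      qed
      have "\<omega> \<in> (\<Union>R. G m R)" for m
      proof -
        obtain R where R: "\<And>t. t \<ge> R \<Longrightarrow> \<bar>X t \<omega>\<bar> < c m * sqrt t" using small[of m] by blast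
        obtain R' :: nat where R': "R \<le> real R'" using real_arch_simple by blast
        have "P m r \<omega>" if "r \<ge> Suc R'" for r
          unfolding P_def
        proof (intro ballI conjI)
          fix u assume u: "u \<in> {real r..2 * real r}"
          then have "\<bar>X u \<omega>\<bar> < c m * sqrt u" using R' that by (intro R) auto
          also have "\<dots> \<le> c m * sqrt (2 * real r)" using u by (intro mult_left_mono) (auto simp: c_def)
          finally show "\<bar>X u \<omega>\<bar> \<le> c m * sqrt (2 * real r)" by simp
        qed (simp add: T)
        then have "\<omega> \<in> G m R'" unfolding G_def using elim(2) by auto
        then show ?thesis by blast
      qed
      then show False using elim(1) by (auto simp: N_def)
    qed
  qed
qed

end

section \<open>Wiener integrals and the linear case\<close>

lemma mesh_sum_integral:
  fixes g :: "real \<Rightarrow> real"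
  assumes l: "0 < l" and g: "continuous_on {a..a+l} g" and n: "0 < n"
  shows "(\<Sum>k<n. integral {mesh a l n k..mesh a l n (Suc k)} g) = integral {a..a+l} g"
proof -
  let ?I = "\<lambda>k. integral {a..mesh a l n k} g"
  have "integral {mesh a l n k..mesh a l n (Suc k)} g = ?I (Suc k) - ?I k" if "k < n" for k
  proof -
    have "{a..mesh a l n (Suc k)} \<subseteq> {a..a+l}" using mesh_le[of l n "Suc k" a] l n that by auto
    then have "g integrable_on {a..mesh a l n (Suc k)}"
      by (intro integrable_continuous_interval continuous_on_subset[OF g])
    then show ?thesis
      using Henstock_Kurzweil_Integration.integral_combine[of a "mesh a l n k" "mesh a l n (Suc k)" g]
        mesh_ge[of l a n k] mesh_less[OF l n, of a k] l by simp
  qed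
  then have "(\<Sum>k<n. integral {mesh a l n k..mesh a l n (Suc k)} g) = (\<Sum>k<n. ?I (Suc k) - ?I k)"
    by (intro sum.cong) auto
  also have "\<dots> = ?I n - ?I 0" by (rule sum_lessThan_telescope)
  finally show ?thesis using mesh_top[OF n, of a l] by simp
qed

text \<open>Riemann sums weighted by the exact integral of \<open>p\<close> over each cell, with
  arbitrary tags. It is applied with the derivative of the integrand and right tags for integration
  by parts, and with \<open>p = 1\<close> and left tags for the variance.\<close>

lemma riemann_cells:
  fixes p w :: "real \<Rightarrow> real"
  assumes l: "0 < l" and p: "continuous_on {a..a+l} p" and w: "continuous_on {a..a+l} w"
    and xi: "\<And>n k. k < n \<Longrightarrow> \<xi> n k \<in> {mesh a l n k..mesh a l n (Suc k)}"
  shows "(\<lambda>n. \<Sum>k<n. w (\<xi> n k) * integral {mesh a l n k..mesh a l n (Suc k)} p)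
    \<longlonglongrightarrow> integral {a..a+l} (\<lambda>s. p s * w s)"
proof (rule LIMSEQ_I)
  fix e :: real assume e: "0 < e"
  obtain K where K: "K > 0" "\<And>s. a \<le> s \<Longrightarrow> s \<le> a + l \<Longrightarrow> \<bar>p s\<bar> \<le> K"
    using continuous_bounded_Icc[OF p] by blast
  define e' where "e' = e / (2 * K * l)"
  have e': "e' > 0" using e K l by (simp add: e'_def)
  have "uniformly_continuous_on {a..a+l} w" by (intro compact_uniformly_continuous w) auto
  then obtain \<delta> where \<delta>: "\<delta> > 0" "\<And>s t. s \<in> {a..a+l} \<Longrightarrow> t \<in> {a..a+l} \<Longrightarrow> dist t s < \<delta> \<Longrightarrow> dist (w t) (w s) < e'"
    unfolding uniformly_continuous_on_def using e' by metis
  obtain N where N: "\<And>n. n \<ge> N \<Longrightarrow> 0 < n \<and> l / real n < \<delta>" using mesh_fine[OF l \<delta>(1)] by blast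
  show "\<exists>N. \<forall>n\<ge>N. norm ((\<Sum>k<n. w (\<xi> n k) * integral {mesh a l n k..mesh a l n (Suc k)} p)
      - integral {a..a+l} (\<lambda>s. p s * w s)) < e"
  proof (intro exI[of _ N] allI impI)
    fix n assume "N \<le> n"
    then have n: "0 < n" and fine: "l / real n < \<delta>" using N by auto
    have pw: "continuous_on {a..a+l} (\<lambda>s. p s * w s)" by (intro continuous_intros p w)
    have cell: "\<bar>w (\<xi> n k) * integral {mesh a l n k..mesh a l n (Suc k)} p
       - integral {mesh a l n k..mesh a l n (Suc k)} (\<lambda>s. p s * w s)\<bar> \<le> K * e' * (l / real n)" if k: "k < n" for k
    proof -
      let ?c = "{mesh a l n k..mesh a l n (Suc k)}"
      have lt: "mesh a l n k \<le> mesh a l n (Suc k)" using mesh_less[OF l n, of a k] by simp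
      have sub: "?c \<subseteq> {a..a+l}" using mesh_le[of l n "Suc k" a] mesh_ge[of l a n k] l n k by auto
      have cp: "continuous_on ?c p" "continuous_on ?c w"
        using sub p w by (auto intro: continuous_on_subset)
      have "norm (integral ?c (\<lambda>s. p s * (w (\<xi> n k) - w s))) \<le> K * e' * (mesh a l n (Suc k) - mesh a l n k)"
      proof (rule integral_bound[OF lt])
        show "continuous_on ?c (\<lambda>s. p s * (w (\<xi> n k) - w s))" by (intro continuous_intros cp)
        fix s assume s: "s \<in> ?c"
        have "dist (\<xi> n k) s < \<delta>" using s xi[OF k] mesh_step[of a l n k] fine by (auto simp: dist_real_def)
        then have "dist (w (\<xi> n k)) (w s) < e'" using s xi[OF k] sub by (intro \<delta>(2)) auto
        then have "\<bar>p s\<bar> * \<bar>w (\<xi> n k) - w s\<bar> \<le> K * e'"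
          using K(2)[of s] s sub K(1) by (intro mult_mono) (auto simp: dist_real_def)
        then show "norm (p s * (w (\<xi> n k) - w s)) \<le> K * e'" by (simp add: abs_mult)
      qed
      moreover have "integral ?c (\<lambda>s. p s * (w (\<xi> n k) - w s)) = w (\<xi> n k) * integral ?c p - integral ?c (\<lambda>s. p s * w s)"
      proof -
        have "integral ?c (\<lambda>s. w (\<xi> n k) * p s - p s * w s) = integral ?c (\<lambda>s. w (\<xi> n k) * p s) - integral ?c (\<lambda>s. p s * w s)"
          by (intro Henstock_Kurzweil_Integration.integral_diff integrable_continuous_interval continuous_intros cp)
        then show ?thesis by (simp add: algebra_simps)
      qed
      ultimately show ?thesis by (simp add: mesh_step)
    qed
    have "\<bar>(\<Sum>k<n. w (\<xi> n k) * integral {mesh a l n k..mesh a l n (Suc k)} p) - integral {a..a+l} (\<lambda>s. p s * w s)\<bar>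
      = \<bar>\<Sum>k<n. w (\<xi> n k) * integral {mesh a l n k..mesh a l n (Suc k)} p - integral {mesh a l n k..mesh a l n (Suc k)} (\<lambda>s. p s * w s)\<bar>"
      unfolding mesh_sum_integral[OF l pw n, symmetric] by (simp add: sum_subtractf)
    also have "\<dots> \<le> (\<Sum>k<n. K * e' * (l / real n))"
      by (rule order_trans[OF sum_abs sum_mono]) (use cell in auto)
    also have "\<dots> = K * e' * l" using n by simp
    also have "\<dots> < e" using e K l by (simp add: e'_def)
    finally show "norm ((\<Sum>k<n. w (\<xi> n k) * integral {mesh a l n k..mesh a l n (Suc k)} p)
      - integral {a..a+l} (\<lambda>s. p s * w s)) < e" by simp
  qed
qed

text \<open>Abel summation moves the differences from \<open>b\<close>, which may have infinite
  variation, to the differentiable \<phi>. The limit is an expression that makes sense for each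
  continuous path.\<close>

lemma riemann_stieltjes_by_parts:
  fixes b \<phi> \<phi>' :: "real \<Rightarrow> real"
  assumes l: "0 < l" and b: "continuous_on {a..a+l} b" and \<phi>': "continuous_on {a..a+l} \<phi>'"
    and der: "\<And>s. s \<in> {a..a+l} \<Longrightarrow> (\<phi> has_real_derivative \<phi>' s) (at s)"
  shows "(\<lambda>n. \<Sum>k<n. \<phi> (mesh a l n k) * (b (mesh a l n (Suc k)) - b (mesh a l n k)))
    \<longlonglongrightarrow> \<phi> (a+l) * (b (a+l) - b a) - integral {a..a+l} (\<lambda>s. \<phi>' s * (b s - b a))"
proof -
  let ?I = "\<lambda>n k. integral {mesh a l n k..mesh a l n (Suc k)} \<phi>'"
  have "(\<lambda>n. \<Sum>k<n. (b (mesh a l n (Suc k)) - b a) * ?I n k) \<longlonglongrightarrow> integral {a..a+l} (\<lambda>s. \<phi>' s * (b s - b a))"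
    using l mesh_less[OF l]
    by (intro riemann_cells[where w = "\<lambda>s. b s - b a" and \<xi> = "\<lambda>n k. mesh a l n (Suc k)"] \<phi>' continuous_intros b)
       (auto intro!: less_imp_le)
  then have "(\<lambda>n. \<phi> (a+l) * (b (a+l) - b a) - (\<Sum>k<n. (b (mesh a l n (Suc k)) - b a) * ?I n k))
     \<longlonglongrightarrow> \<phi> (a+l) * (b (a+l) - b a) - integral {a..a+l} (\<lambda>s. \<phi>' s * (b s - b a))"
    by (intro tendsto_intros)
  moreover have "\<forall>\<^sub>F n in sequentially. \<phi> (a+l) * (b (a+l) - b a) - (\<Sum>k<n. (b (mesh a l n (Suc k)) - b a) * ?I n k)
    = (\<Sum>k<n. \<phi> (mesh a l n k) * (b (mesh a l n (Suc k)) - b (mesh a l n k)))"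
    using eventually_gt_at_top[of 0]
  proof eventually_elim
    case (elim n)
    have I: "?I n k = \<phi> (mesh a l n (Suc k)) - \<phi> (mesh a l n k)" if k: "k < n" for k
    proof (rule integral_unique[OF fundamental_theorem_of_calculus])
      show "mesh a l n k \<le> mesh a l n (Suc k)" using mesh_less[OF l elim, of a k] by simp
      fix s assume "s \<in> {mesh a l n k..mesh a l n (Suc k)}"
      then have "s \<in> {a..a+l}" using mesh_le[of l n "Suc k" a] mesh_ge[of l a n k] l elim k by auto
      then show "(\<phi> has_vector_derivative \<phi>' s) (at s within {mesh a l n k..mesh a l n (Suc k)})"
        using der by (auto simp: has_real_derivative_iff_has_vector_derivative[symmetric] intro: has_field_derivative_at_within)
    qed
    let ?v = "\<lambda>k. \<phi> (mesh a l n k) * (b (mesh a l n k) - b a)"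
    have "(\<Sum>k<n. \<phi> (mesh a l n k) * (b (mesh a l n (Suc k)) - b (mesh a l n k)))
      = (\<Sum>k<n. (?v (Suc k) - ?v k) - (b (mesh a l n (Suc k)) - b a) * ?I n k)"
      by (intro sum.cong refl) (auto simp: I algebra_simps)
    also have "\<dots> = (\<Sum>k<n. ?v (Suc k) - ?v k) - (\<Sum>k<n. (b (mesh a l n (Suc k)) - b a) * ?I n k)"
      by (rule sum_subtractf)
    also have "(\<Sum>k<n. ?v (Suc k) - ?v k) = ?v n - ?v 0" by (rule sum_lessThan_telescope)
    finally show ?case using mesh_top[OF elim, of a l] by simp
  qed
  ultimately show ?thesis by (rule Lim_transform_eventually)
qed

section \<open>Gaussian limits and the law of Wiener integrals\<close>

lemma (in prob_space) char_normal:
  assumes s: "0 < \<sigma>" and X: "distributed M lborel X (normal_density 0 \<sigma>)"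
  shows "(CLINT \<omega>|M. iexp (u * X \<omega>)) = complex_of_real (exp (- (u\<^sup>2 * \<sigma>\<^sup>2) / 2))"
proof -
  have Y: "distributed M lborel (\<lambda>\<omega>. (X \<omega> - 0) / \<sigma>) std_normal_density"
    using X unfolding normal_standard_normal_convert[OF s] .
  have Xm: "X \<in> borel_measurable M" using distributed_measurable[OF X] by simp
  have "distr M borel (\<lambda>\<omega>. X \<omega> / \<sigma>) = distr M lborel (\<lambda>\<omega>. X \<omega> / \<sigma>)" by (rule distr_cong) auto
  also have "\<dots> = std_normal_distribution" using distributed_distr_eq_density[OF Y] by simp
  finally have D: "std_normal_distribution = distr M borel (\<lambda>\<omega>. X \<omega> / \<sigma>)" by simp
  have "char std_normal_distribution (u * \<sigma>) = (CLINT \<omega>|M. iexp (u * \<sigma> * (X \<omega> / \<sigma>)))"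
    unfolding D char_def using Xm by (subst integral_distr) auto
  then show ?thesis using s by (simp add: char_std_normal_distribution power_mult_distrib)
qed

text \<open>Dominated convergence identifies the characteristic function of \<open>Z\<close> as the
  limit of the explicit Gaussian ones, and Levy's uniqueness theorem turns it into the law.\<close>

lemma (in prob_space) normal_limit:
  assumes s: "\<And>n. 0 < \<sigma> n" and S: "\<And>n. distributed M lborel (S n) (normal_density 0 (\<sigma> n))"
    and Z: "Z \<in> borel_measurable M" and lim: "AE \<omega> in M. (\<lambda>n. S n \<omega>) \<longlonglongrightarrow> Z \<omega>"
    and v: "(\<lambda>n. (\<sigma> n)\<^sup>2) \<longlonglongrightarrow> v" "0 < v"
  shows "distributed M lborel Z (normal_density 0 (sqrt v))"
proof -
  define D where "D = density lborel (\<lambda>x. ennreal (normal_density 0 (sqrt v) x))"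
  have sv: "0 < sqrt v" using v by simp
  interpret D: prob_space D unfolding D_def using sv by (rule prob_space_normal_density)
  have "distributed D lborel (\<lambda>x. x) (normal_density 0 (sqrt v))"
    unfolding distributed_def D_def
    by (auto simp: distr_id2 intro!: measurable_ident_sets)
  from D.char_normal[OF sv this] have cD: "char D u = complex_of_real (exp (- (u\<^sup>2 * v) / 2))" for u
    using v unfolding char_def by simp
  have Sm: "S n \<in> borel_measurable M" for n using distributed_measurable[OF S[of n]] by simp
  have cZ: "char (distr M borel Z) u = complex_of_real (exp (- (u\<^sup>2 * v) / 2))" for u
  proof -
    have "(\<lambda>n. CLINT \<omega>|M. iexp (u * S n \<omega>)) \<longlonglongrightarrow> (CLINT \<omega>|M. iexp (u * Z \<omega>))"
    proof (rule integral_dominated_convergence[of _ _ _ "\<lambda>_. 1"])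
      show "AE \<omega> in M. (\<lambda>n. iexp (u * S n \<omega>)) \<longlonglongrightarrow> iexp (u * Z \<omega>)"
        using lim by eventually_elim (intro tendsto_intros)
    qed (use Sm Z in auto)
    then have "(\<lambda>n. complex_of_real (exp (- (u\<^sup>2 * (\<sigma> n)\<^sup>2) / 2))) \<longlonglongrightarrow> (CLINT \<omega>|M. iexp (u * Z \<omega>))"
      unfolding char_normal[OF s S] .
    moreover have "(\<lambda>n. complex_of_real (exp (- (u\<^sup>2 * (\<sigma> n)\<^sup>2) / 2))) \<longlonglongrightarrow> complex_of_real (exp (- (u\<^sup>2 * v) / 2))"
      by (intro tendsto_intros v) auto
    ultimately have "(CLINT \<omega>|M. iexp (u * Z \<omega>)) = complex_of_real (exp (- (u\<^sup>2 * v) / 2))"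
      by (rule LIMSEQ_unique)
    then show ?thesis unfolding char_def using Z by (subst integral_distr) auto
  qed
  have "distr M borel Z = D"
  proof (rule Levy_uniqueness)
    show "real_distribution (distr M borel Z)" using Z by simp
    show "real_distribution D"
      unfolding real_distribution_def real_distribution_axioms_def
      using D.prob_space_axioms by (auto simp: D_def)
    show "char (distr M borel Z) = char D" using cZ cD by auto
  qed
  moreover have "distr M lborel Z = distr M borel Z" by (rule distr_cong) auto
  ultimately show ?thesis unfolding distributed_def D_def using Z by auto
qed

lemma integral_square_pos:
  fixes \<phi> :: "real \<Rightarrow> real"
  assumes l: "0 < l" and c: "continuous_on {a..a+l} \<phi>" and pos: "\<And>s. s \<in> {a..a+l} \<Longrightarrow> 0 < \<phi> s"
  shows "0 < integral {a..a+l} (\<lambda>s. (\<phi> s)\<^sup>2)"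
proof -
  obtain s0 where s0: "s0 \<in> {a..a+l}" "\<And>s. s \<in> {a..a+l} \<Longrightarrow> \<phi> s0 \<le> \<phi> s"
    using continuous_attains_inf[of "{a..a+l}" \<phi>] c l by auto
  have "(\<phi> s0)\<^sup>2 * l = integral {a..a+l} (\<lambda>s. (\<phi> s0)\<^sup>2)" using l by simp
  also have "\<dots> \<le> integral {a..a+l} (\<lambda>s. (\<phi> s)\<^sup>2)"
    using s0 pos by (intro integral_le integrable_continuous_interval continuous_intros c power_mono) (auto intro: less_imp_le)
  finally show ?thesis using l pos[OF s0(1)] by (smt (verit) mult_pos_pos zero_less_power)
qed

text \<open>The expression by parts is the pathwise limit of sums of independent centred Gaussians,
  and their variances are Riemann sums of \<open>\<phi>\<^sup>2\<close>.\<close>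

lemma (in brownian) wiener_integral_normal:
  assumes l: "0 < l" and \<phi>': "continuous_on {1..1+l} \<phi>'"
    and der: "\<And>s. s \<in> {1..1+l} \<Longrightarrow> (\<phi> has_real_derivative \<phi>' s) (at s)"
    and pos: "\<And>s. s \<in> {1..1+l} \<Longrightarrow> 0 < \<phi> s"
  shows "distributed M lborel (\<lambda>\<omega>. \<phi> (1+l) * (B (1+l) \<omega> - B 1 \<omega>) - integral {1..1+l} (\<lambda>s. \<phi>' s * (B s \<omega> - B 1 \<omega>)))
    (normal_density 0 (sqrt (integral {1..1+l} (\<lambda>s. (\<phi> s)\<^sup>2))))" (is "distributed M lborel ?Z _")
proof -
  define t where "t = mesh 1 l"
  have tmem: "t n k \<in> {1..1+l}" if "k \<le> n" "0 < n" for n k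
    unfolding t_def using mesh_ge[of l 1 n k] mesh_le[of l n k 1] that l by auto
  have tless: "t n k < t n (Suc k)" if "0 < n" for n k unfolding t_def by (rule mesh_less[OF l that])
  have c\<phi>: "continuous_on {1..1+l} \<phi>"
    using der by (intro DERIV_continuous_on[of _ _ \<phi>']) (auto intro: has_field_derivative_at_within)
  define S where "S n \<omega> = (\<Sum>k<n. \<phi> (t n k) * (B (t n (Suc k)) \<omega> - B (t n k) \<omega>))" for n \<omega>
  have lim: "(\<lambda>n. S n \<omega>) \<longlonglongrightarrow> ?Z \<omega>" if "\<omega> \<in> space M" for \<omega>
    unfolding S_def t_def
    using continuous_on_subset[OF cont_B[OF that], of "{1..1+l}"]
    by (intro riemann_stieltjes_by_parts l \<phi>' der) auto
  have normal: "distributed M lborel (S n) (normal_density 0 (sqrt (\<Sum>k<n. (\<phi> (t n k))\<^sup>2 * (l / real n))))" if n: "0 < n" for n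
  proof -
    have t0: "0 \<le> t n k" if "k \<le> n" for k using tmem[OF that n] by auto
    have ind: "indep_vars (\<lambda>_. borel) (\<lambda>k \<omega>. B (t n (Suc k)) \<omega> - B (t n k) \<omega>) {..<n}"
      using t0[of 0] tless[OF n] by (intro B_indep) auto
    have ind': "indep_vars (\<lambda>_. borel) (\<lambda>k \<omega>. \<phi> (t n k) * (B (t n (Suc k)) \<omega> - B (t n k) \<omega>)) {..<n}"
      by (rule indep_vars_compose2[OF ind, of "\<lambda>k x. \<phi> (t n k) * x"]) simp
    have "distributed M lborel (S n) (normal_density (\<Sum>k<n. 0) (sqrt (\<Sum>k<n. (\<phi> (t n k) * sqrt (l / real n))\<^sup>2)))"
      unfolding S_def
    proof (rule sum_indep_normal[OF _ _ ind'])
      fix k assume k: "k \<in> {..<n}"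
      have ph: "0 < \<phi> (t n k)" using pos[OF tmem[of k n]] k n by simp
      show "0 < \<phi> (t n k) * sqrt (l / real n)" using ph l n by simp
      have "t n (Suc k) - t n k = l / real n" unfolding t_def by (rule mesh_step)
      then have "distributed M lborel (\<lambda>\<omega>. B (t n (Suc k)) \<omega> - B (t n k) \<omega>) (normal_density 0 (sqrt (l / real n)))"
        using B_normal[OF t0[of k] tless[OF n, of k]] k by simp
      from normal_density_affine[OF this, of "\<phi> (t n k)" 0] ph l n
      show "distributed M lborel (\<lambda>\<omega>. \<phi> (t n k) * (B (t n (Suc k)) \<omega> - B (t n k) \<omega>)) (normal_density 0 (\<phi> (t n k) * sqrt (l / real n)))"
        by simp
    qed (use n in auto)
    then show ?thesis using l by (simp add: power_mult_distrib)
  qed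
  have var: "(\<lambda>n. \<Sum>k<n. (\<phi> (t n k))\<^sup>2 * (l / real n)) \<longlonglongrightarrow> integral {1..1+l} (\<lambda>s. (\<phi> s)\<^sup>2)"
  proof -
    have "(\<lambda>n. \<Sum>k<n. (\<phi> (t n k))\<^sup>2 * integral {mesh 1 l n k..mesh 1 l n (Suc k)} (\<lambda>_. 1))
      \<longlonglongrightarrow> integral {1..1+l} (\<lambda>s. 1 * (\<phi> s)\<^sup>2)"
      unfolding t_def using mesh_less[OF l]
      by (intro riemann_cells[where w = "\<lambda>s. (\<phi> s)\<^sup>2" and \<xi> = "\<lambda>n k. mesh 1 l n k"] l continuous_intros c\<phi>)
         (auto intro!: less_imp_le)
    moreover have "integral {mesh 1 l n k..mesh 1 l n (Suc k)} (\<lambda>_. 1) = l / real n" if "k < n" for n k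
      using mesh_less[OF l, of n 1 k] mesh_step[of 1 l n k] that by simp
    ultimately show ?thesis by simp
  qed
  have pv: "0 < (\<Sum>k<n. (\<phi> (t n k))\<^sup>2 * (l / real n))" if n: "0 < n" for n
    using n l pos[OF tmem] by (intro sum_pos mult_pos_pos zero_less_power) auto
  have ivp: "0 < integral {1..1+l} (\<lambda>s. (\<phi> s)\<^sup>2)"
    by (rule integral_square_pos[OF l c\<phi> pos])
  have Sm: "S n \<in> borel_measurable M" for n
  proof (cases "n = 0")
    case False
    then show ?thesis using distributed_measurable[OF normal] by simp
  next
    case True
    then have "S n = (\<lambda>_. 0)" by (simp add: S_def fun_eq_iff)
    then show ?thesis by simp
  qed
  have Zm: "?Z \<in> borel_measurable M" by (rule borel_measurable_LIMSEQ_real[OF lim Sm])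
  \<comment> \<open>The sequence is shifted to \<open>Suc n\<close> because the empty sum at 0 has
    variance 0 and hence no normal density.\<close>
  show ?thesis
  proof (rule normal_limit[where S = "\<lambda>n. S (Suc n)" and \<sigma> = "\<lambda>n. sqrt (\<Sum>k<Suc n. (\<phi> (t (Suc n) k))\<^sup>2 * (l / real (Suc n)))", OF _ normal Zm])
    show "0 < sqrt (\<Sum>k<Suc n. (\<phi> (t (Suc n) k))\<^sup>2 * (l / real (Suc n)))" for n using pv[of "Suc n"] by (simp del: sum.lessThan_Suc)
    show "AE \<omega> in M. (\<lambda>n. S (Suc n) \<omega>) \<longlonglongrightarrow> ?Z \<omega>" using lim by (auto intro!: AE_I2 LIMSEQ_Suc)
    have "(sqrt (\<Sum>k<Suc n. (\<phi> (t (Suc n) k))\<^sup>2 * (l / real (Suc n))))\<^sup>2 = (\<Sum>k<Suc n. (\<phi> (t (Suc n) k))\<^sup>2 * (l / real (Suc n)))" for n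
      using pv[of "Suc n"] by (intro real_sqrt_pow2) simp
    then show "(\<lambda>n. (sqrt (\<Sum>k<Suc n. (\<phi> (t (Suc n) k))\<^sup>2 * (l / real (Suc n))))\<^sup>2) \<longlonglongrightarrow> integral {1..1+l} (\<lambda>s. (\<phi> s)\<^sup>2)"
      using LIMSEQ_Suc[OF var] by simp
  qed (use ivp in auto)
qed

lemma set_integrable_decay:
  fixes h :: "real \<Rightarrow> real"
  assumes h: "continuous_on {1..} h" and dec: "\<forall>\<^sub>F s in at_top. \<bar>h s\<bar> \<le> s powr (-2)"
  shows "set_integrable lborel {1..} h"
proof -
  obtain R where R: "\<And>s. s \<ge> R \<Longrightarrow> \<bar>h s\<bar> \<le> s powr (-2)" using dec unfolding eventually_at_top_linorder by blast
  define R' where "R' = max R 1"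
  have "set_integrable lborel {1..R'} h"
    using h by (intro borel_integrable_atLeastAtMost') (auto intro: continuous_on_subset)
  moreover have "set_integrable lborel {R'..} h"
  proof -
    have "(\<lambda>s::real. s powr (-2)) absolutely_integrable_on {R'..}"
      using has_integral_powr_to_inf[of "-2" R'] by (intro nonnegative_absolutely_integrable_1) (auto simp: R'_def has_integral_iff)
    then have "set_integrable lborel {R'..} (\<lambda>s::real. s powr (-2))"
      unfolding set_integrable_def by (subst (asm) integrable_completion) auto
    then show ?thesis
    proof (rule set_integrable_bound)
      have "continuous_on {R'..} h" using h by (rule continuous_on_subset) (auto simp: R'_def)
      then show "set_borel_measurable lborel {R'..} h"
        using borel_measurable_continuous_on_indicator[of "{R'..}" h] by (simp add: set_borel_measurable_def)
      show "AE s in lborel. s \<in> {R'..} \<longrightarrow> norm (h s) \<le> norm (s powr (-2))"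
        using R by (auto simp: R'_def)
    qed
  qed
  ultimately have "set_integrable lborel ({1..R'} \<union> {R'..}) h" by (rule set_integrable_Un) auto
  moreover have "{1..R'} \<union> {R'..} = {1..}" by (auto simp: R'_def)
  ultimately show ?thesis by simp
qed

lemma stretched_exp_decay:
  fixes c d q :: real
  assumes "c > 0" "d > 0"
  shows "((\<lambda>s. s powr q * exp (- (c * s powr d))) \<longlongrightarrow> 0) at_top"
  using assms by real_asymp

section \<open>The linear equation, \<alpha> = 1\<close>

locale linear_rate =
  fixes \<rho> \<beta> :: real
  assumes rho_pos: "0 < \<rho>" and be: "\<beta> < 1"
begin

text \<open>Integrating factor of the linear equation, the reciprocal of the growth factor in (c).
  It is not normalised at time 1: its value \<open>exp (\<rho> / (\<beta> - 1))\<close> there is the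
  factor of \<open>x0\<close> in the mean of the limit.\<close>

definition \<phi> where "\<phi> t = exp (- (\<rho> * t powr (1 - \<beta>) / (1 - \<beta>)))"
definition \<phi>' where "\<phi>' t = - (\<rho> / t powr \<beta>) * \<phi> t"

lemma \<phi>_pos: "0 < \<phi> t" by (simp add: \<phi>_def)

lemma \<phi>_deriv: "0 < t \<Longrightarrow> (\<phi> has_real_derivative \<phi>' t) (at t)"
  unfolding \<phi>_def \<phi>'_def using be
  by (auto intro!: derivative_eq_intros simp: powr_minus_divide)

lemma cont_\<phi>: "A \<subseteq> {0<..} \<Longrightarrow> continuous_on A \<phi>"
  by (rule DERIV_continuous_on[of _ _ \<phi>']) (auto intro!: has_field_derivative_at_within \<phi>_deriv)

lemma cont_\<phi>': "A \<subseteq> {0<..} \<Longrightarrow> continuous_on A \<phi>'"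
  unfolding \<phi>'_def by (intro continuous_intros cont_\<phi>) auto

lemma \<phi>_decay: "((\<lambda>s. s powr q * \<phi> s) \<longlongrightarrow> 0) at_top"
  using stretched_exp_decay[of "\<rho> / (1 - \<beta>)" "1 - \<beta>" q] rho_pos be by (simp add: \<phi>_def)

lemma integrable_\<phi>_sq: "set_integrable lborel {1..} (\<lambda>s. (\<phi> s)\<^sup>2)"
proof (rule set_integrable_decay)
  show "continuous_on {1..} (\<lambda>s. (\<phi> s)\<^sup>2)" by (intro continuous_intros cont_\<phi>) auto
  have "\<forall>\<^sub>F s in at_top. s powr 1 * \<phi> s < 1" by (rule order_tendstoD[OF \<phi>_decay]) simp
  then show "\<forall>\<^sub>F s in at_top. \<bar>(\<phi> s)\<^sup>2\<bar> \<le> s powr (-2)"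
    using eventually_gt_at_top[of 0]
  proof eventually_elim
    case (elim s)
    have "\<phi> s \<le> 1 / s" using elim by (simp add: field_simps)
    then have "(\<phi> s)\<^sup>2 \<le> (1 / s)\<^sup>2" using \<phi>_pos[of s] by (intro power_mono) auto
    also have "(1 / s)\<^sup>2 = s powr (-2)" using elim by (simp add: powr_minus_divide power_divide)
    finally show ?case by simp
  qed
qed

lemma integral_\<phi>_sq_pos: "0 < integral {1..1 + real (Suc n)} (\<lambda>s. (\<phi> s)\<^sup>2)"
  by (intro integral_square_pos cont_\<phi> \<phi>_pos) auto

lemma integral_\<phi>_sq: "integral {1..t} (\<lambda>s. (\<phi> s)\<^sup>2) = (LBINT s:{1..t}. (\<phi> s)\<^sup>2)"
  by (rule set_borel_integral_eq_integral(2)[symmetric]) (rule set_integrable_subset[OF integrable_\<phi>_sq], auto)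

lemma LBINT_\<phi>_sq_pos: "0 < (LBINT s:{1..}. (\<phi> s)\<^sup>2)"
proof -
  have "0 < (LBINT s:{1..2}. (\<phi> s)\<^sup>2)" using integral_\<phi>_sq_pos[of 0] integral_\<phi>_sq[of 2] by simp
  also have "\<dots> \<le> (LBINT s:{1..}. (\<phi> s)\<^sup>2)"
    unfolding set_lebesgue_integral_def
    using integrable_\<phi>_sq set_integrable_subset[OF integrable_\<phi>_sq, of "{1..2}"] unfolding set_integrable_def
    by (intro integral_mono) (auto simp: indicator_def)
  finally show ?thesis .
qed

text \<open>The Wiener integral of \<phi> over \<open>{1..t}\<close>, integrated by parts so that it
  is defined path by path.\<close>

definition W where "W b t = \<phi> t * (b t - b 1) - integral {1..t} (\<lambda>s. \<phi>' s * (b s - b 1))"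

text \<open>\<phi> decays faster than any power while \<open>b\<close> grows at most linearly, so
  the boundary term vanishes and the integral converges absolutely.\<close>

lemma W_limit:
  assumes b: "continuous_on {1..} b" and growth: "\<forall>\<^sub>F t in at_top. \<bar>b t\<bar> \<le> t powr 1"
  shows "\<exists>I. (W b \<longlongrightarrow> I) at_top"
proof -
  define h where "h s = \<phi>' s * (b s - b 1)" for s
  have ch: "continuous_on {1..} h" unfolding h_def by (intro continuous_intros cont_\<phi>' b) auto
  have db: "\<forall>\<^sub>F t in at_top. \<bar>b t - b 1\<bar> \<le> t powr 2"
    using growth eventually_ge_at_top[of 1] eventually_ge_at_top[of "1 + \<bar>b 1\<bar>"]
  proof eventually_elim
    case (elim t)
    have "\<bar>b t - b 1\<bar> \<le> t + \<bar>b 1\<bar>" using elim by simp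
    also have "\<dots> \<le> t * (1 + \<bar>b 1\<bar>)" using elim by (simp add: algebra_simps mult_le_cancel_right1)
    also have "\<dots> \<le> t * t" using elim by (intro mult_left_mono) auto
    finally show ?case using elim by (simp add: power2_eq_square)
  qed
  have "\<forall>\<^sub>F s in at_top. \<bar>h s\<bar> \<le> s powr (-2)"
  proof -
    \<comment> \<open>The exponent collects \<open>s powr (- \<beta>)\<close> from
      \<open>\<phi>'\<close>, \<open>s powr 2\<close> from the bound on \<open>b s - b 1\<close>,
      and \<open>s powr 2\<close> to leave the integrable majorant
      \<open>s powr (-2)\<close>.\<close>
    have "\<forall>\<^sub>F s in at_top. s powr (4 - \<beta>) * \<phi> s < 1 / \<rho>" by (rule order_tendstoD[OF \<phi>_decay]) (use rho_pos in simp)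
    then show ?thesis using db eventually_gt_at_top[of 0]
    proof eventually_elim
      case (elim s)
      have p: "s powr (4 - \<beta>) = s powr 2 * s powr (- \<beta>) * s powr 2"
        by (simp add: powr_add[symmetric])
      have "\<bar>h s\<bar> = \<rho> * s powr (- \<beta>) * \<phi> s * \<bar>b s - b 1\<bar>"
        using rho_pos \<phi>_pos[of s] by (simp add: h_def \<phi>'_def abs_mult powr_minus_divide)
      also have "\<dots> \<le> \<rho> * s powr (- \<beta>) * \<phi> s * s powr 2"
        using elim rho_pos \<phi>_pos[of s] by (intro mult_left_mono) auto
      finally have "\<bar>h s\<bar> * s powr 2 \<le> (\<rho> * s powr (- \<beta>) * \<phi> s * s powr 2) * s powr 2"
        by (rule mult_right_mono) simp
      also have "\<dots> = \<rho> * (s powr (4 - \<beta>) * \<phi> s)" unfolding p by (simp only: mult_ac)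
      also have "\<dots> \<le> 1" using elim rho_pos by (simp add: field_simps)
      finally show ?case using elim by (simp add: powr_minus_divide field_simps)
    qed
  qed
  then have ih: "set_integrable lborel {1..} h" by (rule set_integrable_decay[OF ch])
  have "((\<lambda>t. LBINT s:{1..t}. h s) \<longlongrightarrow> (LBINT s:{1..}. h s)) at_top"
    by (rule tendsto_set_lebesgue_integral_at_top[OF _ ih]) auto
  moreover have "(LBINT s:{1..t}. h s) = integral {1..t} h" for t
    by (rule set_borel_integral_eq_integral(2)) (rule set_integrable_subset[OF ih], auto)
  ultimately have L1: "((\<lambda>t. integral {1..t} h) \<longlongrightarrow> (LBINT s:{1..}. h s)) at_top" by simp
  have L2: "((\<lambda>t. \<phi> t * (b t - b 1)) \<longlongrightarrow> 0) at_top"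
  proof (rule Lim_null_comparison[OF _ \<phi>_decay[of 2]])
    show "\<forall>\<^sub>F t in at_top. norm (\<phi> t * (b t - b 1)) \<le> t powr 2 * \<phi> t"
      using db by eventually_elim (use \<phi>_pos in \<open>simp add: abs_mult mult.commute mult_right_mono less_imp_le\<close>)
  qed
  have "(W b \<longlongrightarrow> 0 - (LBINT s:{1..}. h s)) at_top"
    unfolding W_def[abs_def] using tendsto_diff[OF L2 L1] unfolding h_def[abs_def] .
  then show ?thesis by blast
qed

end

context sde_path
begin

text \<open>Variation of constants: for \<open>y = x - (b - b 1)\<close> the terms with
  \<open>x\<close> cancel in the derivative of \<open>y * \<phi>\<close>, and only
  \<open>- \<phi>' * (b - b 1)\<close> remains, which is integrated explicitly.\<close>

lemma linear_solution:
  assumes al: "\<alpha> = 1" and T: "T = \<infinity>" and be: "\<beta> < 1" and t: "1 \<le> t"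
  shows "x t * linear_rate.\<phi> \<rho> \<beta> t = x 1 * linear_rate.\<phi> \<rho> \<beta> 1 + linear_rate.W \<rho> \<beta> b t"
proof -
  interpret linear_rate \<rho> \<beta> by unfold_locales (use rho be in auto)
  have f: "f s = \<rho> * x s / s powr \<beta>" for s
    by (simp add: drift_def al mult.assoc sgn_mult_abs)
  have cx: "continuous_on {1..t} x" using T by (intro cont_x') auto
  have cf: "continuous_on {1..t} f" unfolding f by (intro continuous_intros cx) auto
  define y where "y s = x s - (b s - b 1)" for s
  have dy: "(y has_real_derivative f s) (at s within {1..t})" if s: "s \<in> {1..t}" for s
  proof -
    have "((\<lambda>u. x 1 + integral {1..u} f) has_real_derivative f s) (at s within {1..t})"
      using integral_has_real_derivative[OF cf s] by (auto intro!: derivative_eq_intros)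
    moreover have "x 1 + integral {1..u} f = y u" if "u \<in> {1..t}" for u
      using incr[of 1 u] T that by (simp add: y_def)
    ultimately show ?thesis
      using has_field_derivative_transform_within[OF _ zero_less_one s, of "\<lambda>u. x 1 + integral {1..u} f" "f s" y]
      by blast
  qed
  have "((\<lambda>s. - \<phi>' s * (b s - b 1)) has_integral y t * \<phi> t - y 1 * \<phi> 1) {1..t}"
  proof (rule fundamental_theorem_of_calculus[OF t])
    fix s assume s: "s \<in> {1..t}"
    have "((\<lambda>s. y s * \<phi> s) has_real_derivative f s * \<phi> s + \<phi>' s * y s) (at s within {1..t})"
      using s by (intro DERIV_mult dy has_field_derivative_at_within[OF \<phi>_deriv]) auto
    moreover have "f s * \<phi> s + \<phi>' s * y s = - \<phi>' s * (b s - b 1)"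
      by (simp add: f y_def \<phi>'_def algebra_simps diff_divide_distrib add_divide_distrib)
    ultimately show "((\<lambda>s. y s * \<phi> s) has_vector_derivative - \<phi>' s * (b s - b 1)) (at s within {1..t})"
      by (simp add: has_real_derivative_iff_has_vector_derivative)
  qed
  then have "((\<lambda>s. - (\<phi>' s * (b s - b 1))) has_integral y t * \<phi> t - y 1 * \<phi> 1) {1..t}" by simp
  from has_integral_neg[OF this] have "((\<lambda>s. \<phi>' s * (b s - b 1)) has_integral - (y t * \<phi> t - y 1 * \<phi> 1)) {1..t}" by simp
  then have "integral {1..t} (\<lambda>s. \<phi>' s * (b s - b 1)) = - (y t * \<phi> t - y 1 * \<phi> 1)" by (rule integral_unique)
  then show ?thesis by (simp add: W_def y_def algebra_simps)
qed

end

context sde_sol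
begin

lemma linear_case:
  assumes al: "\<alpha> = 1" and be: "\<beta> < 1"
  shows "\<exists>G. distributed M lborel G
          (normal_density (x0 * exp (\<rho> / (\<beta> - 1)))
             (sqrt (LBINT s:{1..}. exp (2 * \<rho> * s powr (1 - \<beta>) / (\<beta> - 1))))) \<and>
          (AE \<omega> in M. \<tau> \<omega> = \<infinity> \<and>
             ((\<lambda>t. X t \<omega> / exp (\<rho> * t powr (1 - \<beta>) / (1 - \<beta>))) \<longlongrightarrow> G \<omega>) at_top)"
proof -
  interpret linear_rate \<rho> \<beta> by unfold_locales (use rho be in auto)
  define v where "v = (LBINT s:{1..}. (\<phi> s)\<^sup>2)"
  have v: "v = (LBINT s:{1..}. exp (2 * \<rho> * s powr (1 - \<beta>) / (\<beta> - 1)))"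
  proof -
    have "2 * (- (\<rho> * s powr (1 - \<beta>) / (1 - \<beta>))) = 2 * \<rho> * s powr (1 - \<beta>) / (\<beta> - 1)" for s
      using be by (simp add: field_simps)
    then show ?thesis unfolding v_def \<phi>_def exp_double[symmetric] by simp
  qed
  define Wn where "Wn n \<omega> = W (\<lambda>t. B t \<omega>) (1 + real (Suc n))" for n \<omega>
  \<comment> \<open>The limit along integer times is a measurable function and carries the Gaussian
    law; almost surely it coincides with the limit along all times.\<close>
  define Z where "Z \<omega> = lim (\<lambda>n. Wn n \<omega>)" for \<omega>
  have Wn: "distributed M lborel (Wn n) (normal_density 0 (sqrt (integral {1..1+real (Suc n)} (\<lambda>s. (\<phi> s)\<^sup>2))))" for n
    unfolding Wn_def W_def
    by (rule wiener_integral_normal) (auto intro!: cont_\<phi>' \<phi>_deriv \<phi>_pos)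
  have Wm: "Wn n \<in> borel_measurable M" for n using distributed_measurable[OF Wn] by simp
  have Zm: "Z \<in> borel_measurable M" unfolding Z_def[abs_def] using Wm by (rule borel_measurable_lim_metric)
  have nat_top: "filterlim (\<lambda>n. 1 + real (Suc n)) at_top sequentially" by real_asymp
  have growth: "AE \<omega> in M. \<forall>\<^sub>F t in at_top. \<bar>B t \<omega>\<bar> \<le> t powr 1" by (rule B_growth) simp
  have lim: "AE \<omega> in M. (W (\<lambda>t. B t \<omega>) \<longlongrightarrow> Z \<omega>) at_top \<and> (\<lambda>n. Wn n \<omega>) \<longlonglongrightarrow> Z \<omega>"
    using growth AE_space
  proof eventually_elim
    case (elim \<omega>)
    have "continuous_on {1..} (\<lambda>t. B t \<omega>)" using cont_B[OF elim(2)] by (rule continuous_on_subset) auto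
    from W_limit[OF this elim(1)] obtain I where I: "(W (\<lambda>t. B t \<omega>) \<longlongrightarrow> I) at_top" by blast
    have "(\<lambda>n. Wn n \<omega>) \<longlonglongrightarrow> I" unfolding Wn_def by (rule filterlim_compose[OF I nat_top])
    moreover from this have "Z \<omega> = I" unfolding Z_def by (rule limI)
    ultimately show ?case using I by simp
  qed
  have Zd: "distributed M lborel Z (normal_density 0 (sqrt v))"
  proof (rule normal_limit[OF _ Wn Zm])
    show "0 < sqrt (integral {1..1+real (Suc n)} (\<lambda>s. (\<phi> s)\<^sup>2))" for n using integral_\<phi>_sq_pos by simp
    show "AE \<omega> in M. (\<lambda>n. Wn n \<omega>) \<longlonglongrightarrow> Z \<omega>" using lim by eventually_elim simp
    have "((\<lambda>t. LBINT s:{1..t}. (\<phi> s)\<^sup>2) \<longlongrightarrow> v) at_top" unfolding v_def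
      by (rule tendsto_set_lebesgue_integral_at_top[OF _ integrable_\<phi>_sq]) auto
    from filterlim_compose[OF this nat_top]
    have "(\<lambda>n. integral {1..1+real (Suc n)} (\<lambda>s. (\<phi> s)\<^sup>2)) \<longlonglongrightarrow> v" unfolding integral_\<phi>_sq .
    moreover have "(sqrt (integral {1..1+real (Suc n)} (\<lambda>s. (\<phi> s)\<^sup>2)))\<^sup>2 = integral {1..1+real (Suc n)} (\<lambda>s. (\<phi> s)\<^sup>2)" for n
      using integral_\<phi>_sq_pos[of n] by (intro real_sqrt_pow2) simp
    ultimately show "(\<lambda>n. (sqrt (integral {1..1+real (Suc n)} (\<lambda>s. (\<phi> s)\<^sup>2)))\<^sup>2) \<longlonglongrightarrow> v" by simp
    show "0 < v" unfolding v_def by (rule LBINT_\<phi>_sq_pos)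
  qed
  define G where "G \<omega> = x0 * \<phi> 1 + 1 * Z \<omega>" for \<omega>
  have "distributed M lborel G (normal_density (x0 * \<phi> 1 + 1 * 0) (\<bar>1\<bar> * sqrt v))"
    unfolding G_def using LBINT_\<phi>_sq_pos by (intro normal_density_affine Zd) (auto simp: v_def)
  moreover have "\<phi> 1 = exp (\<rho> / (\<beta> - 1))"
    unfolding \<phi>_def using be by (simp add: field_simps)
  ultimately have Gd: "distributed M lborel G (normal_density (x0 * exp (\<rho> / (\<beta> - 1))) (sqrt v))" by simp
  have "AE \<omega> in M. \<tau> \<omega> = \<infinity> \<and> ((\<lambda>t. X t \<omega> / exp (\<rho> * t powr (1 - \<beta>) / (1 - \<beta>))) \<longlongrightarrow> G \<omega>) at_top"
    using lim AE_path
  proof eventually_elim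
    case (elim \<omega>)
    interpret sde_path \<rho> \<alpha> \<beta> "\<lambda>t. B t \<omega>" "\<lambda>t. X t \<omega>" "\<tau> \<omega>" using elim(2) by blast
    have T: "\<tau> \<omega> = \<infinity>" using al by (intro no_explosion) simp
    have l: "((\<lambda>t. x0 * \<phi> 1 + W (\<lambda>t. B t \<omega>) t) \<longlongrightarrow> G \<omega>) at_top"
      unfolding G_def using elim(1) by (auto intro!: tendsto_intros)
    have e: "\<forall>\<^sub>F t in at_top. x0 * \<phi> 1 + W (\<lambda>t. B t \<omega>) t = X t \<omega> / exp (\<rho> * t powr (1 - \<beta>) / (1 - \<beta>))"
      using eventually_ge_at_top[of 1]
    proof eventually_elim
      case t: (elim t)
      have "X t \<omega> * \<phi> t = x0 * \<phi> 1 + W (\<lambda>t. B t \<omega>) t"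
        using linear_solution[OF al T be t] elim(2) by simp
      then show ?case by (simp add: \<phi>_def exp_minus field_simps)
    qed
    show ?case using T Lim_transform_eventually[OF l e] by simp
  qed
  then show ?thesis using Gd unfolding v by blast
qed

end

section \<open>Transience and asymptotics\<close>

context sde_path
begin

lemma sublinear_transient:
  assumes T: "T = \<infinity>" and al: "\<alpha> < 1" and be: "\<beta> < 1"
    and k: "k > 0" and gr: "\<forall>\<^sub>F t in at_top. k * t powr q \<le> x t - b t"
    and b1: "\<forall>\<^sub>F t in at_top. \<bar>b t\<bar> \<le> t powr q'" and q: "q' < q" "q > 0"
  shows "((\<lambda>t. \<bar>x t\<bar> / t powr ((1 - \<beta>) / (1 - \<alpha>))) \<longlongrightarrow> (\<rho> * (1 - \<alpha>) / (1 - \<beta>)) powr (1 / (1 - \<alpha>))) at_top"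
    and "filterlim (\<lambda>t. \<bar>x t\<bar>) at_top at_top"
proof -
  note g = growth_ratio[OF k gr b1 q]
  have ev: "\<forall>\<^sub>F t in at_top. x t / t powr ((1 - \<beta>) / (1 - \<alpha>)) = \<bar>x t\<bar> / t powr ((1 - \<beta>) / (1 - \<alpha>))"
    using g(4) by eventually_elim simp
  show "((\<lambda>t. \<bar>x t\<bar> / t powr ((1 - \<beta>) / (1 - \<alpha>))) \<longlongrightarrow> (\<rho> * (1 - \<alpha>) / (1 - \<beta>)) powr (1 / (1 - \<alpha>))) at_top"
    by (rule Lim_transform_eventually[OF sublinear_asymp[OF T al be k gr b1 q] ev])
  show "filterlim (\<lambda>t. \<bar>x t\<bar>) at_top at_top"
    using g(3) by (rule filterlim_at_top_mono) (auto intro: always_eventually)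
qed

lemma explosion_transient:
  assumes T: "T = ereal r" and lim: "filterlim x at_top (at_left r)" and al: "\<alpha> > 1"
  shows "((\<lambda>t. \<bar>x t\<bar> * (\<rho> * (\<alpha> - 1) * (r - t)) powr (1 / (\<alpha> - 1)) / r powr (\<beta> / (\<alpha> - 1))) \<longlongrightarrow> 1) (at_left r)"
    and "filterlim (\<lambda>t. \<bar>x t\<bar>) at_top (at_left r)"
proof -
  have "\<forall>\<^sub>F t in at_left r. 0 < x t"
    using filterlim_at_top_dense[THEN iffD1, OF lim, THEN spec, of 0] .
  then have ev: "\<forall>\<^sub>F t in at_left r. x t * (\<rho> * (\<alpha> - 1) * (r - t)) powr (1 / (\<alpha> - 1)) / r powr (\<beta> / (\<alpha> - 1))
     = \<bar>x t\<bar> * (\<rho> * (\<alpha> - 1) * (r - t)) powr (1 / (\<alpha> - 1)) / r powr (\<beta> / (\<alpha> - 1))"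
    by eventually_elim simp
  show "((\<lambda>t. \<bar>x t\<bar> * (\<rho> * (\<alpha> - 1) * (r - t)) powr (1 / (\<alpha> - 1)) / r powr (\<beta> / (\<alpha> - 1))) \<longlongrightarrow> 1) (at_left r)"
    by (rule Lim_transform_eventually[OF explosion_asymp[OF T lim al] ev])
  show "filterlim (\<lambda>t. \<bar>x t\<bar>) at_top (at_left r)"
    using lim by (rule filterlim_at_top_mono) (auto intro: always_eventually)
qed

end

lemma phi_gamma_inv:
  assumes "\<gamma> < 1" "1 \<le> T"
  shows "phi_gamma \<gamma> (inv_into {0..} (phi_gamma \<gamma>) T) = T"
proof (rule f_inv_into_f)
  have "1 \<le> T powr (1 - \<gamma>)" using assms by (intro ge_one_powr_ge_zero) auto
  then have "0 \<le> (T powr (1 - \<gamma>) - 1) / (1 - \<gamma>)" using assms by simp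
  moreover have "phi_gamma \<gamma> ((T powr (1 - \<gamma>) - 1) / (1 - \<gamma>)) = T"
    using assms by (simp add: phi_gamma_def powr_powr)
  ultimately show "T \<in> phi_gamma \<gamma> ` {0..}" by (intro image_eqI[of _ _ "(T powr (1 - \<gamma>) - 1) / (1 - \<gamma>)"]) auto
qed

context sde_sol
begin

lemma AE_escape:
  assumes eps: "0 < \<epsilon>" "\<epsilon> < 1" "(2 + \<bar>\<alpha>\<bar>) * \<epsilon> < (\<alpha> + 1 - 2 * \<beta>) / 2"
  shows "AE \<omega> in M. \<tau> \<omega> = \<infinity> \<longrightarrow>
    (\<exists>k>0. \<forall>\<^sub>F t in at_top. k * t powr (1/2 + \<epsilon>) \<le> X t \<omega> - B t \<omega>) \<or>
    (\<exists>k>0. \<forall>\<^sub>F t in at_top. k * t powr (1/2 + \<epsilon>) \<le> - X t \<omega> - (- B t \<omega>))"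
proof -
  \<comment> \<open>The constant from \<open>AE_frequently_large\<close> depends on the path, while
    the oscillation bound holds almost surely for a fixed constant. It is therefore taken for all
    \<open>1 / Suc m\<close> at once, and the constant of the path is lowered to one of
    these.\<close>
  have osc: "AE \<omega> in M. \<forall>m::nat. \<forall>\<^sub>F t in at_top. \<forall>v\<in>{t..t + t powr (1 - \<epsilon>)}. \<bar>B v \<omega> - B t \<omega>\<bar> \<le> (1 / real (Suc m)) / 4 * sqrt t"
    unfolding AE_all_countable using eps by (intro allI B_oscillation) auto
  have gr: "AE \<omega> in M. \<forall>\<^sub>F t in at_top. \<bar>B t \<omega>\<bar> \<le> t powr (1/2 + \<epsilon>/2)"
    using eps by (intro B_growth) auto
  show ?thesis
    using osc gr AE_frequently_large AE_path
  proof eventually_elim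
    case (elim \<omega>)
    show ?case
    proof
      assume T: "\<tau> \<omega> = \<infinity>"
      interpret sde_path \<rho> \<alpha> \<beta> "\<lambda>t. B t \<omega>" "\<lambda>t. X t \<omega>" "\<tau> \<omega>" using elim(4) by blast
      obtain c where c: "c > 0" "\<And>R. \<exists>t\<ge>R. c * sqrt t \<le> \<bar>X t \<omega>\<bar>" using elim(3) T by blast
      obtain m where m: "inverse (real (Suc m)) < c" using reals_Archimedean[OF c(1)] by blast
      define c' where "c' = 1 / real (Suc m)"
      have c': "c' > 0" "c' \<le> c" using m by (auto simp: c'_def inverse_eq_divide)
      have fr: "\<exists>t\<ge>R. c' * sqrt t \<le> \<bar>X t \<omega>\<bar>" for R
      proof -
        obtain t where t: "t \<ge> max R 0" "c * sqrt t \<le> \<bar>X t \<omega>\<bar>" using c(2) by blast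
        have "c' * sqrt t \<le> c * sqrt t" using c' t by (intro mult_right_mono) auto
        then show ?thesis using t by (intro exI[of _ t]) auto
      qed
      have osc': "\<forall>\<^sub>F t in at_top. \<forall>v\<in>{t..t + t powr (1 - \<epsilon>)}. \<bar>B v \<omega> - B t \<omega>\<bar> \<le> c' / 4 * sqrt t"
        using elim(1) unfolding c'_def by blast
      have "(\<forall>R. \<exists>t\<ge>R. c' * sqrt t \<le> X t \<omega>) \<or> (\<forall>R. \<exists>t\<ge>R. c' * sqrt t \<le> - X t \<omega>)"
      proof (rule ccontr)
        assume "\<not> ?thesis"
        then obtain R1 R2 where R: "\<And>t. t \<ge> R1 \<Longrightarrow> \<not> c' * sqrt t \<le> X t \<omega>" "\<And>t. t \<ge> R2 \<Longrightarrow> \<not> c' * sqrt t \<le> - X t \<omega>"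
          by blast
        obtain t where "t \<ge> max R1 R2" "c' * sqrt t \<le> \<bar>X t \<omega>\<bar>" using fr by blast
        then show False using R[of t] by (auto simp: abs_if split: if_splits)
      qed
      then show "(\<exists>k>0. \<forall>\<^sub>F t in at_top. k * t powr (1/2 + \<epsilon>) \<le> X t \<omega> - B t \<omega>) \<or>
        (\<exists>k>0. \<forall>\<^sub>F t in at_top. k * t powr (1/2 + \<epsilon>) \<le> - X t \<omega> - (- B t \<omega>))"
      proof
        assume "\<forall>R. \<exists>t\<ge>R. c' * sqrt t \<le> X t \<omega>"
        then show ?thesis
          using escape[OF T c'(1) eps(1,3) elim(2) osc'] by blast
      next
        assume fr': "\<forall>R. \<exists>t\<ge>R. c' * sqrt t \<le> - X t \<omega>"
        have 1: "\<forall>\<^sub>F t in at_top. \<bar>- B t \<omega>\<bar> \<le> t powr (1/2 + \<epsilon>/2)" using elim(2) by simp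
        have 2: "\<forall>\<^sub>F t in at_top. \<forall>v\<in>{t..t + t powr (1 - \<epsilon>)}. \<bar>- B v \<omega> - - B t \<omega>\<bar> \<le> c' / 4 * sqrt t"
          using osc' by eventually_elim (auto simp: abs_minus_commute)
        show ?thesis
          using sde_path.escape[OF neg T c'(1) eps(1,3) 1 2] fr' by blast
      qed
    qed
  qed
qed

lemma escape_exponent:
  assumes ab: "2 * \<beta> < \<alpha> + 1"
  obtains \<epsilon> where "0 < \<epsilon>" "\<epsilon> < 1" "(2 + \<bar>\<alpha>\<bar>) * \<epsilon> < (\<alpha> + 1 - 2 * \<beta>) / 2"
proof -
  define th where "th = (\<alpha> + 1 - 2 * \<beta>) / 2"
  \<comment> \<open>The denominator \<open>3 + \<bar>\<alpha>\<bar>\<close> in place of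
    \<open>2 + \<bar>\<alpha>\<bar>\<close> yields the strict inequality.\<close>
  define \<epsilon> where "\<epsilon> = min (1/2) (th / (3 + \<bar>\<alpha>\<bar>))"
  have th: "th > 0" using ab by (simp add: th_def)
  have e: "0 < \<epsilon>" "\<epsilon> < 1" using th by (auto simp: \<epsilon>_def min_def)
  have "(2 + \<bar>\<alpha>\<bar>) * \<epsilon> < (3 + \<bar>\<alpha>\<bar>) * \<epsilon>" using e by simp
  also have "\<dots> \<le> (3 + \<bar>\<alpha>\<bar>) * (th / (3 + \<bar>\<alpha>\<bar>))" by (intro mult_left_mono) (auto simp: \<epsilon>_def)
  also have "\<dots> = th" by (simp add: add_nonneg_eq_0_iff)
  finally show thesis using that[of \<epsilon>] e by (simp add: th_def)
qed

lemma sublinear_case: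
  assumes al: "\<alpha> < 1" and ab: "2 * \<beta> < \<alpha> + 1"
  shows "AE \<omega> in M. \<tau> \<omega> = \<infinity> \<and> filterlim (\<lambda>t. \<bar>X t \<omega>\<bar>) at_top at_top \<and>
    ((\<lambda>t. \<bar>X t \<omega>\<bar> / t powr ((1 - \<beta>) / (1 - \<alpha>)))
             \<longlongrightarrow> (\<rho> * (1 - \<alpha>) / (1 - \<beta>)) powr (1 / (1 - \<alpha>))) at_top"
proof -
  obtain \<epsilon> where eps: "0 < \<epsilon>" "\<epsilon> < 1" "(2 + \<bar>\<alpha>\<bar>) * \<epsilon> < (\<alpha> + 1 - 2 * \<beta>) / 2" using escape_exponent[OF ab] by blast
  have gr: "AE \<omega> in M. \<forall>\<^sub>F t in at_top. \<bar>B t \<omega>\<bar> \<le> t powr (1/2 + \<epsilon>/2)"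
    using eps by (intro B_growth) auto
  have be: "\<beta> < 1" using al ab by simp
  have q: "1/2 + \<epsilon>/2 < 1/2 + \<epsilon>" "0 < 1/2 + \<epsilon>" using eps by auto
  show ?thesis
    using AE_escape[OF eps] gr AE_path
  proof eventually_elim
    case (elim \<omega>)
    interpret sde_path \<rho> \<alpha> \<beta> "\<lambda>t. B t \<omega>" "\<lambda>t. X t \<omega>" "\<tau> \<omega>" using elim(3) by blast
    have T: "\<tau> \<omega> = \<infinity>" using al by (intro no_explosion) simp
    have gr': "\<forall>\<^sub>F t in at_top. \<bar>- B t \<omega>\<bar> \<le> t powr (1/2 + \<epsilon>/2)" using elim(2) by simp
    from elim(1) T consider (1) k where "k > 0" "\<forall>\<^sub>F t in at_top. k * t powr (1/2 + \<epsilon>) \<le> X t \<omega> - B t \<omega>"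
      | (2) k where "k > 0" "\<forall>\<^sub>F t in at_top. k * t powr (1/2 + \<epsilon>) \<le> - X t \<omega> - (- B t \<omega>)" by blast
    then show ?case
    proof cases
      case 1
      then show ?thesis using T sublinear_transient[OF T al be 1 elim(2) q] by blast
    next
      case 2
      then show ?thesis using T sde_path.sublinear_transient[OF neg T al be 2 gr' q] by simp
    qed
  qed
qed

lemma superlinear_case:
  assumes al: "\<alpha> > 1" and ab: "2 * \<beta> < \<alpha> + 1"
  shows "AE \<omega> in M. \<exists>r>1. \<tau> \<omega> = ereal r \<and> filterlim (\<lambda>t. \<bar>X t \<omega>\<bar>) at_top (at_left r) \<and>
    ((\<lambda>t. \<bar>X t \<omega>\<bar> * (\<rho> * (\<alpha> - 1) * (r - t)) powr (1 / (\<alpha> - 1)) / r powr (\<beta> / (\<alpha> - 1))) \<longlongrightarrow> 1) (at_left r)"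
proof -
  obtain \<epsilon> where eps: "0 < \<epsilon>" "\<epsilon> < 1" "(2 + \<bar>\<alpha>\<bar>) * \<epsilon> < (\<alpha> + 1 - 2 * \<beta>) / 2" using escape_exponent[OF ab] by blast
  have gr: "AE \<omega> in M. \<forall>\<^sub>F t in at_top. \<bar>B t \<omega>\<bar> \<le> t powr (1/2 + \<epsilon>/2)"
    using eps by (intro B_growth) auto
  \<comment> \<open>The exponent condition of \<open>superlinear_explodes\<close> holds already with
    1/2 in place of \<open>1/2 + \<epsilon>\<close>, where it is equivalent to
    \<open>2 * \<beta> < \<alpha> + 1\<close>; as \<alpha> > 1, adding \<epsilon> only
    helps.\<close>
  have "0 < \<epsilon> * (\<alpha> - 1)" using eps al by simp
  then have "(1 - \<alpha>) / 2 - \<epsilon> * (\<alpha> - 1) < (1 - \<alpha>) / 2 - 0" by (rule diff_strict_left_mono)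
  also have "(1 - \<alpha>) / 2 - 0 = (1 - \<alpha>) / 2" by (rule diff_zero)
  also have "\<dots> < 1 - \<beta>" using ab by (simp add: field_simps)
  also have "(1 - \<alpha>) / 2 - \<epsilon> * (\<alpha> - 1) = (1/2 + \<epsilon>) * (1 - \<alpha>)" by (simp add: algebra_simps)
  finally have "(1/2 + \<epsilon>) * (1 - \<alpha>) < 1 - \<beta>" .
  then have q: "1/2 + \<epsilon>/2 < 1/2 + \<epsilon>" "0 < 1/2 + \<epsilon>" "(1/2 + \<epsilon>) * (1 - \<alpha>) < 1 - \<beta>"
    using eps by auto
  show ?thesis
    using AE_escape[OF eps] gr AE_path
  proof eventually_elim
    case (elim \<omega>)
    interpret sde_path \<rho> \<alpha> \<beta> "\<lambda>t. B t \<omega>" "\<lambda>t. X t \<omega>" "\<tau> \<omega>" using elim(3) by blast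
    have gr': "\<forall>\<^sub>F t in at_top. \<bar>- B t \<omega>\<bar> \<le> t powr (1/2 + \<epsilon>/2)" using elim(2) by simp
    have "\<tau> \<omega> \<noteq> \<infinity>"
    proof
      assume T: "\<tau> \<omega> = \<infinity>"
      with elim(1) consider (1) k where "k > 0" "\<forall>\<^sub>F t in at_top. k * t powr (1/2 + \<epsilon>) \<le> X t \<omega> - B t \<omega>"
        | (2) k where "k > 0" "\<forall>\<^sub>F t in at_top. k * t powr (1/2 + \<epsilon>) \<le> - X t \<omega> - (- B t \<omega>)" by blast
      then show False
        using superlinear_explodes[OF T al _ _ elim(2) q] sde_path.superlinear_explodes[OF neg T al _ _ gr' q]
        by cases blast+
    qed
    then obtain r where r: "\<tau> \<omega> = ereal r" using T_gt by (cases "\<tau> \<omega>") auto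
    have "r > 1" using T_gt r by simp
    then show ?case
      using r explosion[OF r] explosion_transient[OF r _ al] sde_path.explosion_transient[OF neg r _ al]
      by (intro exI[of _ r]) auto
  qed
qed

end

theorem theorem4p9:
  fixes M :: "'a measure" and B X :: "real \<Rightarrow> 'a \<Rightarrow> real" and \<tau> :: "'a \<Rightarrow> ereal"
    and \<rho> \<alpha> \<beta> x0 :: real
  assumes BM: "std_brownian_motion M B"
    and rho: "\<rho> > 0"
    and ab: "2 * \<beta> < \<alpha> + 1"
    and x0: "x0 \<ge> 0"
    and sol: "sde_solution M B \<rho> \<alpha> \<beta> x0 X \<tau>"
    and nonneg: "\<alpha> \<le> -1 \<Longrightarrow> AE \<omega> in M. \<forall>t. 1 \<le> t \<and> ereal t < \<tau> \<omega> \<longrightarrow> X t \<omega> \<ge> 0"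
  shows "(AE \<omega> in M. filterlim (\<lambda>t. \<bar>X t \<omega>\<bar>) at_top (to_expl (\<tau> \<omega>)))
    \<and> (\<alpha> < 1 \<longrightarrow> (AE \<omega> in M. \<tau> \<omega> = \<infinity> \<and>
          ((\<lambda>t. \<bar>X t \<omega>\<bar> / t powr ((1 - \<beta>) / (1 - \<alpha>)))
             \<longlongrightarrow> (\<rho> * (1 - \<alpha>) / (1 - \<beta>)) powr (1 / (1 - \<alpha>))) at_top))
    \<and> (\<alpha> > 1 \<longrightarrow> (AE \<omega> in M. \<tau> \<omega> \<noteq> \<infinity> \<and>
          (let T = real_of_ereal (\<tau> \<omega>); \<gamma> = 2 * \<beta> / (\<alpha> + 1) in
           ((\<lambda>t. \<bar>X t \<omega>\<bar> /
               (phi_gamma \<gamma> (inv_into {0..} (phi_gamma \<gamma>) T) powr (\<gamma> / (\<alpha> - 1)) * T powr (\<gamma> / 2)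
                / (\<rho> * (\<alpha> - 1) * (T - t)) powr (1 / (\<alpha> - 1))))
             \<longlongrightarrow> 1) (at_left T))))
    \<and> (\<alpha> = 1 \<longrightarrow> (\<exists>G. distributed M lborel G
          (normal_density (x0 * exp (\<rho> / (\<beta> - 1)))
             (sqrt (LBINT s:{1..}. exp (2 * \<rho> * s powr (1 - \<beta>) / (\<beta> - 1))))) \<and>
          (AE \<omega> in M. \<tau> \<omega> = \<infinity> \<and>
             ((\<lambda>t. X t \<omega> / exp (\<rho> * t powr (1 - \<beta>) / (1 - \<beta>))) \<longlongrightarrow> G \<omega>) at_top)))"
proof -
  interpret prob_space M using BM by (simp add: std_brownian_motion_def)
  interpret sde_sol M B \<rho> \<alpha> \<beta> x0 X \<tau> by unfold_locales (use BM rho sol in auto)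
  show ?thesis
  proof (intro conjI impI, goal_cases)
    case 1
    show ?case
    proof (cases \<alpha> "1::real" rule: linorder_cases)
      case less
      from sublinear_case[OF this ab] show ?thesis by eventually_elim (simp add: to_expl_def)
    next
      case greater
      from superlinear_case[OF this ab] show ?thesis by eventually_elim (auto simp: to_expl_def)
    next
      case equal
      have be: "\<beta> < 1" using equal ab by simp
      from linear_case[OF equal be] show ?thesis
      proof (elim exE conjE)
        fix G :: "'a \<Rightarrow> real" and m s
        assume G: "distributed M lborel G (normal_density m s)"
          and lim: "AE \<omega> in M. \<tau> \<omega> = \<infinity> \<and>
             ((\<lambda>t. X t \<omega> / exp (\<rho> * t powr (1 - \<beta>) / (1 - \<beta>))) \<longlongrightarrow> G \<omega>) at_top"
        \<comment> \<open>The limit \<open>G\<close> has a density, so it avoids 0 almost surely,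
          and then the divergent factor \<open>?E\<close> forces the modulus of \<open>X\<close> to
          infinity.\<close>
        have "AE y in lborel. y \<noteq> (0::real)" by (rule AE_lborel_singleton)
        then have "AE \<omega> in M. G \<omega> \<noteq> 0" using distributed_AE2[OF G, of "\<lambda>y. y \<noteq> 0"] by auto
        with lim show ?thesis
        proof eventually_elim
          case (elim \<omega>)
          let ?E = "\<lambda>t. exp (\<rho> * t powr (1 - \<beta>) / (1 - \<beta>))"
          have "((\<lambda>t. \<bar>X t \<omega> / ?E t\<bar>) \<longlongrightarrow> \<bar>G \<omega>\<bar>) at_top" using elim by (intro tendsto_rabs) simp
          moreover have "0 < \<bar>G \<omega>\<bar>" using elim by simp
          moreover have "filterlim ?E at_top at_top" using rho be by real_asymp
          ultimately have "filterlim (\<lambda>t. \<bar>X t \<omega> / ?E t\<bar> * ?E t) at_top at_top"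
            by (rule filterlim_tendsto_pos_mult_at_top)
          then show ?case using elim by (simp add: to_expl_def)
        qed
      qed
    qed
  next
    case 2
    then show ?case using sublinear_case[OF _ ab] by (auto elim: eventually_mono)
  next
    case al: 3
    show ?case
      using superlinear_case[OF al ab]
    proof eventually_elim
      case (elim \<omega>)
      then obtain r where r: "r > 1" "\<tau> \<omega> = ereal r"
        and lim: "((\<lambda>t. \<bar>X t \<omega>\<bar> * (\<rho> * (\<alpha> - 1) * (r - t)) powr (1 / (\<alpha> - 1)) / r powr (\<beta> / (\<alpha> - 1))) \<longlongrightarrow> 1) (at_left r)"
        by blast
      define \<gamma> where "\<gamma> = 2 * \<beta> / (\<alpha> + 1)"
      have "\<gamma> < 1" using al ab by (simp add: \<gamma>_def)
      then have inv: "phi_gamma \<gamma> (inv_into {0..} (phi_gamma \<gamma>) r) = r" using r by (intro phi_gamma_inv) auto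
      \<comment> \<open>Once \<open>phi_gamma\<close> has cancelled against its inverse, the two
        powers of the explosion time combine to the exponent \<open>\<beta> / (\<alpha> - 1)\<close>
        found in \<open>explosion_asymp\<close>.\<close>
      have "\<gamma> / (\<alpha> - 1) + \<gamma> / 2 = \<gamma> * (\<alpha> + 1) / (2 * (\<alpha> - 1))" using al by (simp add: field_simps)
      also have "\<gamma> * (\<alpha> + 1) = 2 * \<beta>" using al by (simp add: \<gamma>_def)
      also have "2 * \<beta> / (2 * (\<alpha> - 1)) = \<beta> / (\<alpha> - 1)" by (rule mult_divide_mult_cancel_left) simp
      finally have "r powr (\<gamma> / (\<alpha> - 1)) * r powr (\<gamma> / 2) = r powr (\<beta> / (\<alpha> - 1))"
        by (simp add: powr_add[symmetric])
      then show ?case using lim r inv by (simp add: \<gamma>_def[symmetric] Let_def)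
    qed
  next
    case 4
    then show ?case using linear_case ab by simp
  qed
qed

end
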